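(* From a name of a non-constant meromorphic function $f$ and a name of an open set $U\subseteq\mathrm{dom}(f)$, one can uniformly compute a name of the open set $f[U]$.
   Context: Computability is in the sense of Type-Two Effectivity. $\hat{\mathbb{C}}=\mathbb{C}\cup\{\infty\}$, and $D_r(z)$ is the open disk of radius $r$ centered at $z$. The basic open sets are the open rectangles whose vertices have rational coordinates, together with the sets $\hat{\mathbb{C}}\setminus\overline{D_r(0)}$ with $r$ rational. Names: - A name of a point $z\in\hat{\mathbb{C}}$ is a list of all basic open sets containing $z$. - A name of an open set $U$ is a list of all basic open sets whose closures lie in $U$. - A name of a partial function $f:\subseteq\hat{\mathbb{C}}\to\hat{\mathbb{C}}$ is an oracle $X\subseteq\mathbb{N}$ together with a code of an oracle Turing machine with one-way output tape. With oracle $X$, this machine converts every name of every $z\in\mathrm{dom}(f)$ into a name of $f(z)$. - "Uniformly computable" means a single Turing machine, given names of the data, writes a name of the output. A meromorphic function is one meromorphic on an open subset of $\hat{\mathbb{C}}$, with values in $\hat{\mathbb{C}}$.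
   Formalization: "Non-constant" is taken to mean not constant on any connected component of dom(f); if f is constant on one component of a disconnected domain, f[U] need not be open (f = 0 on D_1(0), f(z) = z on D_1(5), U = D_1(0)). *)

theory Defs
  imports "HOL-Complex_Analysis.Complex_Analysis" "HOL-Library.Nat_Bijection"
begin

datatype ecomplex = Fin complex | Infty

instantiation ecomplex :: topological_space
begin

definition open_ecomplex :: "ecomplex set \<Rightarrow> bool" where
  "open_ecomplex S \<longleftrightarrow> open {z. Fin z \<in> S} \<and>
     (Infty \<in> S \<longrightarrow> (\<exists>r. \<forall>z. r < norm z \<longrightarrow> Fin z \<in> S))"

instance
proof
  show "open (UNIV :: ecomplex set)" by (simp add: open_ecomplex_def)
next
  fix S T :: "ecomplex set"
  assume S: "open S" and T: "open T"
  have e: "{z. Fin z \<in> S \<inter> T} = {z. Fin z \<in> S} \<inter> {z. Fin z \<in> T}" by blast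
  have o: "open {z. Fin z \<in> S \<inter> T}"
    unfolding e using S T by (intro open_Int) (simp_all add: open_ecomplex_def)
  have i: "\<exists>r. \<forall>z. r < norm z \<longrightarrow> Fin z \<in> S \<inter> T" if inf: "Infty \<in> S \<inter> T"
  proof -
    obtain r1 where r1: "\<forall>z. r1 < norm z \<longrightarrow> Fin z \<in> S"
      using S inf unfolding open_ecomplex_def by blast
    obtain r2 where r2: "\<forall>z. r2 < norm z \<longrightarrow> Fin z \<in> T"
      using T inf unfolding open_ecomplex_def by blast
    have "\<forall>z. max r1 r2 < norm z \<longrightarrow> Fin z \<in> S \<inter> T" using r1 r2 by simp
    then show ?thesis by blast
  qed
  show "open (S \<inter> T)" unfolding open_ecomplex_def using o i by blast
next
  fix K :: "ecomplex set set"
  assume K: "\<forall>S\<in>K. open S"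
  have e: "{z. Fin z \<in> \<Union>K} = (\<Union>S\<in>K. {z. Fin z \<in> S})" by blast
  have o: "open {z. Fin z \<in> \<Union>K}"
    unfolding e using K by (intro open_UN) (simp add: open_ecomplex_def)
  have i: "\<exists>r. \<forall>z. r < norm z \<longrightarrow> Fin z \<in> \<Union>K" if inf: "Infty \<in> \<Union>K"
  proof -
    obtain S where "S \<in> K" "Infty \<in> S" using inf by blast
    then obtain r where "\<forall>z. r < norm z \<longrightarrow> Fin z \<in> S"
      using K unfolding open_ecomplex_def by blast
    then show ?thesis using \<open>S \<in> K\<close> by blast
  qed
  show "open (\<Union>K)" unfolding open_ecomplex_def using o i by blast
qed
end

fun fval :: "ecomplex \<Rightarrow> complex" where
  "fval (Fin w) = w"
| "fval Infty = 0"

definition inf_chart :: "complex \<Rightarrow> ecomplex" where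
  "inf_chart w = (if w = 0 then Infty else Fin (inverse w))"

definition meromorphic_hat :: "(ecomplex \<Rightarrow> ecomplex) \<Rightarrow> ecomplex set \<Rightarrow> bool" where
  "meromorphic_hat f D \<longleftrightarrow>
     open D \<and> continuous_on D f \<and>
     (\<forall>a\<in>D. \<not> a islimpt {z\<in>D. f z = Infty}) \<and>
     (\<lambda>z. fval (f (Fin z))) holomorphic_on {z. Fin z \<in> D \<and> f (Fin z) \<noteq> Infty} \<and>
     (\<lambda>w. fval (f (inf_chart w))) holomorphic_on {w. inf_chart w \<in> D \<and> f (inf_chart w) \<noteq> Infty}"

definition nonconstant_hat :: "(ecomplex \<Rightarrow> ecomplex) \<Rightarrow> ecomplex set \<Rightarrow> bool" where
  "nonconstant_hat f D \<longleftrightarrow>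
     (\<forall>z\<in>D. \<not> (\<exists>c. \<forall>w\<in>connected_component_set D z. f w = c))"

definition rect :: "real \<Rightarrow> real \<Rightarrow> real \<Rightarrow> real \<Rightarrow> ecomplex set" where
  "rect a b c d = {Fin z |z. a < Re z \<and> Re z < b \<and> c < Im z \<and> Im z < d}"

definition outer :: "real \<Rightarrow> ecomplex set" where
  "outer r = insert Infty {Fin z |z. z \<notin> closure (ball 0 r)}"

definition basis :: "ecomplex set set" where
  "basis = {rect (of_rat a) (of_rat b) (of_rat c) (of_rat d) |a b c d. a < b \<and> c < d}
         \<union> {outer (of_rat r) |r. True}"

definition rat_decode :: "nat \<Rightarrow> rat" where
  "rat_decode k = (case prod_decode k of (i, j) \<Rightarrow> Fract (int_decode i) (int_decode j))"

definition pos_rat :: "rat \<Rightarrow> rat" where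
  "pos_rat q = (if 0 < q then q else 1)"

text \<open>Explicit (effective) numbering of the basic open sets; its range is basis.\<close>

definition basic :: "nat \<Rightarrow> ecomplex set" where
  "basic n = (case prod_decode n of (t, m) \<Rightarrow>
     if t = 0 then
       (case prod_decode m of (i, m') \<Rightarrow> case prod_decode m' of (j, m'') \<Rightarrow>
        case prod_decode m'' of (k, l) \<Rightarrow>
          rect (of_rat (rat_decode i)) (of_rat (rat_decode i + pos_rat (rat_decode j)))
               (of_rat (rat_decode k)) (of_rat (rat_decode k + pos_rat (rat_decode l))))
     else outer (of_rat (rat_decode m)))"

text \<open>Sequences list sets: value Suc k lists basic set number k, value 0 is padding.\<close>

definition listed :: "(nat \<Rightarrow> nat) \<Rightarrow> ecomplex set set" where
  "listed p = {basic k |k. \<exists>n. p n = Suc k}"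

definition name_point :: "(nat \<Rightarrow> nat) \<Rightarrow> ecomplex \<Rightarrow> bool" where
  "name_point p z \<longleftrightarrow> listed p = {B \<in> basis. z \<in> B}"

definition name_open :: "(nat \<Rightarrow> nat) \<Rightarrow> ecomplex set \<Rightarrow> bool" where
  "name_open p U \<longleftrightarrow> listed p = {B \<in> basis. closure B \<subseteq> U}"

datatype recf = RZ | RS | RProj nat | RComp recf "recf list" | RPrec recf recf | RMn recf

inductive reval :: "recf \<Rightarrow> nat list \<Rightarrow> nat \<Rightarrow> bool" where
  "reval RZ xs 0"
| "reval RS xs (Suc (case xs of [] \<Rightarrow> 0 | x # _ \<Rightarrow> x))"
| "reval (RProj i) xs (if i < length xs then xs ! i else 0)"
| "length ys = length gs \<Longrightarrow> (\<forall>i<length gs. reval (gs ! i) xs (ys ! i)) \<Longrightarrow>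
     reval f ys y \<Longrightarrow> reval (RComp f gs) xs y"
| "reval f xs y \<Longrightarrow> reval (RPrec f g) (0 # xs) y"
| "reval (RPrec f g) (n # xs) y \<Longrightarrow> reval g (n # y # xs) z \<Longrightarrow>
     reval (RPrec f g) (Suc n # xs) z"
| "reval f (n # xs) 0 \<Longrightarrow> (\<forall>m<n. \<exists>y. 0 < y \<and> reval f (m # xs) y) \<Longrightarrow>
     reval (RMn f) xs n"

fun encode :: "recf \<Rightarrow> nat" where
  "encode RZ = prod_encode (0, 0)"
| "encode RS = prod_encode (1, 0)"
| "encode (RProj i) = prod_encode (2, i)"
| "encode (RComp f gs) = prod_encode (3, prod_encode (encode f, list_encode (map encode gs)))"
| "encode (RPrec f g) = prod_encode (4, prod_encode (encode f, encode g))"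
| "encode (RMn f) = prod_encode (5, encode f)"

definition prog :: "nat \<Rightarrow> recf" where
  "prog e = (if \<exists>P. encode P = e then (THE P. encode P = e) else RZ)"

text \<open>Type-2 machine P with natural-number parameters args and input tapes tapes
  (one-way output): on the first n cells of each tape it writes the word
  list_decode v, which is never retracted; r is the (infinite) output.\<close>

definition t2_out :: "recf \<Rightarrow> nat list \<Rightarrow> (nat \<Rightarrow> nat) list \<Rightarrow> (nat \<Rightarrow> nat) \<Rightarrow> bool" where
  "t2_out P args tapes r \<longleftrightarrow>
     (\<forall>n v. reval P (args @ map (\<lambda>q. list_encode (map q [0..<n])) tapes) v \<longrightarrow>
            list_decode v = map r [0..<length (list_decode v)]) \<and>
     (\<forall>k. \<exists>n v. reval P (args @ map (\<lambda>q. list_encode (map q [0..<n])) tapes) v \<and>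
            k \<le> length (list_decode v))"

definition char_seq :: "nat set \<Rightarrow> nat \<Rightarrow> nat" where
  "char_seq X n = (if n \<in> X then 1 else 0)"

text \<open>(X, e) is a name of the partial function f with domain D: the oracle machine
  with code e and oracle X maps every name of every z in D to a name of f z.\<close>

definition name_fun :: "nat set \<Rightarrow> nat \<Rightarrow> (ecomplex \<Rightarrow> ecomplex) \<Rightarrow> ecomplex set \<Rightarrow> bool" where
  "name_fun X e f D \<longleftrightarrow>
     (\<forall>z\<in>D. \<forall>p. name_point p z \<longrightarrow>
        (\<exists>r. t2_out (prog e) [] [char_seq X, p] r \<and> name_point r (f z)))"

end

theory Submission
  imports Defs
begin

text \<open>
  A connected set V that meets f(G) and misses f of the boundary of G lies in f(G), because f(G)
  is open and f(closure G) is compact; both conditions on V can be certified by finite data.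
  A finite run of the given machine on a word w shows that f maps the intersection of the basic
  sets listed in w into each basic set that the run outputs. The sphere is cut into finitely many
  rational cells, and the closure of a basic set B lies in f(U) once every cell that meets it lies in
  such a set V. Conversely every f(z) with z in U has such a V, because the nonconstant f is open
  and takes the value f(z) only at z near z; compactness then bounds the data needed
  for all of closure B. The machine for f(U) searches through all certificates.
\<close>

section \<open>Total recursive functions on lists of numbers\<close>

text \<open>The obstacle is that a name of f answers only on names of points, while neither a name
  of a point nor any description of D is at hand. But a word may be fed to the machine without
  knowing whether it begins a name of a point of D: it continues to a name of every point that lies
  in all the sets it lists. On such a word the machine may fail to halt, so runs are guessed and
  checked as finite derivations instead of being executed. The geometric checks must be decidable as
  well; inclusion and disjointness are therefore replaced by strict rational inequalities on cells,
  which are sound at every level and become true for all sufficiently fine cells near a suitable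
  point. Beyond some thresholds the data found at one point stay valid when derivations are added,
  the grid is refined or longer prefixes are read, and this is what allows finitely many
  certificates to be merged. Isolation of preimages is essential: if f took the value f(z) on the
  boundary of G, no neighborhood of f(z) could miss the image of that boundary.\<close>

lemma reval_Comp: "reval (RComp f gs) xs w \<longleftrightarrow>
  (\<exists>ys. length ys = length gs \<and> (\<forall>i<length gs. reval (gs ! i) xs (ys ! i)) \<and> reval f ys w)"
  by (subst reval.simps) auto

lemma reval_Prec_0: "reval (RPrec f g) (0 # xs) w \<longleftrightarrow> reval f xs w"
  by (subst reval.simps) auto

lemma reval_Prec_Suc: "reval (RPrec f g) (Suc n # xs) w \<longleftrightarrow>
   (\<exists>y. reval (RPrec f g) (n # xs) y \<and> reval g (n # y # xs) w)"
  by (subst reval.simps) auto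

lemma reval_Mn: "reval (RMn f) xs w \<longleftrightarrow> reval f (w # xs) 0 \<and> (\<forall>m<w. \<exists>y. 0 < y \<and> reval f (m # xs) y)"
  by (subst reval.simps) auto

lemma reval_Z: "reval RZ xs w \<longleftrightarrow> w = 0"
  by (subst reval.simps) auto

lemma reval_S: "reval RS xs w \<longleftrightarrow> w = Suc (case xs of [] \<Rightarrow> 0 | x # _ \<Rightarrow> x)"
  by (subst reval.simps) auto

lemma reval_Proj: "reval (RProj i) xs w \<longleftrightarrow> w = (if i < length xs then xs ! i else 0)"
  by (subst reval.simps) auto

text \<open>\<open>t2_out\<close> constrains every value that a program yields, so the final machine
  needs uniqueness of values and not only existence.\<close>

lemma reval_deterministic: "reval P xs v \<Longrightarrow> reval P xs w \<Longrightarrow> v = w"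
proof (induction arbitrary: w rule: reval.induct)
  case (4 ys gs xs f y)
  obtain ys' where ys': "length ys' = length gs"
    "\<forall>i<length gs. reval (gs ! i) xs (ys' ! i)" "reval f ys' w"
    using 4(5) unfolding reval_Comp by blast
  have "ys ! i = ys' ! i" if "i < length gs" for i
    using 4(3) ys'(2) that by simp
  then have "ys = ys'"
    using 4(1) ys'(1) by (intro nth_equalityI) simp_all
  then show ?case using 4(4)[of w] ys'(3) by simp
next
  case (6 f g n xs y z)
  obtain y' where "reval (RPrec f g) (n # xs) y'" "reval g (n # y' # xs) w"
    using 6(5) unfolding reval_Prec_Suc by blast
  then show ?case using 6(3)[of y'] 6(4)[of w] by simp
next
  case (7 f n xs)
  have w: "reval f (w # xs) 0" "\<forall>m<w. \<exists>y. 0 < y \<and> reval f (m # xs) y"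
    using 7(4) unfolding reval_Mn by simp_all
  show ?case
  proof (cases n w rule: linorder_cases)
    case less
    then obtain y where "0 < y" "reval f (n # xs) y" using w(2) by blast
    then show ?thesis using 7(2)[of y] by simp
  next
    case greater
    then show ?thesis using 7(3) w(1) by fastforce
  qed simp
qed (simp_all only: reval_Z reval_S reval_Proj reval_Prec_0)

text \<open>Programs appear only through their existence, so that closure rules can replace explicit
  code. The arity is fixed because nothing is promised about lists of another length.\<close>

definition total_rec :: "nat \<Rightarrow> (nat list \<Rightarrow> nat) \<Rightarrow> bool" where
  "total_rec k F \<longleftrightarrow> (\<exists>P. \<forall>xs. length xs = k \<longrightarrow> reval P xs (F xs))"

lemma total_rec_cong:
  "total_rec k F \<Longrightarrow> (\<And>xs. length xs = k \<Longrightarrow> F xs = G xs) \<Longrightarrow> total_rec k G"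
  unfolding total_rec_def by metis

lemma total_rec_zero: "total_rec k (\<lambda>_. 0)"
  unfolding total_rec_def by (blast intro: reval.intros(1))

lemma total_rec_nth:
  assumes "i < k" shows "total_rec k (\<lambda>xs. xs ! i)"
  unfolding total_rec_def
proof (intro exI allI impI)
  fix xs :: "nat list" assume "length xs = k"
  then show "reval (RProj i) xs (xs ! i)"
    using reval.intros(3)[of i xs] assms by simp
qed

lemma total_rec_compose:
  assumes F: "total_rec (length Gs) F" and Gs: "\<forall>G\<in>set Gs. total_rec k G"
  shows "total_rec k (\<lambda>xs. F (map (\<lambda>G. G xs) Gs))"
proof -
  obtain P where P: "\<And>ys. length ys = length Gs \<Longrightarrow> reval P ys (F ys)"
    using F unfolding total_rec_def by blast
  obtain Q where Q: "\<And>G xs. G \<in> set Gs \<Longrightarrow> length xs = k \<Longrightarrow> reval (Q G) xs (G xs)"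
    using Gs unfolding total_rec_def by metis
  have "reval (RComp P (map Q Gs)) xs (F (map (\<lambda>G. G xs) Gs))" if "length xs = k" for xs
    using that by (intro reval.intros(4)[where ys="map (\<lambda>G. G xs) Gs"]) (auto intro: P Q)
  then show ?thesis unfolding total_rec_def by blast
qed

lemma total_rec_compose1:
  assumes "total_rec (Suc 0) F" "total_rec k G"
  shows "total_rec k (\<lambda>xs. F [G xs])"
  using total_rec_compose[of "[G]" F k] assms by simp

lemma total_rec_compose2:
  assumes "total_rec 2 F" "total_rec k G" "total_rec k H"
  shows "total_rec k (\<lambda>xs. F [G xs, H xs])"
  using total_rec_compose[of "[G, H]" F k] assms by (simp add: numeral_2_eq_2)

lemma total_rec_Suc:
  assumes "total_rec k G"
  shows "total_rec k (\<lambda>xs. Suc (G xs))"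
proof -
  have "total_rec (Suc 0) (\<lambda>xs. Suc (hd xs))"
    unfolding total_rec_def
  proof (intro exI allI impI)
    fix xs :: "nat list" assume "length xs = Suc 0"
    then show "reval RS xs (Suc (hd xs))"
      using reval.intros(2)[of xs] by (cases xs) auto
  qed
  from total_rec_compose1[OF this assms] show ?thesis by simp
qed

lemma total_rec_rec_nat:
  assumes F: "total_rec k F" and G: "total_rec (Suc (Suc k)) G" and N: "total_rec k N"
  shows "total_rec k (\<lambda>xs. rec_nat (F xs) (\<lambda>n y. G (n # y # xs)) (N xs))"
proof -
  obtain f where f: "\<And>xs. length xs = k \<Longrightarrow> reval f xs (F xs)"
    using F unfolding total_rec_def by blast
  obtain g where g: "\<And>xs. length xs = Suc (Suc k) \<Longrightarrow> reval g xs (G xs)"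
    using G unfolding total_rec_def by blast
  have rec: "reval (RPrec f g) (n # xs) (rec_nat (F xs) (\<lambda>n y. G (n # y # xs)) n)"
    if "length xs = k" for n xs
    by (induction n) (auto intro!: reval.intros(5) reval.intros(6) f g simp: that)
  have "total_rec (Suc k) (\<lambda>zs. rec_nat (F (tl zs)) (\<lambda>n y. G (n # y # tl zs)) (hd zs))"
    unfolding total_rec_def
  proof (intro exI allI impI)
    fix zs :: "nat list" assume "length zs = Suc k"
    then show "reval (RPrec f g) zs (rec_nat (F (tl zs)) (\<lambda>n y. G (n # y # tl zs)) (hd zs))"
      using rec[of "tl zs" "hd zs"] by (cases zs) auto
  qed
  \<comment> \<open>\<open>RPrec\<close> recurses on its first argument; composing with
    \<open>N\<close> followed by all projections puts the counter in front of the unchanged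
    arguments.\<close>
  then have "total_rec k (\<lambda>xs. rec_nat (F (tl (map (\<lambda>G. G xs) (N # map (\<lambda>i xs. xs ! i) [0..<k]))))
      (\<lambda>n y. G (n # y # tl (map (\<lambda>G. G xs) (N # map (\<lambda>i xs. xs ! i) [0..<k]))))
      (hd (map (\<lambda>G. G xs) (N # map (\<lambda>i xs. xs ! i) [0..<k]))))"
    by (intro total_rec_compose[where Gs="N # map (\<lambda>i xs. xs ! i) [0..<k]"])
       (auto intro: N total_rec_nth)
  then show ?thesis
    by (rule total_rec_cong) (auto simp: comp_def map_nth)
qed

lemma total_rec_add:
  assumes "total_rec k G" "total_rec k H"
  shows "total_rec k (\<lambda>xs. G xs + H xs)"
proof -
  have e: "rec_nat b (\<lambda>n y. Suc y) a = a + b" for a b :: nat by (induction a) auto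
  have "total_rec 2 (\<lambda>xs. rec_nat (xs ! 1) (\<lambda>n y. Suc ((n # y # xs) ! 1)) (xs ! 0))"
    by (intro total_rec_rec_nat total_rec_nth total_rec_Suc) auto
  from total_rec_compose2[OF this assms] show ?thesis by (simp add: e)
qed

lemma total_rec_pred:
  assumes "total_rec k G"
  shows "total_rec k (\<lambda>xs. G xs - 1)"
proof -
  have e: "rec_nat 0 (\<lambda>n y. n) a = a - 1" for a :: nat by (cases a) auto
  have "total_rec (Suc 0) (\<lambda>xs. rec_nat 0 (\<lambda>n y. (n # y # xs) ! 0) (xs ! 0))"
    by (intro total_rec_rec_nat total_rec_nth total_rec_zero) auto
  from total_rec_compose1[OF this assms] show ?thesis by (simp add: e)
qed

lemma total_rec_diff:
  assumes "total_rec k G" "total_rec k H"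
  shows "total_rec k (\<lambda>xs. G xs - H xs)"
proof -
  have e: "rec_nat a (\<lambda>n y. y - Suc 0) b = a - b" for a b :: nat by (induction b) auto
  have "total_rec 2 (\<lambda>xs. rec_nat (xs ! 0) (\<lambda>n y. (n # y # xs) ! 1 - 1) (xs ! 1))"
    by (intro total_rec_rec_nat total_rec_nth total_rec_pred) auto
  from total_rec_compose2[OF this assms] show ?thesis by (simp add: e)
qed

lemma total_rec_mult:
  assumes "total_rec k G" "total_rec k H"
  shows "total_rec k (\<lambda>xs. G xs * H xs)"
proof -
  have e: "rec_nat 0 (\<lambda>n y. y + b) a = a * b" for a b :: nat by (induction a) auto
  have "total_rec 2 (\<lambda>xs. rec_nat 0 (\<lambda>n y. (n # y # xs) ! 1 + (n # y # xs) ! 3) (xs ! 0))"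
    by (intro total_rec_rec_nat total_rec_nth total_rec_zero total_rec_add) auto
  from total_rec_compose2[OF this assms] show ?thesis by (simp add: e)
qed

lemma total_rec_triangle:
  assumes "total_rec k G"
  shows "total_rec k (\<lambda>xs. triangle (G xs))"
proof -
  have e: "rec_nat 0 (\<lambda>n y. y + Suc n) a = triangle a" for a :: nat
    by (induction a) auto
  have "total_rec (Suc 0) (\<lambda>xs. rec_nat 0 (\<lambda>n y. (n # y # xs) ! 1 + Suc ((n # y # xs) ! 0)) (xs ! 0))"
    by (intro total_rec_rec_nat total_rec_nth total_rec_zero total_rec_add total_rec_Suc) auto
  then have "total_rec (Suc 0) (\<lambda>xs. rec_nat 0 (\<lambda>n y. y + Suc n) (xs ! 0))" by simp
  from total_rec_compose1[OF this assms] show ?thesis unfolding e by simp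
qed

lemma total_rec_prod_encode:
  assumes "total_rec k G" "total_rec k H"
  shows "total_rec k (\<lambda>xs. prod_encode (G xs, H xs))"
  unfolding prod_encode_def
  using assms by (simp add: total_rec_add total_rec_triangle)

lemma total_rec_if:
  assumes "total_rec k C" "total_rec k G" "total_rec k H"
  shows "total_rec k (\<lambda>xs. if C xs \<noteq> 0 then G xs else H xs)"
proof -
  \<comment> \<open>With truncated subtraction \<open>1 - (1 - C xs)\<close> and
    \<open>1 - C xs\<close> are the indicators of the two cases.\<close>
  have "total_rec k (\<lambda>xs. (1 - (1 - C xs)) * G xs + (1 - C xs) * H xs)"
    using assms
    by (intro total_rec_add total_rec_mult total_rec_diff)
       (auto intro: total_rec_Suc[OF total_rec_zero, simplified])
  then show ?thesis by (rule total_rec_cong) auto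
qed

text \<open>The index of the diagonal of Cantor's pairing on which a number lies.\<close>

definition diagonal :: "nat \<Rightarrow> nat" where
  "diagonal n = rec_nat 0 (\<lambda>n y. if Suc n - (triangle (Suc y) - 1) \<noteq> 0 then Suc y else y) n"

text \<open>\<open>prod_encode (a, b)\<close> is \<open>triangle (a + b) + a\<close>, which lies
  below the next triangular number. The test in \<open>diagonal\<close> says
  \<open>triangle (Suc y) \<le> Suc n\<close> in truncated arithmetic: the index grows exactly when
  the next triangular number is reached.\<close>

lemma diagonal_prod_encode: "diagonal (prod_encode (a, b)) = a + b"
proof -
  have b: "triangle (diagonal n) \<le> n \<and> n < triangle (Suc (diagonal n))" for n
    by (induction n) (auto simp: diagonal_def)
  have mono: "triangle m \<le> triangle n" if "m \<le> n" for m n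
    using that by (induction rule: dec_induct) auto
  let ?n = "prod_encode (a, b)"
  have n: "triangle (a + b) \<le> ?n" "?n < triangle (Suc (a + b))"
    by (auto simp: prod_encode_def)
  have "\<not> Suc (a + b) \<le> diagonal ?n" "\<not> Suc (diagonal ?n) \<le> a + b"
    using mono[of "Suc (a + b)" "diagonal ?n"] mono[of "Suc (diagonal ?n)" "a + b"] n b[of ?n]
    by linarith+
  then show ?thesis by simp
qed

lemma total_rec_diagonal:
  assumes "total_rec k G"
  shows "total_rec k (\<lambda>xs. diagonal (G xs))"
proof -
  have "total_rec (Suc 0) (\<lambda>xs. rec_nat 0 (\<lambda>n y.
      (\<lambda>zs. if Suc (zs ! 0) - (triangle (Suc (zs ! 1)) - 1) \<noteq> 0
        then Suc (zs ! 1) else zs ! 1) (n # y # xs)) (xs ! 0))"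
    by (intro total_rec_rec_nat total_rec_nth total_rec_zero total_rec_if total_rec_diff
        total_rec_Suc total_rec_triangle total_rec_pred) auto
  then have "total_rec (Suc 0) (\<lambda>xs. diagonal (xs ! 0))"
    by (simp only: diagonal_def nth_Cons_0 nth_Cons_Suc One_nat_def)
  from total_rec_compose1[OF this assms] show ?thesis by simp
qed

lemma fst_prod_decode: "fst (prod_decode n) = n - triangle (diagonal n)"
proof -
  obtain a b where "n = prod_encode (a, b)" by (metis prod_decode_inverse surj_pair)
  moreover from this have "fst (prod_decode n) = a" by simp
  ultimately show ?thesis using diagonal_prod_encode[of a b] by (simp add: prod_encode_def)
qed

lemma snd_prod_decode: "snd (prod_decode n) = diagonal n - fst (prod_decode n)"
proof -
  obtain a b where "n = prod_encode (a, b)" by (metis prod_decode_inverse surj_pair)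
  then show ?thesis using diagonal_prod_encode[of a b] by simp
qed

lemma total_rec_fst: "total_rec k G \<Longrightarrow> total_rec k (\<lambda>xs. fst (prod_decode (G xs)))"
  unfolding fst_prod_decode by (intro total_rec_diff total_rec_triangle total_rec_diagonal)

lemma total_rec_snd: "total_rec k G \<Longrightarrow> total_rec k (\<lambda>xs. snd (prod_decode (G xs)))"
  unfolding snd_prod_decode by (intro total_rec_diff total_rec_diagonal total_rec_fst)

section \<open>Computable functions on numbered types\<close>

text \<open>Codes need not be unique (rationals have many), so \<open>dec\<close> has no canonical
  inverse. Surjectivity is what lets a search through all numbers meet every certificate.\<close>

class numbered =
  fixes dec :: "nat \<Rightarrow> 'a"
  assumes surj_dec: "surj dec"

instantiation nat :: numbered
begin
definition "dec = (id :: nat \<Rightarrow> nat)"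
instance by standard (simp add: dec_nat_def)
end

instantiation bool :: numbered
begin
definition "dec n \<longleftrightarrow> n \<noteq> (0 :: nat)"
instance
proof
  have "\<exists>n. b = (dec n :: bool)" for b
    unfolding dec_bool_def by (cases b) auto
  then show "surj (dec :: nat \<Rightarrow> bool)" unfolding surj_def by blast
qed
end

instantiation prod :: (numbered, numbered) numbered
begin
definition "dec n = map_prod dec dec (prod_decode n)"
instance
proof
  have "\<exists>n. p = (dec n :: 'a \<times> 'b)" for p
  proof -
    obtain a b where "fst p = dec a" "snd p = dec b" using surj_dec by (meson surjD)
    then have "p = dec (prod_encode (a, b))"
      by (simp add: dec_prod_def prod_eq_iff)
    then show ?thesis ..
  qed
  then show "surj (dec :: nat \<Rightarrow> 'a \<times> 'b)" unfolding surj_def by blast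
qed
end

instantiation list :: (numbered) numbered
begin
definition "dec n = map dec (list_decode n)"
instance
proof
  have "\<exists>n. xs = (dec n :: 'a list)" for xs
  proof -
    obtain g where "\<And>x :: 'a. dec (g x) = x" using surj_dec by (metis surjD)
    then have "xs = dec (list_encode (map g xs))"
      by (simp add: dec_list_def comp_def)
    then show ?thesis ..
  qed
  then show "surj (dec :: nat \<Rightarrow> 'a list)" unfolding surj_def by blast
qed
end

instantiation int :: numbered
begin
definition "dec = int_decode"
instance by standard (simp add: dec_int_def surj_int_decode)
end

lemma surj_rat_decode: "surj rat_decode"
proof -
  have "\<exists>n. q = rat_decode n" for q
  proof -
    obtain a b where "q = Fract a b" by (cases q)
    then have "q = rat_decode (prod_encode (int_encode a, int_encode b))"
      by (simp add: rat_decode_def)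
    then show ?thesis ..
  qed
  then show ?thesis unfolding surj_def by blast
qed

instantiation rat :: numbered
begin
definition "dec = rat_decode"
instance by standard (simp add: dec_rat_def surj_rat_decode)
end

definition realizes :: "(nat \<Rightarrow> nat) \<Rightarrow> ('a::numbered \<Rightarrow> 'b::numbered) \<Rightarrow> bool" where
  "realizes h f \<longleftrightarrow> total_rec (Suc 0) (\<lambda>xs. h (xs ! 0)) \<and> (\<forall>n. dec (h n) = f (dec n))"

definition computable :: "('a::numbered \<Rightarrow> 'b::numbered) \<Rightarrow> bool" where
  "computable f \<longleftrightarrow> (\<exists>h. realizes h f)"

lemma computableI:
  "total_rec (Suc 0) (\<lambda>xs. h (xs ! 0)) \<Longrightarrow> (\<And>n. dec (h n) = f (dec n)) \<Longrightarrow> computable f"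
  unfolding computable_def realizes_def by blast

lemma computableE:
  assumes "computable f"
  obtains h where "realizes h f"
  using assms unfolding computable_def by blast

lemma realizes_dec: "realizes h f \<Longrightarrow> dec (h n) = f (dec n)"
  unfolding realizes_def by blast

lemma realizes_total_rec: "realizes h f \<Longrightarrow> total_rec k G \<Longrightarrow> total_rec k (\<lambda>xs. h (G xs))"
  using total_rec_compose1[of "\<lambda>xs. h (xs ! 0)" k G] unfolding realizes_def by simp

lemma total_rec_nth_0: "total_rec (Suc 0) (\<lambda>xs. xs ! 0)"
  by (simp add: total_rec_nth)

named_theorems computable_intros

lemma computable_id [computable_intros]: "computable (\<lambda>x. x)"
  by (rule computableI[of "\<lambda>n. n"]) (auto intro: total_rec_nth_0)

lemma total_rec_const: "total_rec k (\<lambda>_. c)"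
  by (induction c) (auto intro: total_rec_zero total_rec_Suc)

lemma computable_const [computable_intros]: "computable (\<lambda>_. c)"
proof -
  obtain n where "c = dec n" using surj_dec by (meson surjD)
  then show ?thesis by (intro computableI[of "\<lambda>_. n"]) (auto intro: total_rec_const)
qed

lemma computable_compose:
  assumes "computable g" "computable f"
  shows "computable (\<lambda>x. g (f x))"
proof -
  obtain h where h: "realizes h f"
    using assms(2) by (rule computableE)
  obtain i where i: "realizes i g"
    using assms(1) by (rule computableE)
  show ?thesis
    by (rule computableI[of "\<lambda>n. i (h n)"]) (auto intro!: realizes_total_rec[OF i] realizes_total_rec[OF h] total_rec_nth_0 simp: realizes_dec[OF i] realizes_dec[OF h])
qed

lemma computable_dec: "computable (dec :: nat \<Rightarrow> 'a::numbered)"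
  by (rule computableI[of "\<lambda>n. n"]) (auto intro: total_rec_nth_0 simp: dec_nat_def)

text \<open>Since \<^const>\<open>dec\<close> is realized by the identity, computability can be checked on codes,
  where functions need not be well defined on the numbered type.\<close>

lemma computable_on_codes:
  assumes "computable (\<lambda>n. f (dec n))"
  shows "computable f"
  using assms unfolding computable_def realizes_def by (simp add: dec_nat_def)

text \<open>Makes the realizer itself available as a computable function on numbers, for arguments
  that use the size of a code.\<close>

lemma computable_realizer:
  assumes "computable f"
  obtains h :: "nat \<Rightarrow> nat" where "computable h" "\<And>n. dec (h n) = f (dec n)"
proof -
  obtain h where h: "realizes h f"
    using assms by (rule computableE)
  have "computable h"
    by (rule computableI[of h]) (auto intro!: realizes_total_rec[OF h] total_rec_nth_0 simp: dec_nat_def)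
  then show thesis using realizes_dec[OF h] that by blast
qed

lemma computable_Pair [computable_intros]:
  assumes "computable f" "computable g"
  shows "computable (\<lambda>x. (f x, g x))"
proof -
  obtain h where h: "realizes h f"
    using assms(1) by (rule computableE)
  obtain i where i: "realizes i g"
    using assms(2) by (rule computableE)
  show ?thesis
    by (rule computableI[of "\<lambda>n. prod_encode (h n, i n)"])
       (auto intro!: realizes_total_rec[OF i] realizes_total_rec[OF h] total_rec_nth_0 total_rec_prod_encode simp: realizes_dec[OF i] realizes_dec[OF h] dec_prod_def)
qed

lemma computable_fst [computable_intros]:
  "computable f \<Longrightarrow> computable (\<lambda>x. fst (f x))"
  by (rule computable_compose[of fst], rule computableI[of "\<lambda>n. fst (prod_decode n)"])
     (auto intro!: total_rec_nth_0 total_rec_fst simp: dec_prod_def)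

lemma computable_snd [computable_intros]:
  "computable f \<Longrightarrow> computable (\<lambda>x. snd (f x))"
  by (rule computable_compose[of snd], rule computableI[of "\<lambda>n. snd (prod_decode n)"])
     (auto intro!: total_rec_nth_0 total_rec_snd simp: dec_prod_def)

lemma computable_compose2:
  assumes "computable (\<lambda>z. g (fst z) (snd z))" "computable f" "computable h"
  shows "computable (\<lambda>x. g (f x) (h x))"
  using computable_compose[OF assms(1) computable_Pair[OF assms(2,3)]] by simp

lemma computable_compose3:
  assumes "computable (\<lambda>z. g (fst z) (fst (snd z)) (snd (snd z)))"
    "computable f" "computable h" "computable k"
  shows "computable (\<lambda>x. g (f x) (h x) (k x))"
  using computable_compose[OF assms(1) computable_Pair[OF assms(2) computable_Pair[OF assms(3,4)]]]
  by simp

lemma computable_Suc [computable_intros]: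
  "computable f \<Longrightarrow> computable (\<lambda>x. Suc (f x))"
  by (rule computable_compose[of Suc], rule computableI[of Suc])
     (auto intro!: total_rec_nth_0 total_rec_Suc simp: dec_nat_def)

lemma computable_rec_nat [computable_intros]:
  assumes F: "computable F" and G: "computable (\<lambda>z. G (fst z) (fst (snd z)) (snd (snd z)))"
    and N: "computable N"
  shows "computable (\<lambda>x. rec_nat (F x) (G x) (N x))"
proof -
  obtain F' where F': "realizes F' F"
    using F by (rule computableE)
  obtain N' where N': "realizes N' N"
    using N by (rule computableE)
  obtain G' where G': "realizes G' (\<lambda>z. G (fst z) (fst (snd z)) (snd (snd z)))"
    using G by (rule computableE)
  let ?h = "\<lambda>n. rec_nat (F' n) (\<lambda>i y. G' (prod_encode (n, prod_encode (i, y)))) (N' n)"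
  have "total_rec (Suc 0) (\<lambda>xs. rec_nat (F' (xs ! 0)) (\<lambda>i y. G' (prod_encode ((i # y # xs) ! 2,
      prod_encode ((i # y # xs) ! 0, (i # y # xs) ! 1)))) (N' (xs ! 0)))"
    by (intro total_rec_rec_nat[where G="\<lambda>zs. G' (prod_encode (zs ! 2, prod_encode (zs ! 0, zs ! 1)))"]
        realizes_total_rec[OF F'] realizes_total_rec[OF N'] realizes_total_rec[OF G'] total_rec_prod_encode total_rec_nth) auto
  then have r: "total_rec (Suc 0) (\<lambda>xs. ?h (xs ! 0))" by simp
  have "dec (rec_nat (F' n) (\<lambda>i y. G' (prod_encode (n, prod_encode (i, y)))) m)
      = rec_nat (F (dec n)) (G (dec n)) m" for n m
    by (induction m) (simp_all add: realizes_dec[OF F'] realizes_dec[OF G'] dec_prod_def dec_nat_def)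
  then show ?thesis by (intro computableI[OF r]) (use realizes_dec[OF N'] in \<open>simp add: dec_nat_def\<close>)
qed

lemma computable_if [computable_intros]:
  assumes "computable P" "computable f" "computable g"
  shows "computable (\<lambda>x. if P x then f x else g x)"
proof -
  obtain p where p: "realizes p P"
    using assms(1) by (rule computableE)
  obtain h where h: "realizes h f"
    using assms(2) by (rule computableE)
  obtain i where i: "realizes i g"
    using assms(3) by (rule computableE)
  show ?thesis
    using realizes_dec[OF p]
    by (intro computableI[of "\<lambda>n. if p n \<noteq> 0 then h n else i n"] total_rec_if
          realizes_total_rec[OF p] realizes_total_rec[OF h] realizes_total_rec[OF i] total_rec_nth_0)
       (simp add: realizes_dec[OF i] realizes_dec[OF h] dec_bool_def)
qed

lemma computable_Not [computable_intros]:
  "computable P \<Longrightarrow> computable (\<lambda>x. \<not> P x)"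
  using computable_if[of P "\<lambda>_. False" "\<lambda>_. True", OF _ computable_const computable_const]
  by (simp only: if_bool_eq_conj) simp

lemma computable_conj [computable_intros]:
  "computable P \<Longrightarrow> computable Q \<Longrightarrow> computable (\<lambda>x. P x \<and> Q x)"
  using computable_if[of P Q "\<lambda>_. False", OF _ _ computable_const]
  by (simp only: if_bool_eq_disj) (simp add: conj_commute)

lemma computable_disj [computable_intros]:
  "computable P \<Longrightarrow> computable Q \<Longrightarrow> computable (\<lambda>x. P x \<or> Q x)"
  using computable_Not[OF computable_conj[OF computable_Not computable_Not]] by simp

lemma computable_imp [computable_intros]:
  "computable P \<Longrightarrow> computable Q \<Longrightarrow> computable (\<lambda>x. P x \<longrightarrow> Q x)"
  using computable_disj[of "\<lambda>x. \<not> P x" Q] by (simp add: computable_Not)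

lemma computable_add_nat [computable_intros]:
  fixes f g :: "'a::numbered \<Rightarrow> nat"
  shows "computable f \<Longrightarrow> computable g \<Longrightarrow> computable (\<lambda>x. f x + g x)"
  by (rule computable_compose2[of "(+)"],
      rule computableI[of "\<lambda>n. fst (prod_decode n) + snd (prod_decode n)"])
     (auto intro!: total_rec_nth_0 total_rec_add total_rec_fst total_rec_snd
       simp: dec_nat_def dec_prod_def)

lemma computable_diff_nat [computable_intros]:
  fixes f g :: "'a::numbered \<Rightarrow> nat"
  shows "computable f \<Longrightarrow> computable g \<Longrightarrow> computable (\<lambda>x. f x - g x)"
  by (rule computable_compose2[of "(-)"],
      rule computableI[of "\<lambda>n. fst (prod_decode n) - snd (prod_decode n)"])
     (auto intro!: total_rec_nth_0 total_rec_diff total_rec_fst total_rec_snd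
       simp: dec_nat_def dec_prod_def)

lemma computable_mult_nat [computable_intros]:
  fixes f g :: "'a::numbered \<Rightarrow> nat"
  shows "computable f \<Longrightarrow> computable g \<Longrightarrow> computable (\<lambda>x. f x * g x)"
  by (rule computable_compose2[of "(*)"],
      rule computableI[of "\<lambda>n. fst (prod_decode n) * snd (prod_decode n)"])
     (auto intro!: total_rec_nth_0 total_rec_mult total_rec_fst total_rec_snd
       simp: dec_nat_def dec_prod_def)

lemma computable_nonzero: "computable f \<Longrightarrow> computable (\<lambda>x. f x \<noteq> (0::nat))"
  by (rule computable_compose[of "\<lambda>n. n \<noteq> 0"], rule computableI[of "\<lambda>n. n"])
     (auto intro!: total_rec_nth_0 simp: dec_nat_def dec_bool_def)

lemma computable_less_nat [computable_intros]:
  fixes f g :: "'a::numbered \<Rightarrow> nat"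
  shows "computable f \<Longrightarrow> computable g \<Longrightarrow> computable (\<lambda>x. f x < g x)"
  using computable_nonzero[OF computable_diff_nat[of g f]] by (simp add: not_le)

lemma computable_le_nat [computable_intros]:
  fixes f g :: "'a::numbered \<Rightarrow> nat"
  shows "computable f \<Longrightarrow> computable g \<Longrightarrow> computable (\<lambda>x. f x \<le> g x)"
  using computable_Not[OF computable_less_nat[of g f]] by (simp add: not_less)

lemma computable_eq_nat [computable_intros]:
  fixes f g :: "'a::numbered \<Rightarrow> nat"
  shows "computable f \<Longrightarrow> computable g \<Longrightarrow> computable (\<lambda>x. f x = g x)"
  using computable_conj[OF computable_le_nat[of f g] computable_le_nat[of g f]]
  unfolding order_eq_iff[of "f _" "g _"] by simp

lemma computable_All_less [computable_intros]:
  fixes P :: "'a::numbered \<Rightarrow> nat \<Rightarrow> bool"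
  assumes N: "computable N" and P: "computable (\<lambda>z. P (fst z) (snd z))"
  shows "computable (\<lambda>x. \<forall>i<N x. P x i)"
proof -
  have P': "computable (\<lambda>z. P (fst z) (fst (snd z)))"
    by (rule computable_compose2[of P, OF P]) (intro computable_intros)+
  have e: "(\<forall>i<n. Q i) = rec_nat True (\<lambda>i b. b \<and> Q i) n" for n :: nat and Q
    by (induction n) (auto simp: less_Suc_eq)
  have "computable (\<lambda>x. rec_nat True (\<lambda>i b. b \<and> P x i) (N x))" by (intro computable_intros N P')
  then show ?thesis by (simp only: e)
qed

lemma computable_Ex_less [computable_intros]:
  fixes P :: "'a::numbered \<Rightarrow> nat \<Rightarrow> bool"
  assumes N: "computable N" and P: "computable (\<lambda>z. P (fst z) (snd z))"
  shows "computable (\<lambda>x. \<exists>i<N x. P x i)"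
proof -
  have "computable (\<lambda>x. \<not> (\<forall>i<N x. \<not> P x i))" by (intro computable_intros N P)
  then show ?thesis by simp
qed

section \<open>Pairs and lists, folds and bounded search\<close>

lemma computable_prod_decode [computable_intros]:
  "computable f \<Longrightarrow> computable (\<lambda>x. prod_decode (f x))"
  by (rule computable_compose[of prod_decode], rule computableI[of "\<lambda>n. n"])
     (auto intro!: total_rec_nth_0 simp: dec_nat_def dec_prod_def prod.map_id0)

lemma computable_list_decode [computable_intros]:
  "computable f \<Longrightarrow> computable (\<lambda>x. list_decode (f x))"
  by (rule computable_compose[of list_decode], rule computableI[of "\<lambda>n. n"])
     (auto intro!: total_rec_nth_0 simp: dec_nat_def dec_list_def)

lemma computable_list_encode [computable_intros]:
  "computable f \<Longrightarrow> computable (\<lambda>x. list_encode (f x))"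
  by (rule computable_compose[of list_encode], rule computableI[of "\<lambda>n. n"])
     (auto intro!: total_rec_nth_0 simp: dec_nat_def dec_list_def)

lemma computable_Cons [computable_intros]:
  assumes "computable f" "computable g"
  shows "computable (\<lambda>x. f x # g x)"
  by (rule computable_compose2[of "(#)"], rule computableI[of Suc])
     (auto intro!: total_rec_nth_0 total_rec_Suc assms simp: dec_list_def dec_prod_def
       split: prod.splits)

lemma computable_case_list [computable_intros]:
  assumes L: "computable L" and A: "computable A"
    and B: "computable (\<lambda>z. B (fst z) (fst (snd z)) (snd (snd z)))"
  shows "computable (\<lambda>x. case L x of [] \<Rightarrow> A x | y # ys \<Rightarrow> B x y ys)"
proof -
  obtain l where l: "realizes l L"
    using L by (rule computableE)
  obtain a where a: "realizes a A"
    using A by (rule computableE)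
  obtain b where b: "realizes b (\<lambda>z. B (fst z) (fst (snd z)) (snd (snd z)))"
    using B by (rule computableE)
  show ?thesis
  proof (rule computableI)
    show "total_rec (Suc 0) (\<lambda>xs. (\<lambda>n. if l n \<noteq> 0 then b (prod_encode (n, l n - 1)) else a n) (xs ! 0))"
      by (intro total_rec_if realizes_total_rec[OF l] realizes_total_rec[OF b]
          realizes_total_rec[OF a] total_rec_prod_encode total_rec_pred total_rec_nth_0)
    fix n
    show "dec (if l n \<noteq> 0 then b (prod_encode (n, l n - 1)) else a n) =
      (case L (dec n) of [] \<Rightarrow> A (dec n) | y # ys \<Rightarrow> B (dec n) y ys)"
    proof (cases "l n")
      case 0
      then show ?thesis by (simp add: realizes_dec[OF a] dec_list_def flip: realizes_dec[OF l])
    next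
      case (Suc m)
      then show ?thesis
        by (simp add: realizes_dec[OF b] dec_list_def dec_prod_def flip: realizes_dec[OF l] split: prod.splits)
    qed
  qed
qed

text \<open>Provides a bound on the number of loop iterations: a list is never longer than its
  code.\<close>

lemma length_list_decode_le: "length (list_decode n) \<le> n"
proof (induction n rule: list_decode.induct)
  case (2 n)
  obtain a b where ab: "prod_decode n = (a, b)" by fastforce
  then have "b \<le> n" by (metis le_prod_encode_2 prod_decode_inverse)
  then show ?case using 2[of a b] ab by simp
qed simp

text \<open>The fold becomes a loop on pairs of accumulator and remaining list. Once the list is
  empty the step is idle, so any count that is at least the length will do, and the code of the list
  is such a count. Since a list may have several codes, the count is no function of the list; this
  forces the passage to codes.\<close>

lemma computable_foldl [computable_intros]:
  assumes G: "computable (\<lambda>z. G (fst z) (fst (snd z)) (snd (snd z)))"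
    and A: "computable A" and L: "computable L"
  shows "computable (\<lambda>x. foldl (G x) (A x) (L x))"
proof (rule computable_on_codes)
  obtain l :: "nat \<Rightarrow> nat" where l: "computable l" "\<And>n. dec (l n) = L (dec n)"
    using computable_realizer[OF L] by metis
  define step where "step = (\<lambda>x q. case snd q of [] \<Rightarrow> (fst q, []) | y # ys \<Rightarrow> (G x (fst q) y, ys))"
  have step: "(step x ^^ m) (a, ys) = (foldl (G x) a ys, [])" if "length ys \<le> m" for x a ys m
    using that
  proof (induction m arbitrary: a ys)
    case (Suc m)
    then show ?case by (cases ys) (auto simp: step_def funpow_Suc_right simp del: funpow.simps)
  qed simp
  have rec: "rec_nat b (\<lambda>_. g) m = (g ^^ m) b" for b :: "'b \<times> 'c list" and g m
    by (induction m) auto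
  have "fst (rec_nat (A (dec n), L (dec n)) (\<lambda>_. step (dec n)) (l n)) = foldl (G (dec n)) (A (dec n)) (L (dec n))" for n
  proof -
    have "length (L (dec n)) \<le> l n"
      using length_list_decode_le[of "l n"] by (simp add: dec_list_def flip: l(2))
    then show ?thesis by (simp add: rec step)
  qed
  moreover have "computable (\<lambda>n. fst (rec_nat (A (dec n), L (dec n)) (\<lambda>_. step (dec n)) (l n)))"
    unfolding step_def
    by (intro computable_intros l(1) computable_compose[OF A] computable_compose[OF L]
        computable_compose3[of G, OF G] computable_compose[OF computable_dec])
  ultimately show "computable (\<lambda>n. foldl (G (dec n)) (A (dec n)) (L (dec n)))" by simp
qed

lemma computable_length [computable_intros]:
  assumes "computable L" shows "computable (\<lambda>x. length (L x))"
proof -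
  have e: "foldl (\<lambda>n _. Suc n) m xs = m + length xs" for m and xs :: "'b list"
    by (induction xs arbitrary: m) auto
  have "computable (\<lambda>x. foldl (\<lambda>n _. Suc n) 0 (L x))" by (intro computable_intros assms)
  then show ?thesis by (simp add: e)
qed

lemma computable_Bex_list [computable_intros]:
  assumes L: "computable L" and P: "computable (\<lambda>z. P (fst z) (snd z))"
  shows "computable (\<lambda>x. \<exists>t\<in>set (L x). P x t)"
proof -
  have P': "computable (\<lambda>z. P (fst z) (snd (snd z)))"
    by (rule computable_compose2[of P, OF P]) (intro computable_intros)+
  have e: "foldl (\<lambda>b t. b \<or> Q t) c ts \<longleftrightarrow> c \<or> (\<exists>t\<in>set ts. Q t)" for Q c and ts :: "'b list"
    by (induction ts arbitrary: c) auto
  have "computable (\<lambda>x. foldl (\<lambda>b t. b \<or> P x t) False (L x))" by (intro computable_intros L P')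
  then show ?thesis by (simp add: e)
qed

lemma computable_Ball_list [computable_intros]:
  assumes L: "computable L" and P: "computable (\<lambda>z. P (fst z) (snd z))"
  shows "computable (\<lambda>x. \<forall>t\<in>set (L x). P x t)"
proof -
  have "computable (\<lambda>x. \<not> (\<exists>t\<in>set (L x). \<not> P x t))" by (intro computable_intros L P)
  then show ?thesis by simp
qed

lemma computable_rev [computable_intros]:
  assumes "computable L" shows "computable (\<lambda>x. rev (L x))"
proof -
  have e: "foldl (\<lambda>ys y. y # ys) zs xs = rev xs @ zs" for zs xs :: "'b list"
    by (induction xs arbitrary: zs) auto
  have "computable (\<lambda>x. foldl (\<lambda>ys y. y # ys) [] (L x))" by (intro computable_intros assms)
  then show ?thesis by (simp add: e)
qed

lemma computable_drop [computable_intros]: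
  assumes "computable n" "computable L"
  shows "computable (\<lambda>x. drop (n x) (L x))"
proof -
  have e: "rec_nat xs (\<lambda>_ ys. case ys of [] \<Rightarrow> [] | z # zs \<Rightarrow> zs) m = drop m xs" for m and xs :: "'b list"
    by (induction m) (auto simp: drop_Suc tl_drop list.case_eq_if split: list.splits)
  have "computable (\<lambda>x. rec_nat (L x) (\<lambda>_ ys. case ys of [] \<Rightarrow> [] | z # zs \<Rightarrow> zs) (n x))"
    by (intro computable_intros assms)
  then show ?thesis by (simp add: e)
qed

lemma computable_take [computable_intros]:
  assumes "computable n" "computable L"
  shows "computable (\<lambda>x. take (n x) (L x))"
proof -
  have "take m xs = rev (drop (length xs - m) (rev xs))" for m and xs :: "'b list"
    by (metis rev_rev_ident rev_take)
  moreover have "computable (\<lambda>x. rev (drop (length (L x) - n x) (rev (L x))))"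
    by (intro computable_intros assms)
  ultimately show ?thesis by simp
qed

lemma computable_map_upt [computable_intros]:
  assumes n: "computable n" and f: "computable (\<lambda>z. f (fst z) (snd z))"
  shows "computable (\<lambda>x. map (f x) [0..<n x])"
proof -
  have f': "computable (\<lambda>z. f (fst z) (fst (snd z)))"
    by (rule computable_compose2[of f, OF f]) (intro computable_intros)+
  have e: "rev (rec_nat [] (\<lambda>i ys. g i # ys) m) = map g [0..<m]" for m and g :: "nat \<Rightarrow> 'b"
    by (induction m) auto
  have "computable (\<lambda>x. rev (rec_nat [] (\<lambda>i ys. f x i # ys) (n x)))"
    by (intro computable_intros n f')
  then show ?thesis by (simp only: e)
qed

lemma computable_eq_nat_list [computable_intros]:
  fixes f g :: "'a::numbered \<Rightarrow> nat list"
  assumes "computable f" "computable g"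
  shows "computable (\<lambda>x. f x = g x)"
proof -
  have "computable (\<lambda>x. list_encode (f x) = list_encode (g x))" by (intro computable_intros assms)
  then show ?thesis by (simp add: list_encode_eq)
qed

section \<open>Arithmetic of integers and rationals\<close>

lemma computable_half: "computable (\<lambda>n::nat. n div 2)"
proof -
  have e: "rec_nat 0 (\<lambda>i y. if 2 * Suc y \<le> Suc i then Suc y else y) n = n div 2" for n
    by (induction n) auto
  have "computable (\<lambda>n. rec_nat 0 (\<lambda>i y. if 2 * Suc y \<le> Suc i then Suc y else y) n)"
    by (intro computable_intros)
  then show ?thesis unfolding e .
qed

text \<open>\<open>int_decode\<close> puts a natural number a at code 2a and -(a + 1) at code 2a +
  1. Integer operations are reduced to the positive part \<open>nat a\<close> and the negative part
  \<open>nat (- a)\<close>, both read off from the code.\<close>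

lemma computable_nat_int [computable_intros]:
  assumes "computable f" shows "computable (\<lambda>x. nat (f x))"
proof (rule computable_compose[OF _ assms], rule computable_on_codes)
  have e: "nat (dec n) = (if 2 * (n div 2) = n then n div 2 else 0)" for n
    by (auto simp: dec_int_def int_decode_def sum_decode_def)
  show "computable (\<lambda>n. nat (dec n))"
    unfolding e by (intro computable_intros computable_half)
qed

text \<open>The way back from a pair of natural numbers to an integer. A negative difference -(k +
  1) has the code 2k + 1, which is \<open>2 * (b - a) - 1\<close>.\<close>

lemma computable_int_diff:
  assumes "computable f" "computable g"
  shows "computable (\<lambda>x. int (f x) - int (g x))"
proof -
  have e: "int a - int b = dec (if b \<le> a then 2 * (a - b) else 2 * (b - a) - 1)" for a b
  proof (cases "b \<le> a")
    case False
    then obtain k where "b = Suc (a + k)" by (metis less_iff_Suc_add not_le)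
    then show ?thesis by (simp add: dec_int_def int_decode_def sum_decode_def)
  qed (simp add: dec_int_def int_decode_def sum_decode_def)
  show ?thesis unfolding e
    by (intro computable_compose[OF computable_dec] computable_intros assms)
qed

lemma computable_int [computable_intros]:
  assumes "computable f" shows "computable (\<lambda>x. int (f x))"
  using computable_int_diff[OF assms computable_const[of 0]] by simp

lemma computable_nat_uminus:
  assumes "computable f" shows "computable (\<lambda>x. nat (- f x))"
proof (rule computable_compose[OF _ assms], rule computable_on_codes)
  have e: "nat (- dec n) = (if 2 * (n div 2) = n then 0 else Suc (n div 2))" for n
    by (cases "even n") (auto simp: dec_int_def int_decode_def sum_decode_def elim!: oddE)
  show "computable (\<lambda>n. nat (- dec n))"
    unfolding e by (intro computable_intros computable_half)
qed

lemma computable_uminus_int [computable_intros]: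
  assumes "computable f" shows "computable (\<lambda>x. - f x :: int)"
proof -
  have "int (nat (- a)) - int (nat a) = - a" for a by simp
  moreover have "computable (\<lambda>x. int (nat (- f x)) - int (nat (f x)))"
    by (intro computable_int_diff computable_nat_uminus computable_nat_int assms)
  ultimately show ?thesis by (simp only:)
qed

lemma computable_add_int [computable_intros]:
  assumes "computable f" "computable g" shows "computable (\<lambda>x. f x + g x :: int)"
proof -
  have e: "a + b = int (nat a + nat b) - int (nat (- a) + nat (- b))" for a b by simp
  show ?thesis unfolding e
    by (intro computable_int_diff computable_intros assms)
qed

lemma computable_mult_int [computable_intros]:
  assumes "computable f" "computable g" shows "computable (\<lambda>x. f x * g x :: int)"
proof -
  have e: "a * b = int (nat a * nat b + nat (- a) * nat (- b)) - int (nat a * nat (- b) + nat (- a) * nat b)" for a b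
    by (cases "0 \<le> a"; cases "0 \<le> b") (simp_all add: not_le)
  show ?thesis unfolding e
    by (intro computable_int_diff computable_intros assms)
qed

lemma computable_less_int [computable_intros]:
  assumes "computable f" "computable g" shows "computable (\<lambda>x. f x < (g x :: int))"
proof -
  have e: "a < b \<longleftrightarrow> nat a + nat (- b) < nat b + nat (- a)" for a b by arith
  show ?thesis unfolding e by (intro computable_intros assms)
qed

lemma computable_eq_0_int:
  assumes "computable f" shows "computable (\<lambda>x. f x = (0 :: int))"
proof -
  have e: "a = 0 \<longleftrightarrow> nat a + nat (- a) = 0" for a by arith
  show ?thesis unfolding e by (intro computable_intros assms)
qed

lemma computable_Fract [computable_intros]:
  assumes "computable f" "computable g" shows "computable (\<lambda>x. Fract (f x) (g x))"
  by (rule computable_compose2[of Fract, OF _ assms], rule computableI[of "\<lambda>n. n"])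
     (auto intro: total_rec_nth_0 simp: dec_rat_def rat_decode_def dec_prod_def dec_int_def split: prod.splits)

text \<open>A code may carry the denominator 0, and \<open>Fract a 0\<close> is 0 by convention.
  Reading such a code as 0/1 gives the nonzero denominators that the rules for sums and comparisons
  of fractions require.\<close>

definition rat_num :: "nat \<Rightarrow> int" where
  "rat_num n = (let z = dec n in if snd z = (0::int) then 0 else fst z)"

definition rat_den :: "nat \<Rightarrow> int" where
  "rat_den n = (let z :: int \<times> int = dec n in if snd z = 0 then 1 else snd z)"

lemma rat_den_nonzero: "rat_den n \<noteq> 0"
  by (auto simp: rat_den_def Let_def)

lemma dec_rat: "dec n = Fract (rat_num n) (rat_den n)"
  by (auto simp: dec_rat_def rat_decode_def rat_num_def rat_den_def dec_prod_def dec_int_def Let_def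
      rat_number_collapse split: prod.splits)

lemma computable_rat_num: "computable f \<Longrightarrow> computable (\<lambda>x. rat_num (f x))"
  unfolding rat_num_def Let_def
  by (intro computable_intros computable_eq_0_int computable_compose[OF computable_dec])

lemma computable_rat_den: "computable f \<Longrightarrow> computable (\<lambda>x. rat_den (f x))"
  unfolding rat_den_def Let_def
  by (intro computable_intros computable_eq_0_int computable_compose[OF computable_dec])

text \<open>Numerators and denominators used here belong to codes, not to rational numbers, so an
  operation is verified on codes and then transferred.\<close>

lemma computable_rat_op:
  assumes "computable (\<lambda>z. F (dec (fst z) :: rat) (dec (snd z) :: rat))" "computable f" "computable g"
  shows "computable (\<lambda>x. F (f x) (g x))"
proof (rule computable_compose2[of F, OF computable_on_codes assms(2,3)])
  have e: "F (fst (dec n)) (snd (dec n)) = (\<lambda>z. F (dec (fst z)) (dec (snd z))) (prod_decode n)" for n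
    by (simp add: dec_prod_def)
  show "computable (\<lambda>n. F (fst (dec n)) (snd (dec n)))"
    unfolding e by (rule computable_compose[OF assms(1)]) (intro computable_intros)
qed

lemmas computable_rat_intros = computable_intros computable_rat_num computable_rat_den

lemma computable_add_rat [computable_intros]:
  "computable f \<Longrightarrow> computable g \<Longrightarrow> computable (\<lambda>x. f x + g x :: rat)"
  by (rule computable_rat_op[of "(+)"], unfold dec_rat add_rat[OF rat_den_nonzero rat_den_nonzero],
      intro computable_rat_intros)

lemma computable_mult_rat [computable_intros]:
  "computable f \<Longrightarrow> computable g \<Longrightarrow> computable (\<lambda>x. f x * g x :: rat)"
  by (rule computable_rat_op[of "(*)"], unfold dec_rat mult_rat, intro computable_rat_intros)

lemma computable_less_rat [computable_intros]:
  "computable f \<Longrightarrow> computable g \<Longrightarrow> computable (\<lambda>x. f x < (g x :: rat))"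
  by (rule computable_rat_op[of "(<)"], unfold dec_rat less_rat[OF rat_den_nonzero rat_den_nonzero],
      intro computable_rat_intros)

lemma computable_le_rat [computable_intros]:
  "computable f \<Longrightarrow> computable g \<Longrightarrow> computable (\<lambda>x. f x \<le> (g x :: rat))"
  using computable_Not[OF computable_less_rat[of g f]] by (simp add: not_less)

lemma computable_diff_rat [computable_intros]:
  "computable f \<Longrightarrow> computable g \<Longrightarrow> computable (\<lambda>x. f x - g x :: rat)"
  using computable_add_rat[OF _ computable_mult_rat[OF computable_const[of "- 1"]], of f g] by simp

lemma computable_rat_decode [computable_intros]:
  "computable f \<Longrightarrow> computable (\<lambda>x. rat_decode (f x))"
  using computable_compose[OF computable_dec[where 'a=rat], of f] by (simp only: dec_rat_def)

lemma computable_pos_rat [computable_intros]: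
  "computable f \<Longrightarrow> computable (\<lambda>x. pos_rat (f x))"
  unfolding pos_rat_def by (intro computable_intros)

section \<open>Finite derivations of evaluations\<close>

text \<open>One rule of \<open>reval\<close> read backwards, with entries (program code, arguments,
  value) of \<open>d\<close> as premises. Quantifiers range only over members of \<open>d\<close> or
  below a number, and \<open>drop\<close> replaces indexing, so the closure rules for computability
  apply.\<close>

definition justified :: "(nat \<times> nat list \<times> nat) list \<Rightarrow> nat \<Rightarrow> nat list \<Rightarrow> nat \<Rightarrow> bool" where
  "justified d e xs v \<longleftrightarrow>
    (let t = fst (prod_decode e); a = snd (prod_decode e);
         f = fst (prod_decode a); g = snd (prod_decode a);
         mem = (\<lambda>e xs v. \<exists>s\<in>set d. fst s = e \<and> fst (snd s) = xs \<and> snd (snd s) = v) in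
      t = 0 \<and> v = 0 \<or>
      t = 1 \<and> v = Suc (case xs of [] \<Rightarrow> 0 | x # _ \<Rightarrow> x) \<or>
      t = 2 \<and> v = (case drop a xs of [] \<Rightarrow> 0 | x # _ \<Rightarrow> x) \<or>
      t = 3 \<and> (\<exists>s\<in>set d. fst s = f \<and> length (fst (snd s)) = length (list_decode g) \<and> snd (snd s) = v \<and>
        (\<forall>i<length (list_decode g). case drop i (list_decode g) of [] \<Rightarrow> False | h # _ \<Rightarrow>
           (case drop i (fst (snd s)) of [] \<Rightarrow> False | y # _ \<Rightarrow> mem h xs y))) \<or>
      t = 4 \<and> (case xs of [] \<Rightarrow> False | n # ys \<Rightarrow>
        if n = 0 then mem f ys v
        else \<exists>s\<in>set d. fst s = e \<and> fst (snd s) = (n - 1) # ys \<and> mem g ((n - 1) # snd (snd s) # ys) v) \<or>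
      t = 5 \<and> mem a (v # xs) 0 \<and>
        (\<forall>m<v. \<exists>s\<in>set d. fst s = a \<and> fst (snd s) = m # xs \<and> 0 < snd (snd s)))"

text \<open>Premises stand after conclusions in the list. This excludes circular justifications and
  makes soundness an induction on the list.\<close>

definition derivation :: "(nat \<times> nat list \<times> nat) list \<Rightarrow> bool" where
  "derivation d \<longleftrightarrow> (\<forall>i<length d. case drop i d of [] \<Rightarrow> True
     | s # d' \<Rightarrow> justified d' (fst s) (fst (snd s)) (snd (snd s)))"

lemma computable_justified:
  assumes "computable d" "computable e" "computable xs" "computable v"
  shows "computable (\<lambda>x. justified (d x) (e x) (xs x) (v x))"
proof -
  have "computable (\<lambda>z. justified (fst z) (fst (snd z)) (fst (snd (snd z))) (snd (snd (snd z))))"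
    unfolding justified_def Let_def by (intro computable_intros)
  from computable_compose[OF this, of "\<lambda>x. (d x, e x, xs x, v x)"] show ?thesis
    by (simp add: computable_Pair assms)
qed

lemma computable_derivation:
  "computable f \<Longrightarrow> computable (\<lambda>x. derivation (f x))"
  by (rule computable_compose[of derivation], unfold derivation_def)
     (intro computable_intros computable_justified)

lemma derivation_Nil: "derivation []"
  by (simp add: derivation_def)

lemma derivation_Cons: "derivation (s # d) \<longleftrightarrow>
    justified d (fst s) (fst (snd s)) (snd (snd s)) \<and> derivation d"
  unfolding derivation_def by (auto simp: All_less_Suc2)

lemma triple_in_set_iff: "(\<exists>s\<in>set d. fst s = e \<and> fst (snd s) = xs \<and> snd (snd s) = v) \<longleftrightarrow> (e, xs, v) \<in> set d"
  by force

lemma justified_encode: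
  "justified d (encode RZ) xs v \<longleftrightarrow> v = 0"
  "justified d (encode RS) xs v \<longleftrightarrow> v = Suc (case xs of [] \<Rightarrow> 0 | x # _ \<Rightarrow> x)"
  "justified d (encode (RProj i)) xs v \<longleftrightarrow> v = (if i < length xs then xs ! i else 0)"
  "justified d (encode (RComp f gs)) xs v \<longleftrightarrow>
    (\<exists>ys. (encode f, ys, v) \<in> set d \<and> length ys = length gs \<and>
      (\<forall>i<length gs. (encode (gs ! i), xs, ys ! i) \<in> set d))"
  "justified d (encode (RPrec f g)) xs v \<longleftrightarrow> (case xs of [] \<Rightarrow> False
    | 0 # ys \<Rightarrow> (encode f, ys, v) \<in> set d
    | Suc n # ys \<Rightarrow> (\<exists>y. (encode (RPrec f g), n # ys, y) \<in> set d \<and> (encode g, n # y # ys, v) \<in> set d))"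
  "justified d (encode (RMn f)) xs v \<longleftrightarrow> (encode f, v # xs, 0) \<in> set d \<and>
    (\<forall>m<v. \<exists>y. (encode f, m # xs, y) \<in> set d \<and> 0 < y)"
proof -
  have drop: "(case drop i ys of [] \<Rightarrow> b | y # _ \<Rightarrow> h y) = (if i < length ys then h (ys ! i) else b)"
    for i and ys :: "nat list" and b :: 'z and h
    by (cases "i < length ys") (simp_all add: Cons_nth_drop_Suc[symmetric])
  show "justified d (encode RZ) xs v \<longleftrightarrow> v = 0"
    "justified d (encode RS) xs v \<longleftrightarrow> v = Suc (case xs of [] \<Rightarrow> 0 | x # _ \<Rightarrow> x)"
    "justified d (encode (RProj i)) xs v \<longleftrightarrow> v = (if i < length xs then xs ! i else 0)"
    by (simp_all add: justified_def Let_def drop)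
  show "justified d (encode (RComp f gs)) xs v \<longleftrightarrow>
    (\<exists>ys. (encode f, ys, v) \<in> set d \<and> length ys = length gs \<and>
      (\<forall>i<length gs. (encode (gs ! i), xs, ys ! i) \<in> set d))"
    by (auto simp: justified_def Let_def drop triple_in_set_iff) force
  show "justified d (encode (RPrec f g)) xs v \<longleftrightarrow> (case xs of [] \<Rightarrow> False
    | 0 # ys \<Rightarrow> (encode f, ys, v) \<in> set d
    | Suc n # ys \<Rightarrow> (\<exists>y. (encode (RPrec f g), n # ys, y) \<in> set d \<and> (encode g, n # y # ys, v) \<in> set d))"
    by (auto simp: justified_def Let_def triple_in_set_iff split: list.splits nat.splits) force
  show "justified d (encode (RMn f)) xs v \<longleftrightarrow> (encode f, v # xs, 0) \<in> set d \<and>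
    (\<forall>m<v. \<exists>y. (encode f, m # xs, y) \<in> set d \<and> 0 < y)"
    by (auto simp: justified_def Let_def triple_in_set_iff) force+
qed

lemma derivation_sound:
  "derivation d \<Longrightarrow> (encode P, xs, v) \<in> set d \<Longrightarrow> reval P xs v"
proof (induction d arbitrary: P xs v)
  case (Cons s d)
  show ?case
  proof (cases "(encode P, xs, v) \<in> set d")
    case True
    then show ?thesis using Cons by (simp add: derivation_Cons)
  next
    case False
    then have j: "justified d (encode P) xs v" and d: "derivation d"
      using Cons.prems by (auto simp: derivation_Cons)
    have IH: "reval Q ys w" if "(encode Q, ys, w) \<in> set d" for Q ys w
      using Cons.IH[OF d that] .
    show ?thesis
    proof (cases P)
      case (RComp f gs)
      then obtain ys where "(encode f, ys, v) \<in> set d" "length ys = length gs"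
        "\<forall>i<length gs. (encode (gs ! i), xs, ys ! i) \<in> set d"
        using j unfolding RComp justified_encode by blast
      then show ?thesis unfolding RComp reval_Comp using IH by blast
    next
      case (RPrec f g)
      show ?thesis using j unfolding RPrec justified_encode
        by (auto simp: reval_Prec_0 reval_Prec_Suc split: list.splits nat.splits dest: IH IH[of "RPrec f g", simplified])
    next
      case (RMn f)
      then show ?thesis using j unfolding RMn justified_encode reval_Mn using IH by blast
    qed (use j in \<open>simp_all only: justified_encode reval_Z reval_S reval_Proj\<close>)
  qed
qed simp

text \<open>\<open>d\<close> occurs only positively, so more premises do no harm; this is what
  allows derivations to be concatenated.\<close>

lemma justified_mono: "justified d e xs v \<Longrightarrow> set d \<subseteq> set d' \<Longrightarrow> justified d' e xs v"
proof -
  assume j: "justified d e xs v" and d: "set d \<subseteq> set d'"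
  have bex: "(\<exists>s\<in>set d. P s) \<longrightarrow> (\<exists>s\<in>set d'. Q s)" if "\<And>s. P s \<longrightarrow> Q s" for P Q
    using d that by blast
  have case_list: "(case ys of [] \<Rightarrow> False | z # zs \<Rightarrow> P z zs) \<longrightarrow> (case ys of [] \<Rightarrow> False | z # zs \<Rightarrow> Q z zs)"
    if "\<And>z zs. P z zs \<longrightarrow> Q z zs" for P Q and ys :: "nat list"
    using that by (cases ys) auto
  have If: "(if c then P else P') \<longrightarrow> (if c then Q else Q')" if "P \<longrightarrow> Q" "P' \<longrightarrow> Q'" for c P P' Q Q'
    using that by simp
  have "justified d e xs v \<longrightarrow> justified d' e xs v"
    unfolding justified_def Let_def
    by (intro imp_refl disj_mono conj_mono bex case_list If all_mono imp_mono)
  then show ?thesis using j by blast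
qed

lemma derivation_append: "derivation d \<Longrightarrow> derivation d' \<Longrightarrow> derivation (d @ d')"
  by (induction d) (auto simp: derivation_Cons intro: justified_mono)

lemma derivation_concat: "(\<And>d. d \<in> set ds \<Longrightarrow> derivation d) \<Longrightarrow> derivation (concat ds)"
  by (induction ds) (auto simp: derivation_Nil derivation_append)

text \<open>Composition and minimization have one premise per component or per smaller argument;
  their derivations are joined here.\<close>

lemma derivation_UN:
  assumes "finite I" "\<And>i. i \<in> I \<Longrightarrow> \<exists>d. derivation d \<and> s i \<in> set d"
  shows "\<exists>d. derivation d \<and> s ` I \<subseteq> set d"
  using assms
proof (induction rule: finite_induct)
  case (insert i I)
  obtain d where "derivation d" "s i \<in> set d" using insert.prems by blast
  moreover obtain d' where "derivation d'" "s ` I \<subseteq> set d'" using insert.IH insert.prems by blast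
  ultimately show ?case by (intro exI[of _ "d @ d'"]) (auto simp: derivation_append)
qed (auto intro: derivation_Nil)

lemma derivation_complete:
  "reval P xs v \<Longrightarrow> \<exists>d. derivation d \<and> (encode P, xs, v) \<in> set d"
proof (induction rule: reval.induct)
  case (4 ys gs xs f y)
  have "\<exists>d. derivation d \<and> (\<lambda>i. (encode (gs ! i), xs, ys ! i)) ` {..<length gs} \<subseteq> set d"
    by (rule derivation_UN) (use 4(3) in auto)
  then obtain d where d: "derivation d" "(\<lambda>i. (encode (gs ! i), xs, ys ! i)) ` {..<length gs} \<subseteq> set d"
    by blast
  obtain d' where d': "derivation d'" "(encode f, ys, y) \<in> set d'" using 4(4) by blast
  have "justified (d @ d') (encode (RComp f gs)) xs y"
    unfolding justified_encode using 4(1) d d' by (auto intro!: exI[of _ ys])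
  then show ?case
    using d d' by (intro exI[of _ "(encode (RComp f gs), xs, y) # d @ d'"])
      (simp add: derivation_Cons derivation_append del: encode.simps)
next
  case (5 f xs y g)
  then obtain d where "derivation d" "(encode f, xs, y) \<in> set d" by blast
  then show ?case
    by (intro exI[of _ "(encode (RPrec f g), 0 # xs, y) # d"])
      (simp add: derivation_Cons justified_encode del: encode.simps)
next
  case (6 f g n xs y z)
  then obtain d d' where "derivation d" "(encode (RPrec f g), n # xs, y) \<in> set d"
    "derivation d'" "(encode g, n # y # xs, z) \<in> set d'" by blast
  then show ?case
    by (intro exI[of _ "(encode (RPrec f g), Suc n # xs, z) # d @ d'"])
      (auto simp add: derivation_Cons justified_encode derivation_append simp del: encode.simps)
next
  case (7 f n xs)
  then obtain y where y: "\<And>m. m < n \<Longrightarrow> 0 < y m"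
    "\<And>m. m < n \<Longrightarrow> \<exists>d. derivation d \<and> (encode f, m # xs, y m) \<in> set d" by metis
  have "\<exists>d. derivation d \<and> (\<lambda>m. (encode f, m # xs, y m)) ` {..<n} \<subseteq> set d"
    by (rule derivation_UN) (use y(2) in auto)
  then obtain d where d: "derivation d" "(\<lambda>m. (encode f, m # xs, y m)) ` {..<n} \<subseteq> set d"
    by blast
  obtain d' where d': "derivation d'" "(encode f, n # xs, 0) \<in> set d'" using 7(2) by blast
  have "justified (d @ d') (encode (RMn f)) xs n"
    unfolding justified_encode using d d' y(1) by auto
  then show ?case
    using d d' by (intro exI[of _ "(encode (RMn f), xs, n) # d @ d'"])
      (simp add: derivation_Cons derivation_append del: encode.simps)
next
  case (1 xs)
  show ?case by (rule exI[of _ "[(encode RZ, xs, 0)]"])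
      (simp add: derivation_Cons derivation_Nil justified_encode del: encode.simps)
next
  case (2 xs)
  show ?case by (rule exI[of _ "[(encode RS, xs, Suc (case xs of [] \<Rightarrow> 0 | x # _ \<Rightarrow> x))]"])
      (simp add: derivation_Cons derivation_Nil justified_encode del: encode.simps)
next
  case (3 i xs)
  show ?case by (rule exI[of _ "[(encode (RProj i), xs, if i < length xs then xs ! i else 0)]"])
      (simp add: derivation_Cons derivation_Nil justified_encode del: encode.simps)
qed

lemma encode_inject: "encode P = encode Q \<longleftrightarrow> P = Q"
proof
  show "encode P = encode Q \<Longrightarrow> P = Q"
  proof (induction P arbitrary: Q)
    case (RComp f gs)
    then obtain f' gs' where Q: "Q = RComp f' gs'" by (cases Q) auto
    have "map encode gs = map encode gs'" using RComp.prems Q by (simp add: list_encode_eq)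
    then have "gs = gs'"
      using RComp.IH(2) by (induction gs gs' rule: list_induct2') auto
    then show ?case using RComp.IH(1) RComp.prems Q by simp
  next
    case RZ then show ?case by (cases Q) auto
  next
    case RS then show ?case by (cases Q) auto
  next
    case (RProj i) then show ?case by (cases Q) auto
  next
    case (RPrec f g) then show ?case by (cases Q) auto
  next
    case (RMn f) then show ?case by (cases Q) auto
  qed
qed simp

lemma prog_encode: "prog (encode P) = P"
  by (auto simp: prog_def encode_inject)

section \<open>The Riemann sphere and meromorphic functions\<close>

lemma open_Fin_image: "open S \<Longrightarrow> open (Fin ` S)"
proof -
  have "{z. Fin z \<in> Fin ` S} = S" by auto
  then show "open S \<Longrightarrow> open (Fin ` S)" by (auto simp: open_ecomplex_def)
qed

lemma continuous_on_Fin: "continuous_on UNIV Fin"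
  by (auto simp: continuous_on_open_vimage vimage_def open_ecomplex_def)

lemma open_inverse_vimage:
  fixes S :: "complex set"
  assumes "open S" shows "open {w. w \<noteq> 0 \<and> inverse w \<in> S}"
proof -
  have "continuous_on (- {0}) (inverse :: complex \<Rightarrow> complex)"
    by (intro continuous_intros) auto
  then have "open (inverse -` S \<inter> - {0})"
    using assms by (subst (asm) continuous_on_open_vimage) auto
  then show ?thesis by (simp add: vimage_def Int_def conj_commute)
qed

lemma open_inf_chart_image:
  assumes S: "open S" shows "open (inf_chart ` S)"
proof -
  have "{z. Fin z \<in> inf_chart ` S} = {z. z \<noteq> 0 \<and> inverse z \<in> S}"
    by (force simp: inf_chart_def image_iff split: if_splits)
  moreover have "\<exists>r. \<forall>z. r < norm z \<longrightarrow> Fin z \<in> inf_chart ` S" if "Infty \<in> inf_chart ` S"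
  proof -
    have "0 \<in> S" using that by (auto simp: inf_chart_def split: if_splits)
    then obtain e where e: "0 < e" "ball 0 e \<subseteq> S" using S open_contains_ball by blast
    have "Fin z \<in> inf_chart ` S" if "1 / e < norm z" for z
    proof -
      have "0 < 1 / e" using e by simp
      then have z: "z \<noteq> 0" using that by auto
      have "norm (inverse z) < e"
        using that e z by (simp add: norm_inverse norm_divide field_simps)
      then have "inverse z \<in> S" using e by auto
      then show ?thesis using z by (intro image_eqI[of _ _ "inverse z"]) (auto simp: inf_chart_def)
    qed
    then show ?thesis by blast
  qed
  ultimately show ?thesis using open_inverse_vimage[OF S] by (simp add: open_ecomplex_def)
qed

lemma continuous_on_inf_chart: "continuous_on UNIV inf_chart"
proof -
  have "open {w. inf_chart w \<in> S}" if S: "open S" for S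
  proof -
    have o: "open {w. w \<noteq> 0 \<and> inverse w \<in> {z. Fin z \<in> S}}"
      using S by (intro open_inverse_vimage) (simp add: open_ecomplex_def)
    show ?thesis
    proof (cases "Infty \<in> S")
      case False
      then have "{w. inf_chart w \<in> S} = {w. w \<noteq> 0 \<and> inverse w \<in> {z. Fin z \<in> S}}"
        by (auto simp: inf_chart_def)
      then show ?thesis using o by simp
    next
      case True
      then obtain r where r: "\<And>z. r < norm z \<Longrightarrow> Fin z \<in> S"
        using S by (auto simp: open_ecomplex_def)
      \<comment> \<open>The 1 makes \<open>R\<close> positive, since \<open>r\<close> may be zero or
        negative.\<close>
      define R where "R = max r 1"
      have near: "inf_chart w \<in> S" if "norm w < 1 / R" for w
      proof (cases "w = 0")
        case False
        have "0 < R" "r \<le> R" by (auto simp: R_def)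
        then have "R < norm (inverse w)"
          using that False by (simp add: norm_inverse norm_divide field_simps)
        then show ?thesis using r[of "inverse w"] False \<open>r \<le> R\<close> by (simp add: inf_chart_def)
      qed (use True in \<open>simp add: inf_chart_def\<close>)
      have R: "0 < 1 / R" by (simp add: R_def)
      have "inf_chart w \<in> S \<longleftrightarrow> w \<in> {w. w \<noteq> 0 \<and> inverse w \<in> {z. Fin z \<in> S}} \<union> ball 0 (1 / R)" for w
      proof (cases "norm w < 1 / R")
        case False
        then have "w \<noteq> 0" using R by auto
        then show ?thesis using False by (simp add: inf_chart_def)
      qed (simp add: near)
      then have "{w. inf_chart w \<in> S} = {w. w \<noteq> 0 \<and> inverse w \<in> {z. Fin z \<in> S}} \<union> ball 0 (1 / R)"
        by blast
      then show ?thesis by (simp only:) (intro open_Un o open_ball)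
    qed
  qed
  then show ?thesis by (auto simp: continuous_on_open_vimage vimage_def)
qed

lemma inj_inf_chart: "inj inf_chart"
  by (auto simp: inj_def inf_chart_def split: if_splits)

text \<open>Used in the domain as well as in the range, these two charts let finite points,
  \<open>Infty\<close>, ordinary values and poles share one argument.\<close>

definition chart :: "(complex \<Rightarrow> ecomplex) \<Rightarrow> bool" where
  "chart \<phi> \<longleftrightarrow> \<phi> = Fin \<or> \<phi> = inf_chart"

lemma chart_open_image: "chart \<phi> \<Longrightarrow> open S \<Longrightarrow> open (\<phi> ` S)"
  by (auto simp: chart_def open_Fin_image open_inf_chart_image)

lemma chart_open_vimage: "chart \<phi> \<Longrightarrow> open S \<Longrightarrow> open {w. \<phi> w \<in> S}"
  using continuous_on_Fin continuous_on_inf_chart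
  by (auto simp: chart_def continuous_on_open_vimage vimage_def)

lemma chart_inj: "chart \<phi> \<Longrightarrow> \<phi> w = \<phi> w' \<longleftrightarrow> w = w'"
  using inj_inf_chart by (auto simp: chart_def inj_def)

lemma chart_at: obtains \<phi> a0 where "chart \<phi>" "\<phi> a0 = a"
proof (cases a)
  case (Fin z) then show ?thesis using that[of Fin z] by (simp add: chart_def)
next
  case Infty then show ?thesis using that[of inf_chart 0] by (simp add: chart_def inf_chart_def)
qed

lemma open_outside: "open (insert Infty {Fin z |z. r < norm z})"
proof -
  have "{z. Fin z \<in> insert Infty {Fin z |z. r < norm z}} = {z. r < norm z}" by auto
  moreover have "open {z::complex. r < norm z}" by (intro open_Collect_less continuous_intros)
  ultimately show ?thesis unfolding open_ecomplex_def by auto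
qed

instance ecomplex :: t2_space
proof
  fix x y :: ecomplex assume "x \<noteq> y"
  have inf: "\<exists>U V. open U \<and> open V \<and> Fin a \<in> U \<and> Infty \<in> V \<and> U \<inter> V = {}" for a
    by (rule exI[of _ "Fin ` ball 0 (norm a + 1)"], rule exI[of _ "insert Infty {Fin z |z. norm a + 1 < norm z}"])
       (auto simp: open_outside open_Fin_image)
  show "\<exists>U V. open U \<and> open V \<and> x \<in> U \<and> y \<in> V \<and> U \<inter> V = {}"
  proof (cases x)
    case (Fin a)
    show ?thesis
    proof (cases y)
      case Infty
      then show ?thesis using inf[of a] Fin by simp
    next
      case (Fin b)
      then have "a \<noteq> b" using \<open>x = Fin a\<close> \<open>x \<noteq> y\<close> by simp
      then obtain U V where "open U" "open V" "a \<in> U" "b \<in> V" "U \<inter> V = {}" by (meson hausdorff)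
      then show ?thesis using Fin \<open>x = Fin a\<close>
        by (intro exI[of _ "Fin ` U"] exI[of _ "Fin ` V"]) (auto simp: open_Fin_image)
    qed
  next
    case Infty
    then obtain b where "y = Fin b" using \<open>x \<noteq> y\<close> by (cases y) auto
    then show ?thesis using inf[of b] Infty by (metis Int_commute)
  qed
qed

lemma compact_Fin_image: "compact S \<Longrightarrow> compact (Fin ` S)"
  by (rule compact_continuous_image[OF continuous_on_subset[OF continuous_on_Fin]]) auto

lemma compact_UNIV_ecomplex: "compact (UNIV :: ecomplex set)"
proof (rule compactI)
  fix C :: "ecomplex set set" assume C: "\<forall>t\<in>C. open t" and cov: "UNIV \<subseteq> \<Union>C"
  then obtain S where S: "S \<in> C" "Infty \<in> S" by auto
  then obtain r where r: "\<And>z. r < norm z \<Longrightarrow> Fin z \<in> S"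
    using C by (auto simp: open_ecomplex_def)
  have "compact (Fin ` cball 0 r)" by (rule compact_Fin_image) simp
  then obtain C' where C': "C' \<subseteq> C" "finite C'" "Fin ` cball 0 r \<subseteq> \<Union>C'"
    using C cov by (meson compactE subset_UNIV order_trans)
  have "x \<in> \<Union>(insert S C')" for x
  proof (cases x)
    case (Fin z)
    show ?thesis
    proof (cases "r < norm z")
      case False
      then have "Fin z \<in> Fin ` cball 0 r" by simp
      then show ?thesis using C'(3) Fin by blast
    qed (use r Fin in auto)
  qed (use S in auto)
  then have "UNIV \<subseteq> \<Union>(insert S C')" by blast
  moreover have "insert S C' \<subseteq> C" "finite (insert S C')" using C' S by simp_all
  ultimately show "\<exists>C'. C' \<subseteq> C \<and> finite C' \<and> UNIV \<subseteq> \<Union>C'" by blast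
qed

lemma closed_imp_compact_ecomplex: "closed (K :: ecomplex set) \<Longrightarrow> compact K"
  using compact_Int_closed[OF compact_UNIV_ecomplex] by simp

section \<open>Closures, connectedness and separation of basic open sets\<close>

lemma rect_eq: "rect a b c d = Fin ` box (Complex a c) (Complex b d)"
  by (auto simp: rect_def in_box_complex_iff)

text \<open>The closure of the empty ball is empty even for radius 0, so \<open>outer 0\<close> is
  the whole sphere and not the complement of a point. Hence the later case distinctions on the sign
  of the radius.\<close>

lemma outer_nonpos: "r \<le> 0 \<Longrightarrow> outer r = UNIV"
proof -
  assume "r \<le> 0"
  then have "x \<in> outer r" for x by (cases x) (auto simp: outer_def ball_empty)
  then show ?thesis by auto
qed

lemma outer_pos: "0 < r \<Longrightarrow> outer r = insert Infty {Fin z |z. r < norm z}"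
  by (auto simp: outer_def)

lemma outer_pos_eq: "0 < r \<Longrightarrow> outer r = - Fin ` cball 0 r"
proof -
  assume "0 < r"
  then have "x \<in> outer r \<longleftrightarrow> x \<in> - Fin ` cball 0 r" for x by (cases x) (auto simp: outer_def)
  then show ?thesis by auto
qed

lemma closure_rect:
  assumes "a < b" "c < d"
  shows "closure (rect a b c d) = Fin ` cbox (Complex a c) (Complex b d)"
proof -
  have ne: "Complex ((a + b) / 2) ((c + d) / 2) \<in> box (Complex a c) (Complex b d)"
    using assms by (simp add: in_box_complex_iff)
  then have c: "closure (box (Complex a c) (Complex b d)) = cbox (Complex a c) (Complex b d)"
    by (intro closure_box) blast
  have "Fin ` closure (box (Complex a c) (Complex b d)) \<subseteq> closure (Fin ` box (Complex a c) (Complex b d))"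
    by (rule image_closure_subset[OF continuous_on_subset[OF continuous_on_Fin]])
       (auto simp: closure_subset image_subset_iff intro: closure_subset[THEN subsetD])
  moreover have "closure (Fin ` box (Complex a c) (Complex b d)) \<subseteq> Fin ` cbox (Complex a c) (Complex b d)"
    by (intro closure_minimal image_mono compact_imp_closed compact_Fin_image compact_cbox box_subset_cbox)
  ultimately show ?thesis unfolding rect_eq c by blast
qed

lemma closure_outer:
  assumes "0 < r" shows "closure (outer r) = - Fin ` ball 0 r"
proof -
  \<comment> \<open>The closure of a complement is the complement of the interior, so it suffices to
    find the interior of the closed disk in the sphere.\<close>
  have "interior (Fin ` cball 0 r) = Fin ` ball 0 r"
  proof
    show "Fin ` ball 0 r \<subseteq> interior (Fin ` cball 0 r)"
      by (intro interior_maximal open_Fin_image) auto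
    have "{z. Fin z \<in> interior (Fin ` cball 0 r)} \<subseteq> interior (cball 0 r)"
      by (rule interior_maximal)
         (use interior_subset[of "Fin ` cball 0 r"] open_interior[of "Fin ` cball 0 r"]
           in \<open>auto simp: open_ecomplex_def\<close>)
    then show "interior (Fin ` cball 0 r) \<subseteq> Fin ` ball 0 r"
      using interior_subset[of "Fin ` cball 0 r"] by (simp add: interior_cball) blast
  qed
  then show ?thesis using assms by (simp add: outer_pos_eq closure_complement)
qed

lemma open_rect: "open (rect a b c d)"
  unfolding rect_eq by (intro open_Fin_image open_box)

lemma open_outer: "open (outer r)"
  by (cases "0 < r") (auto simp: outer_pos open_outside outer_nonpos)

lemma connected_rect: "connected (rect a b c d)"
  unfolding rect_eq
  by (intro connected_continuous_image continuous_on_subset[OF continuous_on_Fin] convex_connected convex_box) auto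

lemma connected_UNIV_ecomplex: "connected (UNIV :: ecomplex set)"
proof -
  have "x \<in> range Fin \<union> range inf_chart" for x
    by (cases x) (auto simp: inf_chart_def intro: range_eqI[of _ _ 0])
  then have "UNIV = range Fin \<union> range inf_chart" by blast
  moreover have "Fin 1 \<in> range Fin \<inter> range inf_chart"
    by (auto simp: inf_chart_def intro!: range_eqI[of _ _ 1])
  then have ne: "range Fin \<inter> range inf_chart \<noteq> {}" by blast
  have "connected (range Fin \<union> range inf_chart)"
    by (rule connected_Un[OF connected_continuous_image[OF continuous_on_Fin connected_UNIV]
        connected_continuous_image[OF continuous_on_inf_chart connected_UNIV] ne])
  ultimately show ?thesis by simp
qed

lemma connected_outer: "connected (outer r)"
proof (cases "0 < r")
  case True
  \<comment> \<open>In the chart at infinity \<open>outer r\<close> is a disk of radius 1/r, hence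
    connected.\<close>
  have "x \<in> outer r \<longleftrightarrow> x \<in> inf_chart ` ball 0 (1 / r)" for x
  proof (cases x)
    case (Fin z)
    have "Fin z \<in> inf_chart ` ball 0 (1 / r) \<longleftrightarrow> z \<noteq> 0 \<and> norm (inverse z) < 1 / r"
      by (force simp: inf_chart_def image_iff split: if_splits)
    also have "\<dots> \<longleftrightarrow> r < norm z"
    proof (cases "z = 0")
      case False
      then show ?thesis using True by (simp add: norm_divide inverse_eq_divide field_simps)
    qed (use True in simp)
    finally show ?thesis using Fin True by (simp add: outer_pos)
  next
    case Infty
    then show ?thesis using True by (auto simp: outer_pos inf_chart_def intro!: image_eqI[of _ _ 0])
  qed
  then have "outer r = inf_chart ` ball 0 (1 / r)" by blast
  then show ?thesis
    by (auto intro!: connected_continuous_image continuous_on_subset[OF continuous_on_inf_chart])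
qed (simp add: outer_nonpos connected_UNIV_ecomplex)

lemma basis_open: "B \<in> basis \<Longrightarrow> open B"
  by (auto simp: basis_def open_rect open_outer)

lemma basis_connected: "B \<in> basis \<Longrightarrow> connected B"
  by (auto simp: basis_def connected_rect connected_outer)

text \<open>The closure is controlled because names of open sets list only those basic sets whose
  closures lie inside.\<close>

lemma basis_regular:
  assumes S: "open S" and z: "z \<in> S"
  obtains B where "B \<in> basis" "z \<in> B" "closure B \<subseteq> S"
proof (cases z)
  case (Fin w)
  have "open {z. Fin z \<in> S}" using S by (simp add: open_ecomplex_def)
  then obtain e where e: "0 < e" "ball w e \<subseteq> {z. Fin z \<in> S}"
    using z Fin open_contains_ball by blast
  \<comment> \<open>Coordinate errors below e / 2 add up to a norm below e.\<close>
  obtain a where a: "Re w - e / 2 < of_rat a" "of_rat a < Re w"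
    using of_rat_dense[of "Re w - e / 2" "Re w"] e by auto
  obtain b where b: "Re w < of_rat b" "of_rat b < Re w + e / 2"
    using of_rat_dense[of "Re w" "Re w + e / 2"] e by auto
  obtain c where c: "Im w - e / 2 < of_rat c" "of_rat c < Im w"
    using of_rat_dense[of "Im w - e / 2" "Im w"] e by auto
  obtain d where d: "Im w < of_rat d" "of_rat d < Im w + e / 2"
    using of_rat_dense[of "Im w" "Im w + e / 2"] e by auto
  have ab: "real_of_rat a < real_of_rat b" "real_of_rat c < real_of_rat d" using a b c d by linarith+
  then have rat: "a < b" "c < d" by (simp_all add: of_rat_less)
  let ?B = "rect (of_rat a) (of_rat b) (of_rat c) (of_rat d)"
  have "Fin u \<in> S" if "u \<in> cbox (Complex (of_rat a) (of_rat c)) (Complex (of_rat b) (of_rat d))" for u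
  proof -
    have "of_rat a \<le> Re u" "Re u \<le> of_rat b" "of_rat c \<le> Im u" "Im u \<le> of_rat d"
      using that by (auto simp: in_cbox_complex_iff)
    then have "norm (w - u) < e"
      using cmod_le[of "w - u"] a b c d unfolding minus_complex.sel by linarith
    then show ?thesis using e by (auto simp: dist_norm)
  qed
  then have "closure ?B \<subseteq> S" unfolding closure_rect[OF ab] by auto
  moreover have "z \<in> ?B" using Fin a b c d by (simp add: rect_def)
  moreover have "?B \<in> basis" using rat unfolding basis_def by blast
  ultimately show thesis using that by blast
next
  case Infty
  then obtain r where r: "\<And>z. r < norm z \<Longrightarrow> Fin z \<in> S"
    using S z by (auto simp: open_ecomplex_def)
  obtain q where q: "max r 0 < of_rat q" using of_rat_dense[of "max r 0" "max r 0 + 1"] by auto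
  have "x \<in> S" if "x \<in> - Fin ` ball 0 (of_rat q)" for x
    using that q r z Infty by (cases x) (auto simp: image_iff not_less)
  then have "closure (outer (of_rat q)) \<subseteq> S" using q by (subst closure_outer) auto
  moreover have "outer (of_rat q) \<in> basis" unfolding basis_def by blast
  ultimately show thesis using that Infty q by (auto simp: outer_def)
qed

text \<open>Disjoint closures, and not merely disjoint sets: only these can be certified by
  sufficiently fine cells.\<close>

lemma basis_separate:
  assumes "x \<noteq> y"
  obtains A B where "A \<in> basis" "x \<in> A" "B \<in> basis" "y \<in> B" "closure A \<inter> closure B = {}"
proof -
  obtain U V where "open U" "open V" "x \<in> U" "y \<in> V" "U \<inter> V = {}"
    using hausdorff[OF assms] by blast
  moreover obtain A where "A \<in> basis" "x \<in> A" "closure A \<subseteq> U"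
    using basis_regular[OF \<open>open U\<close> \<open>x \<in> U\<close>] by blast
  moreover obtain B where "B \<in> basis" "y \<in> B" "closure B \<subseteq> V"
    using basis_regular[OF \<open>open V\<close> \<open>y \<in> V\<close>] by blast
  ultimately show thesis by (intro that[of A B]) auto
qed

section \<open>Local structure of nonconstant meromorphic maps\<close>

lemma local_form:
  assumes f: "meromorphic_hat f D" and a: "a \<in> D"
  obtains \<phi> \<psi> h a0 r where "chart \<phi>" "chart \<psi>" "0 < r" "\<phi> a0 = a" "\<phi> ` ball a0 r \<subseteq> D"
    "h holomorphic_on ball a0 r" "\<And>w. w \<in> ball a0 r \<Longrightarrow> f (\<phi> w) = \<psi> (h w)"
proof -
  obtain \<phi> a0 where \<phi>: "chart \<phi>" "\<phi> a0 = a" by (rule chart_at)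
  have D: "open D" and cont: "continuous_on D f" and isol: "\<not> a islimpt {z \<in> D. f z = Infty}"
    using f a by (auto simp: meromorphic_hat_def)
  have hol: "(\<lambda>w. fval (f (\<phi> w))) holomorphic_on {w. \<phi> w \<in> D \<and> f (\<phi> w) \<noteq> Infty}"
    using f \<phi>(1) by (auto simp: meromorphic_hat_def chart_def)
  have o: "open {w. \<phi> w \<in> D \<and> f (\<phi> w) \<in> S}" if "open S" for S
  proof -
    have "open (f -` S \<inter> D)" using cont that D by (simp add: continuous_on_open_vimage)
    from chart_open_vimage[OF \<phi>(1) this] show ?thesis by (simp add: conj_commute)
  qed
  show thesis
  proof (cases "f a = Infty")
    case False
    have "open {w. \<phi> w \<in> D \<and> f (\<phi> w) \<in> - {Infty}}" by (intro o open_Compl closed_singleton)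
    moreover have "a0 \<in> {w. \<phi> w \<in> D \<and> f (\<phi> w) \<in> - {Infty}}" using False a \<phi> by simp
    ultimately obtain r where r: "0 < r" "ball a0 r \<subseteq> {w. \<phi> w \<in> D \<and> f (\<phi> w) \<in> - {Infty}}"
      using open_contains_ball by blast
    have rD: "\<phi> w \<in> D" "f (\<phi> w) \<noteq> Infty" if "w \<in> ball a0 r" for w
      using r(2) that by blast+
    show thesis
    proof (rule that[of \<phi> Fin r a0 "\<lambda>w. fval (f (\<phi> w))"])
      show "(\<lambda>w. fval (f (\<phi> w))) holomorphic_on ball a0 r"
        by (rule holomorphic_on_subset[OF hol]) (use rD in blast)
      show "f (\<phi> w) = Fin (fval (f (\<phi> w)))" if "w \<in> ball a0 r" for w
        using rD(2)[OF that] by (cases "f (\<phi> w)") simp_all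
      show "\<phi> ` ball a0 r \<subseteq> D" using rD(1) by blast
      show "chart Fin" by (simp add: chart_def)
    qed (rule \<phi> r)+
  next
    case True
    \<comment> \<open>At a pole the reciprocal is used. The ball is shrunk until it contains neither
      a zero of f nor another pole; the singularity of the reciprocal at \<open>a0\<close> is then
      removable by continuity.\<close>
    obtain T where T: "open T" "a \<in> T" "\<And>y. y \<in> {z \<in> D. f z = Infty} \<Longrightarrow> y \<in> T \<Longrightarrow> y = a"
      using isol unfolding islimpt_def by blast
    have "open ({w. \<phi> w \<in> D \<and> f (\<phi> w) \<in> - {Fin 0}} \<inter> {w. \<phi> w \<in> T})"
      by (rule open_Int[OF o[OF open_Compl[OF closed_singleton]] chart_open_vimage[OF \<phi>(1) T(1)]])
    moreover have "a0 \<in> {w. \<phi> w \<in> D \<and> f (\<phi> w) \<in> - {Fin 0}} \<inter> {w. \<phi> w \<in> T}"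
      using True a \<phi>(2) T(2) by simp
    ultimately obtain r where r: "0 < r" "ball a0 r \<subseteq> {w. \<phi> w \<in> D \<and> f (\<phi> w) \<in> - {Fin 0}} \<inter> {w. \<phi> w \<in> T}"
      using open_contains_ball by blast
    have r': "\<phi> w \<in> D" "f (\<phi> w) \<noteq> Fin 0" "\<phi> w \<in> T" if "w \<in> ball a0 r" for w
      using r(2) that by blast+
    \<comment> \<open>At the pole \<open>fval Infty = 0\<close> and \<open>inverse 0 = 0\<close>
      give h the value 0, which \<open>inf_chart\<close> sends back to \<open>Infty\<close>. The
      default values thus produce the continuous extension.\<close>
    define h where "h = (\<lambda>w. inverse (fval (f (\<phi> w))))"
    have fin: "f (\<phi> w) \<noteq> Infty" if "w \<in> ball a0 r - {a0}" for w
    proof -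
      have "\<phi> w \<noteq> a" using that chart_inj[OF \<phi>(1), of w a0] \<phi>(2) by simp
      then show ?thesis using T(3)[of "\<phi> w"] r'[of w] that by blast
    qed
    have h: "f (\<phi> w) = inf_chart (h w)" if "w \<in> ball a0 r" for w
    proof (cases "f (\<phi> w)")
      case (Fin v)
      then have "v \<noteq> 0" using r'(2)[OF that] by simp
      then show ?thesis using Fin by (simp add: h_def inf_chart_def)
    qed (simp add: h_def inf_chart_def)
    have "fval (f (\<phi> w)) \<noteq> 0" if "w \<in> ball a0 r - {a0}" for w
      using fin[OF that] r'(2)[of w] that by (cases "f (\<phi> w)") simp_all
    moreover have "ball a0 r - {a0} \<subseteq> {w. \<phi> w \<in> D \<and> f (\<phi> w) \<noteq> Infty}"
      using fin r'(1) by blast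
    ultimately have hol': "h holomorphic_on ball a0 r - {a0}"
      unfolding h_def by (intro holomorphic_on_inverse holomorphic_on_subset[OF hol])
    \<comment> \<open>Since \<open>inf_chart\<close> is injective, a preimage under h is the
      preimage under f of an open set of the sphere.\<close>
    have "continuous_on (ball a0 r) h"
      unfolding continuous_on_open_vimage[OF open_ball]
    proof (intro allI impI)
      fix V :: "complex set" assume "open V"
      then have "open ({w. \<phi> w \<in> D \<and> f (\<phi> w) \<in> inf_chart ` V} \<inter> ball a0 r)"
        by (intro open_Int o[OF open_inf_chart_image] open_ball)
      also have "{w. \<phi> w \<in> D \<and> f (\<phi> w) \<in> inf_chart ` V} \<inter> ball a0 r = h -` V \<inter> ball a0 r"
        using h r'(1) by (auto simp del: mem_ball simp: inj_eq[OF inj_inf_chart])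
      finally show "open (h -` V \<inter> ball a0 r)" .
    qed
    then have "h holomorphic_on ball a0 r"
      by (rule no_isolated_singularity[OF _ hol']) simp_all
    moreover have "\<phi> ` ball a0 r \<subseteq> D" using r'(1) by blast
    moreover have "chart inf_chart" by (simp add: chart_def)
    ultimately show thesis using \<phi> r(1) h by (intro that[of \<phi> inf_chart r a0 h])
  qed
qed

text \<open>The identity theorem: the set of points near which f is constantly c is closed in D.\<close>

lemma not_locally_constant:
  assumes f: "meromorphic_hat f D" and nc: "nonconstant_hat f D"
    and T: "open T" "a \<in> T" "T \<subseteq> D"
  shows "\<exists>w\<in>T. f w \<noteq> c"
proof (rule ccontr)
  assume "\<not> (\<exists>w\<in>T. f w \<noteq> c)"
  then have const: "\<And>w. w \<in> T \<Longrightarrow> f w = c" by blast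
  define A where "A = \<Union>{S. open S \<and> S \<subseteq> D \<and> (\<forall>w\<in>S. f w = c)}"
  \<comment> \<open>\<open>B\<close> is the exterior of \<open>A\<close>. Once both cover D,
    connectedness puts the whole component of a into \<open>A\<close>.\<close>
  define B where "B = \<Union>{S. open S \<and> S \<inter> A = {}}"
  have A: "open A" "A \<subseteq> D" "\<And>w. w \<in> A \<Longrightarrow> f w = c" by (auto simp: A_def)
  have B: "open B" "A \<inter> B = {}" by (auto simp: B_def)
  have "z \<in> A \<union> B" if z: "z \<in> D" for z
  proof (rule local_form[OF f z])
    fix \<phi> \<psi> h a0 and r :: real
    assume \<phi>: "chart \<phi>" "chart \<psi>" "0 < r" "\<phi> a0 = z" "\<phi> ` ball a0 r \<subseteq> D"
      and h: "h holomorphic_on ball a0 r" "\<And>w. w \<in> ball a0 r \<Longrightarrow> f (\<phi> w) = \<psi> (h w)"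
    have N: "open (\<phi> ` ball a0 r)" "z \<in> \<phi> ` ball a0 r"
      using \<phi> by (auto intro: chart_open_image)
    show ?thesis
    proof (cases "\<phi> ` ball a0 r \<inter> A = {}")
      case True
      then show ?thesis using N by (auto simp: B_def)
    next
      case False
      then obtain u where u: "u \<in> ball a0 r" "\<phi> u \<in> A" by blast
      let ?S = "{w. \<phi> w \<in> A} \<inter> ball a0 r"
      have "h w = h u" if "w \<in> ball a0 r" for w
      proof (rule analytic_continuation_open[of ?S "ball a0 r" h "\<lambda>_. h u" w])
        show "open ?S" using chart_open_vimage[OF \<phi>(1) A(1)] by auto
        show "h w = h u" if "w \<in> ?S" for w
        proof -
          have w: "w \<in> ball a0 r" "\<phi> w \<in> A" using that by simp_all
          have "\<psi> (h w) = f (\<phi> w)" using h(2)[OF w(1)] by (rule sym)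
          also have "\<dots> = f (\<phi> u)" using A(3)[OF w(2)] A(3)[OF u(2)] by simp
          also have "\<dots> = \<psi> (h u)" by (rule h(2)[OF u(1)])
          finally show ?thesis by (simp only: chart_inj[OF \<phi>(2)])
        qed
        show "?S \<noteq> {}" using u by blast
      qed (use h(1) that in \<open>simp_all add: connected_ball\<close>)
      then have "f (\<phi> w) = f (\<phi> u)" if "w \<in> ball a0 r" for w
        using h(2)[OF that] h(2)[OF u(1)] that by simp
      then have "f (\<phi> w) = c" if "w \<in> ball a0 r" for w
        using A(3)[OF u(2)] that by simp
      then have "\<phi> ` ball a0 r \<subseteq> A" using N \<phi>(5) unfolding A_def by blast
      then show ?thesis using N by blast
    qed
  qed
  then have cov: "connected_component_set D a \<subseteq> A \<union> B"
    using connected_component_subset by blast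
  have a: "a \<in> A" "a \<in> D" using T const by (auto simp: A_def)
  then have "a \<in> connected_component_set D a" by simp
  then have "B \<inter> connected_component_set D a = {}"
    using connectedD[OF connected_connected_component[of D a] A(1) B(1)] cov B(2) a by blast
  then have "\<forall>w\<in>connected_component_set D a. f w = c" using cov A(3) by blast
  then show False using nc a unfolding nonconstant_hat_def by blast
qed

lemma local_form_nonconstant:
  assumes f: "meromorphic_hat f D" and nc: "nonconstant_hat f D"
    and S: "open S" "S \<subseteq> D" and a: "a \<in> S"
  obtains \<phi> \<psi> h a0 r where "chart \<phi>" "chart \<psi>" "0 < r" "\<phi> a0 = a" "\<phi> ` ball a0 r \<subseteq> S"
    "h holomorphic_on ball a0 r" "\<And>w. w \<in> ball a0 r \<Longrightarrow> f (\<phi> w) = \<psi> (h w)"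
    "\<And>c. \<exists>w\<in>ball a0 r. h w \<noteq> c"
proof -
  have "a \<in> D" using S a by blast
  from f this show thesis
  proof (rule local_form)
    fix \<phi> \<psi> h a0 and r :: real
    assume \<phi>: "chart \<phi>" "chart \<psi>" "0 < r" "\<phi> a0 = a" "\<phi> ` ball a0 r \<subseteq> D"
      and h: "h holomorphic_on ball a0 r" "\<And>w. w \<in> ball a0 r \<Longrightarrow> f (\<phi> w) = \<psi> (h w)"
    have "open ({w. \<phi> w \<in> S} \<inter> ball a0 r)" "a0 \<in> {w. \<phi> w \<in> S} \<inter> ball a0 r"
      using chart_open_vimage[OF \<phi>(1) S(1)] \<phi> a by auto
    then obtain s where s: "0 < s" "ball a0 s \<subseteq> {w. \<phi> w \<in> S} \<inter> ball a0 r"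
      using open_contains_ball by blast
    have "\<exists>w\<in>ball a0 s. h w \<noteq> c" for c
    proof -
      have "open (\<phi> ` ball a0 s)" "a \<in> \<phi> ` ball a0 s" "\<phi> ` ball a0 s \<subseteq> D"
        using chart_open_image[OF \<phi>(1) open_ball] \<phi>(4) s S(2) by (simp, force, blast)
      from not_locally_constant[OF f nc this, of "\<psi> c"]
      obtain w where w: "w \<in> ball a0 s" "f (\<phi> w) \<noteq> \<psi> c" by blast
      then have "h w \<noteq> c" using h(2)[of w] s(2) by blast
      then show ?thesis using w by blast
    qed
    then show thesis
      using s \<phi> h by (intro that[of \<phi> \<psi> s a0 h]) (auto intro: holomorphic_on_subset)
  qed
qed

lemma open_meromorphic_image:
  assumes f: "meromorphic_hat f D" and nc: "nonconstant_hat f D"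
    and S: "open S" "S \<subseteq> D"
  shows "open (f ` S)"
proof (subst open_subopen, safe)
  fix a assume "a \<in> S"
  from f nc S this show "\<exists>T. open T \<and> f a \<in> T \<and> T \<subseteq> f ` S"
  proof (rule local_form_nonconstant)
    fix \<phi> \<psi> h a0 and r :: real
    assume \<phi>: "chart \<phi>" "chart \<psi>" "0 < r" "\<phi> a0 = a" "\<phi> ` ball a0 r \<subseteq> S"
      and h: "h holomorphic_on ball a0 r" "\<And>w. w \<in> ball a0 r \<Longrightarrow> f (\<phi> w) = \<psi> (h w)"
        "\<And>c. \<exists>w\<in>ball a0 r. h w \<noteq> c"
    have "open (h ` ball a0 r)"
      using open_mapping_thm[OF h(1)] h(3) by (auto simp: constant_on_def)
    then have "open (\<psi> ` h ` ball a0 r)" using \<phi>(2) by (intro chart_open_image)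
    moreover have "\<psi> ` h ` ball a0 r = f ` \<phi> ` ball a0 r" using h(2) by (force simp: image_iff)
    ultimately show ?thesis using \<phi> by (intro exI[of _ "f ` \<phi> ` ball a0 r"]) auto
  qed
qed

text \<open>In the charts the equation becomes h(w) = h(a0), and the zeros of the nonconstant
  function h - h(a0) are isolated.\<close>

lemma isolated_preimages:
  assumes f: "meromorphic_hat f D" and nc: "nonconstant_hat f D"
    and S: "open S" "S \<subseteq> D" and a: "a \<in> S"
  obtains T where "open T" "a \<in> T" "T \<subseteq> S" "\<And>w. w \<in> T \<Longrightarrow> f w = f a \<Longrightarrow> w = a"
proof (rule local_form_nonconstant[OF f nc S a])
  fix \<phi> \<psi> h a0 and r :: real
  assume \<phi>: "chart \<phi>" "chart \<psi>" "0 < r" "\<phi> a0 = a" "\<phi> ` ball a0 r \<subseteq> S"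
    and h: "h holomorphic_on ball a0 r" "\<And>w. w \<in> ball a0 r \<Longrightarrow> f (\<phi> w) = \<psi> (h w)"
      "\<And>c. \<exists>w\<in>ball a0 r. h w \<noteq> c"
  obtain b where b: "b \<in> ball a0 r" "h b \<noteq> h a0" using h(3) by blast
  have "(\<lambda>w. h w - h a0) holomorphic_on ball a0 r" by (intro holomorphic_intros h)
  from isolated_zeros[OF this, of a0 b] b \<phi>(3) obtain s where s: "0 < s" "ball a0 s \<subseteq> ball a0 r"
    "\<And>w. w \<in> ball a0 s - {a0} \<Longrightarrow> h w - h a0 \<noteq> 0"
    by auto
  show thesis
  proof (rule that[of "\<phi> ` ball a0 s"])
    fix w assume "w \<in> \<phi> ` ball a0 s" "f w = f a"
    then obtain u where u: "u \<in> ball a0 s" "w = \<phi> u" by blast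
    have "h u = h a0"
      using u s(2) \<open>f w = f a\<close> h(2)[of u] h(2)[of a0] \<phi> chart_inj[OF \<phi>(2)] by auto
    then show "w = a" using s(3)[of u] u \<phi> by auto
  qed (use \<phi> s in \<open>auto intro: chart_open_image\<close>)
qed

text \<open>The set f(G) is relatively open and relatively closed in V.\<close>

lemma connected_subset_image:
  fixes f :: "ecomplex \<Rightarrow> ecomplex"
  assumes cont: "continuous_on (closure G) f" and op: "open (f ` G)" and V: "connected V"
    and meet: "V \<inter> f ` G \<noteq> {}" and avoid: "\<And>z. z \<in> closure G \<Longrightarrow> z \<notin> G \<Longrightarrow> f z \<notin> V"
  shows "V \<subseteq> f ` G"
proof -
  have "compact (f ` closure G)"
    by (intro compact_continuous_image cont closed_imp_compact_ecomplex closed_closure)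
  then have "open (- f ` closure G)" by (simp add: compact_imp_closed open_Compl)
  moreover have "V \<subseteq> f ` G \<union> - f ` closure G" using avoid by blast
  moreover have "f ` G \<inter> - f ` closure G \<inter> V = {}" using closure_subset by blast
  ultimately show ?thesis using connectedD[OF V op] meet by blast
qed

section \<open>Rational cells\<close>

text \<open>This and the next definitions read the parameters of a basic set off its number by
  projections alone, which makes them computable. They have values also for sets of the other kind,
  where they mean nothing.\<close>

definition is_rect :: "nat \<Rightarrow> bool" where
  "is_rect k \<longleftrightarrow> fst (prod_decode k) = 0"

definition x_lo :: "nat \<Rightarrow> rat" where
  "x_lo k = rat_decode (fst (prod_decode (snd (prod_decode k))))"

definition x_hi :: "nat \<Rightarrow> rat" where
  "x_hi k = x_lo k + pos_rat (rat_decode (fst (prod_decode (snd (prod_decode (snd (prod_decode k)))))))"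

definition y_lo :: "nat \<Rightarrow> rat" where
  "y_lo k = rat_decode (fst (prod_decode (snd (prod_decode (snd (prod_decode (snd (prod_decode k))))))))"

definition y_hi :: "nat \<Rightarrow> rat" where
  "y_hi k = y_lo k + pos_rat (rat_decode (snd (prod_decode (snd (prod_decode (snd (prod_decode (snd (prod_decode k)))))))))"

definition radius :: "nat \<Rightarrow> rat" where
  "radius k = rat_decode (snd (prod_decode k))"

lemma pos_rat_pos: "0 < pos_rat q"
  by (simp add: pos_rat_def)

lemma lo_less_hi: "x_lo k < x_hi k" "y_lo k < y_hi k"
  by (simp_all add: x_hi_def y_hi_def pos_rat_pos)

lemma basic_eq: "basic k = (if is_rect k
    then rect (of_rat (x_lo k)) (of_rat (x_hi k)) (of_rat (y_lo k)) (of_rat (y_hi k))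
    else outer (of_rat (radius k)))"
  by (simp add: basic_def case_prod_unfold is_rect_def x_lo_def x_hi_def y_lo_def y_hi_def radius_def)

lemma basic_in_basis: "basic k \<in> basis"
  unfolding basic_eq basis_def using lo_less_hi[of k] by auto

lemma basis_eq_range: "B \<in> basis \<longleftrightarrow> (\<exists>k. B = basic k)"
proof
  assume "B \<in> basis"
  then consider a b c d where "B = rect (of_rat a) (of_rat b) (of_rat c) (of_rat d)" "a < b" "c < d"
    | r where "B = outer (of_rat r)"
    unfolding basis_def by blast
  then show "\<exists>k. B = basic k"
  proof cases
    case 1
    obtain i j k l where "rat_decode i = a" "rat_decode j = b - a" "rat_decode k = c" "rat_decode l = d - c"
      using surj_rat_decode by (metis surjD)
    then have "B = basic (prod_encode (0, prod_encode (i, prod_encode (j, prod_encode (k, l)))))"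
      using 1 by (simp add: basic_def pos_rat_def)
    then show ?thesis ..
  next
    case 2
    obtain m where "rat_decode m = r" using surj_rat_decode by (metis surjD)
    then have "B = basic (prod_encode (1, m))" using 2 by (simp add: basic_def)
    then show ?thesis ..
  qed
qed (auto simp: basic_in_basis)

lemma basis_basicE: assumes "B \<in> basis" obtains k where "B = basic k"
  using assms basis_eq_range by blast

lemma open_basic: "open (basic k)"
  using basic_in_basis basis_open by blast

lemma connected_basic: "connected (basic k)"
  using basic_in_basis basis_connected by blast

text \<open>Side length 2(N+1) in steps of 1/(N+1) gives 2(N+1)^2 steps per side. All remaining
  index pairs denote the one outer cell.\<close>

definition inner_cell :: "nat \<Rightarrow> nat \<Rightarrow> nat \<Rightarrow> bool" where
  "inner_cell N i j \<longleftrightarrow> i < 2 * (Suc N * Suc N) \<and> j < 2 * (Suc N * Suc N)"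

definition grid_coord :: "nat \<Rightarrow> nat \<Rightarrow> real" where
  "grid_coord N i = real i / real (Suc N) - real (Suc N)"

text \<open>At level N the sphere is cut into the closed squares of side 1/(N+1) that fill
  the square of half-side N+1 around 0, and the closed complement of that square.\<close>

definition cell :: "nat \<Rightarrow> nat \<Rightarrow> nat \<Rightarrow> ecomplex set" where
  "cell N i j = (if inner_cell N i j
     then Fin ` cbox (Complex (grid_coord N i) (grid_coord N j))
       (Complex (grid_coord N i + 1 / real (Suc N)) (grid_coord N j + 1 / real (Suc N)))
     else insert Infty (Fin ` {z. real (Suc N) \<le> \<bar>Re z\<bar> \<or> real (Suc N) \<le> \<bar>Im z\<bar>}))"

text \<open>One more than the number of steps, so that bounded search also meets an index pair of
  the outer cell.\<close>

definition cell_index :: "nat \<Rightarrow> nat" where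
  "cell_index N = Suc (2 * (Suc N * Suc N))"

text \<open>Keeps \<open>real (Suc N)\<close> as a single atom in the linear arithmetic that
  follows.\<close>

declare of_nat_Suc [simp del]

lemma coordinate_in_grid:
  assumes "\<bar>x\<bar> < real (Suc N)"
  obtains i where "i < 2 * (Suc N * Suc N)" "grid_coord N i \<le> x" "x \<le> grid_coord N i + 1 / real (Suc N)"
proof -
  define K where "K = real (Suc N)"
  have K: "0 < K" by (simp add: K_def)
  \<comment> \<open>The position of x in grid steps, counted from the left edge -K.\<close>
  define t where "t = (x + K) * K"
  have t: "0 \<le> t" using assms K unfolding t_def by (intro mult_nonneg_nonneg) (auto simp: K_def)
  define i where "i = nat \<lfloor>t\<rfloor>"
  have "0 \<le> \<lfloor>t\<rfloor>" using t by simp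
  then have i: "real i \<le> t" "t < real i + 1"
    unfolding i_def by linarith+
  have "t < 2 * (K * K)"
  proof -
    have "(x + K) * K < (2 * K) * K" using assms K by (intro mult_strict_right_mono) (auto simp: K_def)
    then show ?thesis by (simp add: t_def)
  qed
  moreover have "real (2 * (Suc N * Suc N)) = 2 * (K * K)"
    by (simp only: of_nat_mult of_nat_numeral K_def)
  ultimately have "real i < real (2 * (Suc N * Suc N))" using i(1) by linarith
  then have "i < 2 * (Suc N * Suc N)" by (simp only: of_nat_less_iff)
  moreover have "grid_coord N i \<le> x"
    using i(1) K by (simp add: grid_coord_def t_def field_simps flip: K_def)
  moreover have "x \<le> grid_coord N i + 1 / real (Suc N)"
    using i(2) K by (simp add: grid_coord_def t_def field_simps flip: K_def)
  ultimately show thesis using that by blast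
qed

lemma cells_cover: "\<exists>i<cell_index N. \<exists>j<cell_index N. z \<in> cell N i j"
proof -
  have out: ?thesis if "z \<in> insert Infty (Fin ` {z. real (Suc N) \<le> \<bar>Re z\<bar> \<or> real (Suc N) \<le> \<bar>Im z\<bar>})"
    using that by (intro exI[of _ "2 * (Suc N * Suc N)"] conjI)
      (auto simp: cell_index_def cell_def inner_cell_def)
  show ?thesis
  proof (cases z)
    case (Fin w)
    show ?thesis
    proof (cases "\<bar>Re w\<bar> < real (Suc N) \<and> \<bar>Im w\<bar> < real (Suc N)")
      case True
      obtain i where i: "i < 2 * (Suc N * Suc N)" "grid_coord N i \<le> Re w" "Re w \<le> grid_coord N i + 1 / real (Suc N)"
        using True coordinate_in_grid by blast
      obtain j where j: "j < 2 * (Suc N * Suc N)" "grid_coord N j \<le> Im w" "Im w \<le> grid_coord N j + 1 / real (Suc N)"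
        using True coordinate_in_grid by blast
      have "z \<in> cell N i j" using i j Fin by (simp add: cell_def inner_cell_def in_cbox_complex_iff)
      then show ?thesis using i(1) j(1) unfolding cell_index_def by (meson less_SucI)
    next
      case False
      then show ?thesis using Fin by (intro out) (auto simp: not_less)
    qed
  qed (use out in simp)
qed

lemma cell_nonempty: "cell N i j \<noteq> {}"
  by (auto simp: cell_def box_ne_empty Basis_complex_def)

lemma inner_cellE:
  assumes "inner_cell N i j" "z \<in> cell N i j"
  obtains w where "z = Fin w" "grid_coord N i \<le> Re w" "Re w \<le> grid_coord N i + 1 / real (Suc N)"
    "grid_coord N j \<le> Im w" "Im w \<le> grid_coord N j + 1 / real (Suc N)"
    "norm (w - Complex (grid_coord N i) (grid_coord N j)) \<le> 2 / real (Suc N)"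
proof -
  obtain w where w: "z = Fin w" "grid_coord N i \<le> Re w" "Re w \<le> grid_coord N i + 1 / real (Suc N)"
    "grid_coord N j \<le> Im w" "Im w \<le> grid_coord N j + 1 / real (Suc N)"
    using assms by (auto simp: cell_def in_cbox_complex_iff)
  \<comment> \<open>The norm is bounded by the sum of the coordinate differences; the constant 2 in
    place of the sharper square root of 2 keeps the later tests rational.\<close>
  have "2 / real (Suc N) = 1 / real (Suc N) + 1 / real (Suc N)" by simp
  then have "norm (w - Complex (grid_coord N i) (grid_coord N j)) \<le> 2 / real (Suc N)"
    using cmod_le[of "w - Complex (grid_coord N i) (grid_coord N j)"] w by simp
  then show thesis using w that by blast
qed

definition grid_rat :: "nat \<Rightarrow> nat \<Rightarrow> rat" where
  "grid_rat N i = Fract (int i - int (Suc N * Suc N)) (int (Suc N))"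

lemma of_rat_grid_rat: "real_of_rat (grid_rat N i) = grid_coord N i"
  by (simp add: grid_rat_def grid_coord_def of_rat_rat diff_divide_distrib del: mult_Suc mult_Suc_right)

text \<open>A decidable sufficient condition for inclusion. For an outer set the corner must have
  norm above r + 2h, where 2h bounds the distance from the corner to points of the cell; squares are
  compared to avoid roots. Strictness makes the test succeed for all fine cells near a point of the
  basic set.\<close>

definition cell_inside :: "nat \<Rightarrow> nat \<Rightarrow> nat \<Rightarrow> nat \<Rightarrow> bool" where
  "cell_inside N i j k \<longleftrightarrow>
    (let x = grid_rat N i; y = grid_rat N j; h = Fract 1 (int (Suc N)); r = radius k in
     if is_rect k then inner_cell N i j \<and> x_lo k < x \<and> x + h < x_hi k \<and> y_lo k < y \<and> y + h < y_hi k
     else r \<le> 0 \<or> (if inner_cell N i j then (r + 2 * h) * (r + 2 * h) < x * x + y * y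
       else r < Fract (int (Suc N)) 1))"

text \<open>The analogous test for disjointness from the closure. The condition 2h < r makes the
  comparison of squares legitimate, and it fails for radius at most 0, where the closure is the
  whole sphere. The outer cell contains \<open>Infty\<close> and so meets every outer set. The lower
  bounds are written as products to fit the computability rules.\<close>

definition cell_outside :: "nat \<Rightarrow> nat \<Rightarrow> nat \<Rightarrow> nat \<Rightarrow> bool" where
  "cell_outside N i j k \<longleftrightarrow>
    (let x = grid_rat N i; y = grid_rat N j; h = Fract 1 (int (Suc N)); K = Fract (int (Suc N)) 1;
       r = radius k in
     if is_rect k then
       (if inner_cell N i j then x + h < x_lo k \<or> x_hi k < x \<or> y + h < y_lo k \<or> y_hi k < y
        else - 1 * K < x_lo k \<and> x_hi k < K \<and> - 1 * K < y_lo k \<and> y_hi k < K)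
     else inner_cell N i j \<and> 2 * h < r \<and> x * x + y * y < (r - 2 * h) * (r - 2 * h))"

lemma computable_basic_parameters [computable_intros]:
  assumes "computable k"
  shows "computable (\<lambda>x. is_rect (k x))" "computable (\<lambda>x. x_lo (k x))" "computable (\<lambda>x. x_hi (k x))"
    "computable (\<lambda>x. y_lo (k x))" "computable (\<lambda>x. y_hi (k x))" "computable (\<lambda>x. radius (k x))"
  unfolding is_rect_def x_lo_def x_hi_def y_lo_def y_hi_def radius_def
  by (intro computable_intros assms)+

lemma computable_grid_rat [computable_intros]:
  "computable N \<Longrightarrow> computable i \<Longrightarrow> computable (\<lambda>x. grid_rat (N x) (i x))"
  unfolding grid_rat_def by (intro computable_intros computable_int_diff)

lemma computable_inner_cell [computable_intros]:
  "computable N \<Longrightarrow> computable i \<Longrightarrow> computable j \<Longrightarrow> computable (\<lambda>x. inner_cell (N x) (i x) (j x))"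
  unfolding inner_cell_def by (intro computable_intros)

lemma computable_cell_index [computable_intros]:
  "computable N \<Longrightarrow> computable (\<lambda>x. cell_index (N x))"
  unfolding cell_index_def by (intro computable_intros)

lemma computable_cell_inside:
  assumes "computable N" "computable i" "computable j" "computable k"
  shows "computable (\<lambda>x. cell_inside (N x) (i x) (j x) (k x))"
  unfolding cell_inside_def Let_def by (intro computable_intros assms)

lemma computable_cell_outside:
  assumes "computable N" "computable i" "computable j" "computable k"
  shows "computable (\<lambda>x. cell_outside (N x) (i x) (j x) (k x))"
  unfolding cell_outside_def Let_def by (intro computable_intros assms)

lemmas rat_to_real = of_rat_less[where 'a=real, symmetric] of_rat_less_eq[where 'a=real, symmetric]

lemma of_rat_Fract_simps:
  "real_of_rat (Fract 1 (int (Suc N))) = 1 / real (Suc N)"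
  "real_of_rat (Fract (int (Suc N)) 1) = real (Suc N)"
  by (simp_all add: of_rat_rat)

lemma cell_inside_real: "cell_inside N i j k \<longleftrightarrow>
    (let x = grid_coord N i; y = grid_coord N j; h = 1 / real (Suc N); r = real_of_rat (radius k) in
     if is_rect k then inner_cell N i j \<and> real_of_rat (x_lo k) < x \<and> x + h < real_of_rat (x_hi k) \<and>
       real_of_rat (y_lo k) < y \<and> y + h < real_of_rat (y_hi k)
     else r \<le> 0 \<or> (if inner_cell N i j then (r + 2 * h) * (r + 2 * h) < x * x + y * y
       else r < real (Suc N)))"
  unfolding cell_inside_def Let_def rat_to_real of_rat_add of_rat_mult of_rat_grid_rat of_rat_Fract_simps
  by (simp only: of_rat_0 of_rat_numeral_eq)

lemma cell_outside_real: "cell_outside N i j k \<longleftrightarrow>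
    (let x = grid_coord N i; y = grid_coord N j; h = 1 / real (Suc N); K = real (Suc N);
       r = real_of_rat (radius k) in
     if is_rect k then
       (if inner_cell N i j then x + h < real_of_rat (x_lo k) \<or> real_of_rat (x_hi k) < x \<or>
          y + h < real_of_rat (y_lo k) \<or> real_of_rat (y_hi k) < y
        else - 1 * K < real_of_rat (x_lo k) \<and> real_of_rat (x_hi k) < K \<and>
          - 1 * K < real_of_rat (y_lo k) \<and> real_of_rat (y_hi k) < K)
     else inner_cell N i j \<and> 2 * h < r \<and> x * x + y * y < (r - 2 * h) * (r - 2 * h))"
  unfolding cell_outside_def Let_def rat_to_real of_rat_add of_rat_diff of_rat_mult of_rat_grid_rat of_rat_Fract_simps
  by (simp only: of_rat_minus of_rat_1 of_rat_numeral_eq)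

lemma norm_Complex_less_iff:
  assumes "0 \<le> r"
  shows "norm (Complex x y) < r \<longleftrightarrow> x * x + y * y < r * r" "r < norm (Complex x y) \<longleftrightarrow> r * r < x * x + y * y"
proof -
  have e: "x * x + y * y = (norm (Complex x y))\<^sup>2" "r * r = r\<^sup>2"
    by (simp_all add: cmod_power2 flip: power2_eq_square)
  show "norm (Complex x y) < r \<longleftrightarrow> x * x + y * y < r * r" "r < norm (Complex x y) \<longleftrightarrow> r * r < x * x + y * y"
    unfolding e using assms by (simp_all add: power_mono_iff flip: not_le)
qed

lemma outer_cell_norm:
  assumes "\<not> inner_cell N i j" "Fin w \<in> cell N i j"
  shows "real (Suc N) \<le> norm w"
  using assms abs_Re_le_cmod[of w] abs_Im_le_cmod[of w] by (auto simp: cell_def)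

lemma cell_inside_sound:
  assumes c: "cell_inside N i j k" shows "cell N i j \<subseteq> basic k"
proof
  fix z assume z: "z \<in> cell N i j"
  show "z \<in> basic k"
  proof (cases "is_rect k")
    case True
    then have "inner_cell N i j" using c by (simp add: cell_inside_real Let_def)
    from this z show ?thesis
      by (rule inner_cellE) (use c True in \<open>auto simp: cell_inside_real basic_eq rect_def Let_def\<close>)
  next
    case False
    let ?r = "real_of_rat (radius k)"
    show ?thesis
    proof (cases "?r \<le> 0")
      case True
      then show ?thesis using False by (simp add: basic_eq outer_nonpos)
    next
      case r: False
      show ?thesis
      proof (cases "inner_cell N i j")
        case True
        then have "?r + 2 / real (Suc N) < norm (Complex (grid_coord N i) (grid_coord N j))"
          using c False r by (subst norm_Complex_less_iff) (auto simp: cell_inside_real Let_def)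
        moreover obtain w where w: "z = Fin w" "norm (w - Complex (grid_coord N i) (grid_coord N j)) \<le> 2 / real (Suc N)"
          using inner_cellE[OF True z] by blast
        ultimately have "?r < norm w"
          using norm_triangle_ineq2[of "Complex (grid_coord N i) (grid_coord N j)" w]
          by (simp add: norm_minus_commute)
        then show ?thesis using False r w by (simp add: basic_eq outer_pos)
      next
        case outer: False
        then have K: "?r < real (Suc N)" using c False r by (simp add: cell_inside_real Let_def)
        show ?thesis
        proof (cases z)
          case (Fin w)
          then show ?thesis using outer_cell_norm[OF outer, of w] z K False r by (simp add: basic_eq outer_pos)
        qed (use False r in \<open>simp add: basic_eq outer_pos\<close>)
      qed
    qed
  qed
qed

lemma closure_basic: "closure (basic k) = (if is_rect k
    then Fin ` cbox (Complex (of_rat (x_lo k)) (of_rat (y_lo k))) (Complex (of_rat (x_hi k)) (of_rat (y_hi k)))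
    else if radius k \<le> 0 then UNIV else - Fin ` ball 0 (of_rat (radius k)))"
  using lo_less_hi[of k]
  by (simp add: basic_eq closure_rect of_rat_less closure_outer outer_nonpos)

lemma cell_outside_sound:
  assumes c: "cell_outside N i j k" and z: "z \<in> cell N i j" shows "z \<notin> closure (basic k)"
proof (cases "is_rect k")
  case True
  show ?thesis
  proof (cases "inner_cell N i j")
    case inner: True
    from this z show ?thesis
      by (rule inner_cellE) (use c True inner in \<open>auto simp: cell_outside_real closure_basic Let_def in_cbox_complex_iff\<close>)
  next
    case False
    then show ?thesis
      using c True z by (auto simp: cell_def cell_outside_real closure_basic Let_def in_cbox_complex_iff)
  qed
next
  case False
  let ?r = "real_of_rat (radius k)"
  have inner: "inner_cell N i j" and r: "2 / real (Suc N) < ?r"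
    using c False by (auto simp: cell_outside_real Let_def)
  have "norm (Complex (grid_coord N i) (grid_coord N j)) < ?r - 2 / real (Suc N)"
    using c False r by (subst norm_Complex_less_iff) (auto simp: cell_outside_real Let_def)
  moreover obtain w where w: "z = Fin w" "norm (w - Complex (grid_coord N i) (grid_coord N j)) \<le> 2 / real (Suc N)"
    using inner_cellE[OF inner z] by blast
  ultimately have "norm w < ?r"
    using norm_triangle_ineq2[of w "Complex (grid_coord N i) (grid_coord N j)"] by simp
  moreover have "0 < radius k"
  proof -
    have "0 < ?r" using r by (rule le_less_trans[rotated]) simp
    then show ?thesis by simp
  qed
  ultimately show ?thesis using w False by (simp add: closure_basic)
qed

text \<open>All fine cells that meet a neighborhood are covered, not just those containing z: this
  is the form from which compactness yields one level for the whole sphere.\<close>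

definition near_cells :: "ecomplex \<Rightarrow> (nat \<Rightarrow> nat \<Rightarrow> nat \<Rightarrow> bool) \<Rightarrow> bool" where
  "near_cells z Q \<longleftrightarrow> (\<exists>W N0. open W \<and> z \<in> W \<and>
     (\<forall>N\<ge>N0. \<forall>i j. cell N i j \<inter> W \<noteq> {} \<longrightarrow> Q N i j))"

lemma near_cells_FinI:
  assumes e: "0 < e"
    and Q: "\<And>N i j w. inner_cell N i j \<Longrightarrow> 1 / real (Suc N) < e \<Longrightarrow> norm (w - z) < e \<Longrightarrow>
      norm (w - Complex (grid_coord N i) (grid_coord N j)) \<le> 2 / real (Suc N) \<Longrightarrow>
      grid_coord N i \<le> Re w \<Longrightarrow> Re w \<le> grid_coord N i + 1 / real (Suc N) \<Longrightarrow>
      grid_coord N j \<le> Im w \<Longrightarrow> Im w \<le> grid_coord N j + 1 / real (Suc N) \<Longrightarrow> Q N i j"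
  shows "near_cells (Fin z) Q"
proof -
  \<comment> \<open>The first bound makes the mesh smaller than e; the second keeps the outer cell
    away from the ball.\<close>
  obtain N0 where N0: "1 / e < real N0" "norm z + e < real N0"
    using reals_Archimedean2[of "max (1 / e) (norm z + e)"] by auto
  have "Q N i j" if N: "N0 \<le> N" and ne: "cell N i j \<inter> Fin ` ball z e \<noteq> {}" for N i j
  proof -
    have K: "real N0 \<le> real (Suc N)" using N by simp
    obtain w where w: "Fin w \<in> cell N i j" "norm (w - z) < e"
      using ne by (auto simp: dist_norm norm_minus_commute)
    have "norm w < real (Suc N)"
      using norm_triangle_ineq2[of w z] w(2) N0(2) K by linarith
    then have inner: "inner_cell N i j" using outer_cell_norm[of N i j w] w(1) by linarith
    have "1 / e < real (Suc N)" using N0(1) K by linarith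
    then have h: "1 / real (Suc N) < e" using e by (simp add: field_simps)
    from inner w(1) show ?thesis
      by (rule inner_cellE) (use Q[OF inner h] w(2) in auto)
  qed
  then show ?thesis unfolding near_cells_def
    using e by (intro exI[of _ "Fin ` ball z e"] exI[of _ N0]) (auto intro: open_Fin_image)
qed

lemma near_cells_InftyI:
  assumes Q: "\<And>N i j w. inner_cell N i j \<Longrightarrow> R < norm w \<Longrightarrow>
      norm (w - Complex (grid_coord N i) (grid_coord N j)) \<le> 2 / real (Suc N) \<Longrightarrow>
      grid_coord N i \<le> Re w \<Longrightarrow> Re w \<le> grid_coord N i + 1 / real (Suc N) \<Longrightarrow>
      grid_coord N j \<le> Im w \<Longrightarrow> Im w \<le> grid_coord N j + 1 / real (Suc N) \<Longrightarrow> Q N i j"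
    and Q': "\<And>N i j. \<not> inner_cell N i j \<Longrightarrow> R < real (Suc N) \<Longrightarrow> Q N i j"
  shows "near_cells Infty Q"
proof -
  obtain N0 where N0: "R < real N0" using reals_Archimedean2 by blast
  have "Q N i j" if N: "N0 \<le> N" and ne: "cell N i j \<inter> insert Infty {Fin z |z. R < norm z} \<noteq> {}" for N i j
  proof (cases "inner_cell N i j")
    case True
    then obtain w where w: "Fin w \<in> cell N i j" "R < norm w"
      using ne by (auto simp: cell_def)
    from True w(1) show ?thesis
      by (rule inner_cellE) (use Q[OF True] w(2) in auto)
  next
    case False
    then show ?thesis using N N0 by (intro Q') auto
  qed
  then show ?thesis unfolding near_cells_def
    by (intro exI[of _ "insert Infty {Fin z |z. R < norm z}"] exI[of _ N0]) (auto simp: open_outside)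
qed

lemma near_cell_inside:
  assumes z: "z \<in> basic k" shows "near_cells z (\<lambda>N i j. cell_inside N i j k)"
proof (cases "is_rect k")
  case True
  let ?a = "real_of_rat (x_lo k)" and ?b = "real_of_rat (x_hi k)"
    and ?c = "real_of_rat (y_lo k)" and ?d = "real_of_rat (y_hi k)"
  obtain w where w: "z = Fin w" "?a < Re w" "Re w < ?b" "?c < Im w" "Im w < ?d"
    using z True by (auto simp: basic_eq rect_def)
  \<comment> \<open>Half the distance to the nearest side: one e for the step from w to u, another
    for the step from u across the cell.\<close>
  define e where "e = min (min (Re w - ?a) (?b - Re w)) (min (Im w - ?c) (?d - Im w)) / 2"
  have e: "0 < e" "2 * e \<le> Re w - ?a" "2 * e \<le> ?b - Re w" "2 * e \<le> Im w - ?c" "2 * e \<le> ?d - Im w"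
    using w by (auto simp: e_def)
  show ?thesis unfolding w(1)
  proof (rule near_cells_FinI[OF e(1)])
    fix N i j u
    assume u: "inner_cell N i j" "1 / real (Suc N) < e" "norm (u - w) < e"
      "grid_coord N i \<le> Re u" "Re u \<le> grid_coord N i + 1 / real (Suc N)"
      "grid_coord N j \<le> Im u" "Im u \<le> grid_coord N j + 1 / real (Suc N)"
    have "\<bar>Re u - Re w\<bar> < e" "\<bar>Im u - Im w\<bar> < e"
      using abs_Re_le_cmod[of "u - w"] abs_Im_le_cmod[of "u - w"] u(3) by simp_all
    then have "?a < grid_coord N i \<and> grid_coord N i + 1 / real (Suc N) < ?b \<and>
      ?c < grid_coord N j \<and> grid_coord N j + 1 / real (Suc N) < ?d"
      using u e by linarith
    then show "cell_inside N i j k" using True u(1) by (simp add: cell_inside_real Let_def)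
  qed
next
  case False
  let ?r = "real_of_rat (radius k)"
  show ?thesis
  proof (cases "?r \<le> 0")
    case True
    then have "cell_inside N i j k" for N i j using False by (simp add: cell_inside_real Let_def)
    then show ?thesis unfolding near_cells_def by (intro exI[of _ UNIV]) simp
  next
    case r: False
    show ?thesis
    proof (cases z)
      case (Fin w)
      have w: "?r < norm w" using z Fin False r by (simp add: basic_eq outer_pos)
      \<comment> \<open>Of the five parts one pays for the step from w to u, two for the step to the
        corner, and two for the margin 2h in the test.\<close>
      define e where "e = (norm w - ?r) / 5"
      have e: "0 < e" using w by (simp add: e_def)
      show ?thesis unfolding Fin
      proof (rule near_cells_FinI[OF e(1)])
        fix N i j u
        assume u: "inner_cell N i j" "1 / real (Suc N) < e" "norm (u - w) < e"
          "norm (u - Complex (grid_coord N i) (grid_coord N j)) \<le> 2 / real (Suc N)"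
        let ?v = "Complex (grid_coord N i) (grid_coord N j)"
        have "2 / real (Suc N) = 2 * (1 / real (Suc N))" by simp
        then have "norm (u - ?v) < 2 * e" using u(2,4) by linarith
        moreover have "norm w \<le> norm (u - w) + norm (u - ?v) + norm ?v"
          using norm_triangle_sub[of w u] norm_triangle_sub[of u ?v] by (simp add: norm_minus_commute)
        moreover have "5 * e = norm w - ?r" by (simp add: e_def)
        ultimately have "?r + 2 * (1 / real (Suc N)) < norm ?v" using u(2,3) by linarith
        then have "(?r + 2 * (1 / real (Suc N))) * (?r + 2 * (1 / real (Suc N))) <
            grid_coord N i * grid_coord N i + grid_coord N j * grid_coord N j"
          by (subst (asm) norm_Complex_less_iff) (use r in auto)
        then show "cell_inside N i j k" using False u(1) by (simp add: cell_inside_real Let_def)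
      qed
    next
      case Infty
      show ?thesis unfolding Infty
      \<comment> \<open>The mesh is at most 1, so 2 suffices for the distance to the corner and 2
        for the margin of the test.\<close>
      proof (rule near_cells_InftyI[of "?r + 4"])
        fix N i j u
        assume u: "inner_cell N i j" "?r + 4 < norm u"
          "norm (u - Complex (grid_coord N i) (grid_coord N j)) \<le> 2 / real (Suc N)"
        let ?v = "Complex (grid_coord N i) (grid_coord N j)"
        have h: "1 / real (Suc N) \<le> 1" by simp
        have "2 / real (Suc N) = 2 * (1 / real (Suc N))" by simp
        then have "norm (u - ?v) \<le> 2" using u(3) h by linarith
        then have "?r + 2 * (1 / real (Suc N)) < norm ?v"
          using u(2) norm_triangle_sub[of u ?v] h by linarith
        then have "(?r + 2 * (1 / real (Suc N))) * (?r + 2 * (1 / real (Suc N))) <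
            grid_coord N i * grid_coord N i + grid_coord N j * grid_coord N j"
          by (subst (asm) norm_Complex_less_iff) (use r in auto)
        then show "cell_inside N i j k" using False u(1) by (simp add: cell_inside_real Let_def)
      next
        fix N i j assume "\<not> inner_cell N i j" "?r + 4 < real (Suc N)"
        then show "cell_inside N i j k" using False by (simp add: cell_inside_real Let_def)
      qed
    qed
  qed
qed

lemma near_cell_outside:
  assumes z: "z \<notin> closure (basic k)" shows "near_cells z (\<lambda>N i j. cell_outside N i j k)"
proof (cases "is_rect k")
  case True
  let ?a = "real_of_rat (x_lo k)" and ?b = "real_of_rat (x_hi k)"
    and ?c = "real_of_rat (y_lo k)" and ?d = "real_of_rat (y_hi k)"
  show ?thesis
  proof (cases z)
    case (Fin w)
    then have "Re w < ?a \<or> ?b < Re w \<or> Im w < ?c \<or> ?d < Im w"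
      using z True by (auto simp: closure_basic in_cbox_complex_iff)
    \<comment> \<open>The largest violation of a side condition. It is halved below, to pay for the
      step from w to u and for crossing the cell.\<close>
    moreover define m where "m = max (max (?a - Re w) (Re w - ?b)) (max (?c - Im w) (Im w - ?d))"
    ultimately have m: "0 < m" "m = ?a - Re w \<or> m = Re w - ?b \<or> m = ?c - Im w \<or> m = Im w - ?d"
      by (auto simp: less_max_iff_disj max_def)
    define e where "e = m / 2"
    have e: "0 < e" "m = 2 * e" using m(1) by (simp_all add: e_def)
    show ?thesis unfolding Fin
    proof (rule near_cells_FinI[OF e(1)])
      fix N i j u
      assume u: "inner_cell N i j" "1 / real (Suc N) < e" "norm (u - w) < e"
        "grid_coord N i \<le> Re u" "Re u \<le> grid_coord N i + 1 / real (Suc N)"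
        "grid_coord N j \<le> Im u" "Im u \<le> grid_coord N j + 1 / real (Suc N)"
      have "\<bar>Re u - Re w\<bar> < e" "\<bar>Im u - Im w\<bar> < e"
        using abs_Re_le_cmod[of "u - w"] abs_Im_le_cmod[of "u - w"] u(3) by simp_all
      then have "grid_coord N i + 1 / real (Suc N) < ?a \<or> ?b < grid_coord N i \<or>
        grid_coord N j + 1 / real (Suc N) < ?c \<or> ?d < grid_coord N j"
        using m(2) u(2,4-7) e(2) by (elim disjE) linarith+
      then show "cell_outside N i j k" using True u(1) by (simp add: cell_outside_real Let_def)
    qed
  next
    case Infty
    define M where "M = max (max (max (- ?a) ?b) (max (- ?c) ?d)) 0"
    have M: "- ?a \<le> M" "?b \<le> M" "- ?c \<le> M" "?d \<le> M" "0 \<le> M" by (simp_all add: M_def)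
    show ?thesis unfolding Infty
    \<comment> \<open>Beyond this norm some coordinate exceeds M + 2 in absolute value, and a cell
      of side at most 1 through such a point stays beyond the rectangle.\<close>
    proof (rule near_cells_InftyI[of "2 * M + 4"])
      fix N i j u
      assume u: "inner_cell N i j" "2 * M + 4 < norm u"
        "grid_coord N i \<le> Re u" "Re u \<le> grid_coord N i + 1 / real (Suc N)"
        "grid_coord N j \<le> Im u" "Im u \<le> grid_coord N j + 1 / real (Suc N)"
      have h: "1 / real (Suc N) \<le> 1" by simp
      have "\<not> (\<bar>Re u\<bar> \<le> M + 2 \<and> \<bar>Im u\<bar> \<le> M + 2)" using cmod_le[of u] u(2) by auto
      then have "M + 2 < Re u \<or> Re u < - M - 2 \<or> M + 2 < Im u \<or> Im u < - M - 2" by (auto simp: abs_le_iff)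
      then have "grid_coord N i + 1 / real (Suc N) < ?a \<or> ?b < grid_coord N i \<or>
        grid_coord N j + 1 / real (Suc N) < ?c \<or> ?d < grid_coord N j"
        using u(3-6) h M by (elim disjE) linarith+
      then show "cell_outside N i j k" using True u(1) by (simp add: cell_outside_real Let_def)
    next
      fix N i j assume o: "\<not> inner_cell N i j" "2 * M + 4 < real (Suc N)"
      have "M < real (Suc N)" using o(2) M(5) by linarith
      then have "- 1 * real (Suc N) < ?a \<and> ?b < real (Suc N) \<and> - 1 * real (Suc N) < ?c \<and> ?d < real (Suc N)"
        using M by simp
      then show "cell_outside N i j k" using True o(1) by (simp add: cell_outside_real Let_def)
    qed
  qed
next
  case False
  let ?r = "real_of_rat (radius k)"
  obtain w where w: "z = Fin w" "norm w < ?r"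
    using z False by (auto simp: closure_basic split: if_splits)
  define e where "e = (?r - norm w) / 5"
  have e: "0 < e" using w by (simp add: e_def)
  show ?thesis unfolding w(1)
  proof (rule near_cells_FinI[OF e(1)])
    fix N i j u
    assume u: "inner_cell N i j" "1 / real (Suc N) < e" "norm (u - w) < e"
      "norm (u - Complex (grid_coord N i) (grid_coord N j)) \<le> 2 / real (Suc N)"
    let ?v = "Complex (grid_coord N i) (grid_coord N j)"
    have "2 / real (Suc N) = 2 * (1 / real (Suc N))" by simp
    then have "norm (u - ?v) < 2 * e" using u(2,4) by linarith
    moreover have "norm ?v \<le> norm (u - w) + norm (u - ?v) + norm w"
      using norm_triangle_sub[of ?v u] norm_triangle_sub[of u w] by (simp add: norm_minus_commute)
    moreover have "5 * e = ?r - norm w" by (simp add: e_def)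
    ultimately have *: "norm ?v < ?r - 2 * (1 / real (Suc N))" using u(2,3) by linarith
    then have pos: "0 < ?r - 2 * (1 / real (Suc N))" using norm_ge_zero[of ?v] by linarith
    then have "grid_coord N i * grid_coord N i + grid_coord N j * grid_coord N j <
        (?r - 2 * (1 / real (Suc N))) * (?r - 2 * (1 / real (Suc N)))"
      using * by (subst (asm) norm_Complex_less_iff) auto
    then show "cell_outside N i j k" using False u(1) pos by (simp add: cell_outside_real Let_def)
  qed
qed

text \<open>A Lebesgue number argument on the compact sphere.\<close>

lemma near_cells_uniform:
  assumes Q: "\<And>z. near_cells z (Q z)"
  obtains C N0 where "finite C" "\<And>N i j. N0 \<le> N \<Longrightarrow> \<exists>z\<in>C. Q z N i j"
proof -
  have "\<exists>p. open (fst p) \<and> z \<in> fst p \<and> (\<forall>N\<ge>snd p. \<forall>i j. cell N i j \<inter> fst p \<noteq> {} \<longrightarrow> Q z N i j)" for z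
  proof -
    obtain W N0 where "open W" "z \<in> W" "\<forall>N\<ge>N0. \<forall>i j. cell N i j \<inter> W \<noteq> {} \<longrightarrow> Q z N i j"
      using Q[of z] unfolding near_cells_def by blast
    then show ?thesis by (intro exI[of _ "(W, N0)"]) simp
  qed
  then have "\<forall>z. \<exists>p. open (fst p) \<and> z \<in> fst p \<and>
      (\<forall>N\<ge>snd p. \<forall>i j. cell N i j \<inter> fst p \<noteq> {} \<longrightarrow> Q z N i j)" by (rule allI)
  from choice[OF this] obtain p where p: "\<forall>z. open (fst (p z)) \<and> z \<in> fst (p z) \<and>
      (\<forall>N\<ge>snd (p z). \<forall>i j. cell N i j \<inter> fst (p z) \<noteq> {} \<longrightarrow> Q z N i j)" by (rule exE)
  define W where "W = (\<lambda>z. fst (p z))"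
  define N0 where "N0 = (\<lambda>z. snd (p z))"
  have W: "open (W z)" "z \<in> W z" "N0 z \<le> N \<Longrightarrow> cell N i j \<inter> W z \<noteq> {} \<Longrightarrow> Q z N i j" for z N i j
    using p by (simp_all add: W_def N0_def)
  have cov: "UNIV \<subseteq> (\<Union>z\<in>UNIV. W z)" using W(2) by blast
  obtain C where C: "C \<subseteq> UNIV" "finite C" "UNIV \<subseteq> (\<Union>z\<in>C. W z)"
    by (rule compactE_image[OF compact_UNIV_ecomplex W(1) cov])
  have "\<exists>z\<in>C. Q z N i j" if N: "Max (insert 0 (N0 ` C)) \<le> N" for N i j
  proof -
    obtain t where t: "t \<in> cell N i j" using cell_nonempty by blast
    then obtain z where z: "z \<in> C" "t \<in> W z" using C by blast
    then have "N0 z \<le> N" using N C(2) by simp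
    then show ?thesis using W(3)[of z N i j] t z by blast
  qed
  then show thesis using that C(2) by blast
qed

lemma near_cells_mono:
  assumes "near_cells z Q" "\<And>N i j. Q N i j \<Longrightarrow> R N i j"
  shows "near_cells z R"
  using assms unfolding near_cells_def by metis

lemma near_cells_True: "near_cells z (\<lambda>N i j. True)"
  unfolding near_cells_def by blast

lemma near_cells_conj:
  assumes "near_cells z Q" "near_cells z R"
  shows "near_cells z (\<lambda>N i j. Q N i j \<and> R N i j)"
proof -
  obtain V N0 where V: "open V" "z \<in> V" "\<forall>N\<ge>N0. \<forall>i j. cell N i j \<inter> V \<noteq> {} \<longrightarrow> Q N i j"
    using assms(1) unfolding near_cells_def by blast
  obtain W N1 where W: "open W" "z \<in> W" "\<forall>N\<ge>N1. \<forall>i j. cell N i j \<inter> W \<noteq> {} \<longrightarrow> R N i j"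
    using assms(2) unfolding near_cells_def by blast
  have "Q N i j \<and> R N i j" if "max N0 N1 \<le> N" "cell N i j \<inter> (V \<inter> W) \<noteq> {}" for N i j
    using V(3)[rule_format, of N i j] W(3)[rule_format, of N i j] that by auto
  then show ?thesis unfolding near_cells_def
    using V(1,2) W(1,2) by (intro exI[of _ "V \<inter> W"] exI[of _ "max N0 N1"]) auto
qed

lemma near_cells_at:
  assumes "near_cells z Q"
  obtains N0 where "\<And>N. N0 \<le> N \<Longrightarrow> \<exists>i<cell_index N. \<exists>j<cell_index N. Q N i j"
proof -
  obtain V N0 where V: "open V" "z \<in> V" "\<forall>N\<ge>N0. \<forall>i j. cell N i j \<inter> V \<noteq> {} \<longrightarrow> Q N i j"
    using assms unfolding near_cells_def by blast
  have "\<exists>i<cell_index N. \<exists>j<cell_index N. Q N i j" if N: "N0 \<le> N" for N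
  proof -
    obtain i j where ij: "i < cell_index N" "j < cell_index N" "z \<in> cell N i j"
      using cells_cover by blast
    then have "cell N i j \<inter> V \<noteq> {}" using V(2) by blast
    then show ?thesis using V(3) N ij by blast
  qed
  then show thesis using that by blast
qed

text \<open>Every point of the sphere misses one of the two closures, so one of the two tests
  succeeds near it.\<close>

lemma cells_separate:
  assumes "closure (basic k) \<inter> closure (basic l) = {}"
  obtains N0 where "\<And>N i j. N0 \<le> N \<Longrightarrow> cell_outside N i j k \<or> cell_outside N i j l"
proof -
  have "near_cells z (\<lambda>N i j. cell_outside N i j k \<or> cell_outside N i j l)" for z
  proof (cases "z \<in> closure (basic k)")
    case True
    then have "z \<notin> closure (basic l)" using assms by blast
    from near_cell_outside[OF this] show ?thesis by (rule near_cells_mono) simp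
  next
    case False
    from near_cell_outside[OF this] show ?thesis by (rule near_cells_mono) simp
  qed
  from near_cells_uniform[of "\<lambda>_ N i j. cell_outside N i j k \<or> cell_outside N i j l", OF this]
  show thesis using that by metis
qed

section \<open>Certificates for the image\<close>

type_synonym entry = "nat \<times> nat list \<times> nat"

text \<open>An entry (e, [x, w], v) of a derivation records a run of machine e on the oracle prefix x
  and the word w, with output word v.\<close>

definition input_word :: "entry \<Rightarrow> nat list" where
  "input_word s = (case drop 1 (fst (snd s)) of [] \<Rightarrow> [] | c # _ \<Rightarrow> list_decode c)"

definition output_word :: "entry \<Rightarrow> nat list" where
  "output_word s = list_decode (snd (snd s))"

text \<open>A derivation may contain anything; this selects entries for the given machine whose
  oracle argument is the true prefix. Both prefixes have equal length because \<open>t2_out\<close>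
  cuts all tapes at the same cell. The length bound ensures that enough of the oracle has been
  read.\<close>

definition run_entry :: "nat \<Rightarrow> nat list \<Rightarrow> entry \<Rightarrow> bool" where
  "run_entry e x s \<longleftrightarrow> fst s = e \<and> length (input_word s) \<le> length x \<and>
     fst (snd s) = [list_encode (take (length (input_word s)) x), list_encode (input_word s)]"

definition cell_inside_word :: "nat \<Rightarrow> nat \<Rightarrow> nat \<Rightarrow> nat list \<Rightarrow> bool" where
  "cell_inside_word N i j w \<longleftrightarrow> (\<forall>c\<in>set w. c \<noteq> 0 \<longrightarrow> cell_inside N i j (c - 1))"

text \<open>A finite proof that the closures are disjoint: each point of the sphere lies in some
  cell, and that cell misses one of them.\<close>

definition separated :: "nat \<Rightarrow> nat \<Rightarrow> nat \<Rightarrow> bool" where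
  "separated M k l \<longleftrightarrow>
    (\<forall>a<cell_index M. \<forall>b<cell_index M. cell_outside M a b k \<or> cell_outside M a b l)"

text \<open>A finite proof that the basic set meets all the sets listed in \<open>w\<close> in a
  common point, since cells are nonempty.\<close>

definition common_cell :: "nat \<Rightarrow> nat \<Rightarrow> nat list \<Rightarrow> bool" where
  "common_cell M k w \<longleftrightarrow>
    (\<exists>a<cell_index M. \<exists>b<cell_index M. cell_inside M a b k \<and> cell_inside_word M a b w)"

definition avoided_on :: "nat \<Rightarrow> nat list \<Rightarrow> entry list \<Rightarrow> nat \<Rightarrow> nat \<Rightarrow> nat \<Rightarrow> nat \<Rightarrow> bool" where
  "avoided_on e x d M a b l \<longleftrightarrow>
    (\<exists>t\<in>set d. run_entry e x t \<and> cell_inside_word M a b (input_word t) \<and>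
      (\<exists>w\<in>set (output_word t). w \<noteq> 0 \<and> separated M (w - 1) l))"

text \<open>Cells that pass neither test include all those meeting the boundary of basic set
  \<open>k\<close>; on each of them a run must keep f away from basic set \<open>l\<close>.\<close>

definition boundary_avoided :: "nat \<Rightarrow> nat list \<Rightarrow> entry list \<Rightarrow> nat \<Rightarrow> nat \<Rightarrow> nat \<Rightarrow> bool" where
  "boundary_avoided e x d M k l \<longleftrightarrow>
    (\<forall>a<cell_index M. \<forall>b<cell_index M.
      cell_inside M a b k \<or> cell_outside M a b k \<or> avoided_on e x d M a b l)"

text \<open>The certificate behind \<open>connected_subset_image\<close>: G is listed by
  \<open>p\<close>, so its closure lies in U; the run \<open>s\<close> shows that f(G) meets V; the
  last clause keeps the boundary of G away from V. Level \<open>N\<close> cuts the target set, while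
  level \<open>M\<close> serves the auxiliary checks in domain and range.\<close>

definition covers_cell :: "nat \<Rightarrow> nat list \<Rightarrow> nat list \<Rightarrow> entry list \<Rightarrow> nat \<Rightarrow> nat \<Rightarrow> nat \<Rightarrow> nat \<Rightarrow> bool" where
  "covers_cell e x p d M N i j \<longleftrightarrow>
    (\<exists>g\<in>set p. g \<noteq> 0 \<and>
     (\<exists>s\<in>set d. run_entry e x s \<and> common_cell M (g - 1) (input_word s) \<and>
      (\<exists>v\<in>set (output_word s). v \<noteq> 0 \<and> cell_inside N i j (v - 1) \<and>
       boundary_avoided e x d M (g - 1) (v - 1))))"

definition accepts :: "nat \<Rightarrow> nat list \<Rightarrow> nat list \<Rightarrow> nat \<Rightarrow> entry list \<Rightarrow> nat \<Rightarrow> nat \<Rightarrow> bool" where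
  "accepts e x p k d N M \<longleftrightarrow> derivation d \<and>
    (\<forall>i<cell_index N. \<forall>j<cell_index N. cell_outside N i j k \<or> covers_cell e x p d M N i j)"

section \<open>Decidability of the certificate checks\<close>

lemma computable_input_word [computable_intros]:
  "computable s \<Longrightarrow> computable (\<lambda>x. input_word (s x))"
  unfolding input_word_def by (intro computable_intros)

lemma computable_output_word [computable_intros]:
  "computable s \<Longrightarrow> computable (\<lambda>x. output_word (s x))"
  unfolding output_word_def by (intro computable_intros)

lemma computable_run_entry [computable_intros]:
  "computable e \<Longrightarrow> computable x \<Longrightarrow> computable s \<Longrightarrow> computable (\<lambda>z. run_entry (e z) (x z) (s z))"
  unfolding run_entry_def by (intro computable_intros)

lemma computable_cell_inside_word:
  assumes "computable N" "computable i" "computable j" "computable w"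
  shows "computable (\<lambda>x. cell_inside_word (N x) (i x) (j x) (w x))"
proof -
  have "computable (\<lambda>z. cell_inside_word (fst z) (fst (snd z)) (fst (snd (snd z))) (snd (snd (snd z))))"
    unfolding cell_inside_word_def by (intro computable_intros computable_cell_inside)
  from computable_compose[OF this, of "\<lambda>x. (N x, i x, j x, w x)"] show ?thesis
    by (simp add: computable_Pair assms)
qed

lemma computable_separated:
  assumes "computable M" "computable k" "computable l"
  shows "computable (\<lambda>x. separated (M x) (k x) (l x))"
proof -
  have "computable (\<lambda>z. separated (fst z) (fst (snd z)) (snd (snd z)))"
    unfolding separated_def by (intro computable_intros computable_cell_outside)
  from computable_compose[OF this, of "\<lambda>x. (M x, k x, l x)"] show ?thesis
    by (simp add: computable_Pair assms)
qed

lemma computable_common_cell: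
  assumes "computable M" "computable k" "computable w"
  shows "computable (\<lambda>x. common_cell (M x) (k x) (w x))"
proof -
  have "computable (\<lambda>z. common_cell (fst z) (fst (snd z)) (snd (snd z)))"
    unfolding common_cell_def
    by (intro computable_intros computable_cell_inside computable_cell_inside_word)
  from computable_compose[OF this, of "\<lambda>x. (M x, k x, w x)"] show ?thesis
    by (simp add: computable_Pair assms)
qed

lemma computable_avoided_on:
  assumes "computable e" "computable y" "computable d" "computable M" "computable a" "computable b" "computable l"
  shows "computable (\<lambda>x. avoided_on (e x) (y x) (d x) (M x) (a x) (b x) (l x))"
proof -
  have "computable (\<lambda>z. avoided_on (fst z) (fst (snd z)) (fst (snd (snd z))) (fst (snd (snd (snd z))))
      (fst (snd (snd (snd (snd z))))) (fst (snd (snd (snd (snd (snd z)))))) (snd (snd (snd (snd (snd (snd z)))))))"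
    unfolding avoided_on_def
    by (intro computable_intros computable_cell_inside_word computable_separated)
  from computable_compose[OF this, of "\<lambda>x. (e x, y x, d x, M x, a x, b x, l x)"] show ?thesis
    by (simp add: computable_Pair assms)
qed

lemma computable_boundary_avoided:
  assumes "computable e" "computable y" "computable d" "computable M" "computable k" "computable l"
  shows "computable (\<lambda>x. boundary_avoided (e x) (y x) (d x) (M x) (k x) (l x))"
proof -
  have "computable (\<lambda>z. boundary_avoided (fst z) (fst (snd z)) (fst (snd (snd z))) (fst (snd (snd (snd z))))
      (fst (snd (snd (snd (snd z))))) (snd (snd (snd (snd (snd z))))))"
    unfolding boundary_avoided_def
    by (intro computable_intros computable_cell_inside computable_cell_outside computable_avoided_on)
  from computable_compose[OF this, of "\<lambda>x. (e x, y x, d x, M x, k x, l x)"] show ?thesis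
    by (simp add: computable_Pair assms)
qed

lemma computable_covers_cell:
  assumes "computable e" "computable y" "computable p" "computable d" "computable M" "computable N"
    "computable i" "computable j"
  shows "computable (\<lambda>x. covers_cell (e x) (y x) (p x) (d x) (M x) (N x) (i x) (j x))"
proof -
  have "computable (\<lambda>z. covers_cell (fst z) (fst (snd z)) (fst (snd (snd z))) (fst (snd (snd (snd z))))
      (fst (snd (snd (snd (snd z))))) (fst (snd (snd (snd (snd (snd z))))))
      (fst (snd (snd (snd (snd (snd (snd z))))))) (snd (snd (snd (snd (snd (snd (snd z))))))))"
    unfolding covers_cell_def
    by (intro computable_intros computable_cell_inside computable_common_cell computable_boundary_avoided)
  from computable_compose[OF this, of "\<lambda>x. (e x, y x, p x, d x, M x, N x, i x, j x)"] show ?thesis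
    by (simp add: computable_Pair assms)
qed

lemma computable_accepts:
  assumes "computable e" "computable y" "computable p" "computable k" "computable d" "computable N"
    "computable M"
  shows "computable (\<lambda>x. accepts (e x) (y x) (p x) (k x) (d x) (N x) (M x))"
proof -
  have "computable (\<lambda>z. accepts (fst z) (fst (snd z)) (fst (snd (snd z))) (fst (snd (snd (snd z))))
      (fst (snd (snd (snd (snd z))))) (fst (snd (snd (snd (snd (snd z)))))) (snd (snd (snd (snd (snd (snd z)))))))"
    unfolding accepts_def
    by (intro computable_intros computable_cell_outside computable_derivation computable_covers_cell)
  from computable_compose[OF this, of "\<lambda>x. (e x, y x, p x, k x, d x, N x, M x)"] show ?thesis
    by (simp add: computable_Pair assms)
qed

text \<open>Position i codes a basic set, a prefix length n and a coded certificate. A component of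
  a pair is at most its code, so n \<le> i: the answer at i depends on the first n cells only, and
  reading more input merely extends the output. A rejected candidate prints the padding value
  0.\<close>

definition answers :: "nat \<Rightarrow> nat list \<Rightarrow> nat list \<Rightarrow> nat list" where
  "answers e x p = map (\<lambda>i. let k = fst (prod_decode i); m = snd (prod_decode i);
      n = fst (prod_decode m); c = dec (snd (prod_decode m))
    in if accepts e (take n x) (take n p) k (fst c) (fst (snd c)) (snd (snd c)) then Suc k else 0) [0..<length p]"

lemma computable_answers: "computable (\<lambda>z. answers (fst z) (fst (snd z)) (snd (snd z)))"
  unfolding answers_def Let_def
  by (intro computable_intros computable_accepts computable_compose[OF computable_dec])

lemma machine_for_answers:
  obtains P where "\<And>e x p v. reval P [e, list_encode x, list_encode p] v \<longleftrightarrow> v = list_encode (answers e x p)"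
proof -
  obtain h where h: "realizes h (\<lambda>z. answers (fst z) (fst (snd z)) (snd (snd z)))"
    using computable_answers unfolding computable_def by blast
  have "total_rec 3 (\<lambda>xs. h (prod_encode (xs ! 0, prod_encode (xs ! 1, xs ! 2))))"
    by (intro realizes_total_rec[OF h] total_rec_prod_encode total_rec_nth) auto
  then obtain P where P: "\<And>xs. length xs = 3 \<Longrightarrow> reval P xs (h (prod_encode (xs ! 0, prod_encode (xs ! 1, xs ! 2))))"
    unfolding total_rec_def by blast
  have "h (prod_encode (e, prod_encode (list_encode x, list_encode p))) = list_encode (answers e x p)" for e x p
  proof -
    have "list_decode (h (prod_encode (e, prod_encode (list_encode x, list_encode p)))) = answers e x p"
      using realizes_dec[OF h, of "prod_encode (e, prod_encode (list_encode x, list_encode p))"]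
      by (simp add: dec_list_def dec_prod_def dec_nat_def)
    then show ?thesis by (metis list_decode_inverse)
  qed
  then have "reval P [e, list_encode x, list_encode p] (list_encode (answers e x p))" for e x p
    using P[of "[e, list_encode x, list_encode p]"] by (simp add: numeral_2_eq_2)
  then show thesis by (intro that[of P]) (auto dest: reval_deterministic)
qed

section \<open>Words, names and the meaning of finite runs\<close>

definition word_set :: "nat list \<Rightarrow> ecomplex set" where
  "word_set w = {z. \<forall>c\<in>set w. c \<noteq> 0 \<longrightarrow> z \<in> basic (c - 1)}"

lemma cell_inside_word_sound: "cell_inside_word N i j w \<Longrightarrow> cell N i j \<subseteq> word_set w"
  using cell_inside_sound unfolding cell_inside_word_def word_set_def by blast

lemma near_cell_inside_word:
  assumes "z \<in> word_set w" shows "near_cells z (\<lambda>N i j. cell_inside_word N i j w)"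
  using assms
proof (induction w)
  case Nil
  show ?case by (rule near_cells_mono[OF near_cells_True]) (simp add: cell_inside_word_def)
next
  case (Cons c w)
  have "near_cells z (\<lambda>N i j. c \<noteq> 0 \<longrightarrow> cell_inside N i j (c - 1))"
  proof (cases "c = 0")
    case True
    then show ?thesis by (intro near_cells_mono[OF near_cells_True]) simp
  next
    case False
    then have "z \<in> basic (c - 1)" using Cons.prems by (simp add: word_set_def)
    from near_cell_inside[OF this] show ?thesis by (rule near_cells_mono) simp
  qed
  moreover have "near_cells z (\<lambda>N i j. cell_inside_word N i j w)"
    using Cons by (simp add: word_set_def)
  ultimately have "near_cells z (\<lambda>N i j. (c \<noteq> 0 \<longrightarrow> cell_inside N i j (c - 1)) \<and> cell_inside_word N i j w)"
    by (rule near_cells_conj)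
  then show ?case by (rule near_cells_mono) (simp add: cell_inside_word_def)
qed

text \<open>After the word, position \<open>length w + k\<close> lists basic set k exactly if it
  contains z. No computability of the continuation is needed, since it occurs only in the proof of
  correctness.\<close>

lemma name_point_extend:
  assumes "z \<in> word_set w"
  obtains q where "name_point q z" "map q [0..<length w] = w"
proof -
  define q where "q = (\<lambda>n. if n < length w then w ! n
    else if z \<in> basic (n - length w) then Suc (n - length w) else 0)"
  have q: "q n \<noteq> 0 \<Longrightarrow> z \<in> basic (q n - 1)" for n
    using assms by (auto simp: q_def word_set_def)
  have "B \<in> listed q \<longleftrightarrow> B \<in> basis \<and> z \<in> B" for B
  proof
    assume "B \<in> listed q"
    then obtain k n where k: "B = basic k" "q n = Suc k" unfolding listed_def by blast
    then have "z \<in> B" using q[of n] by simp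
    then show "B \<in> basis \<and> z \<in> B" using k(1) basic_in_basis by simp
  next
    assume B: "B \<in> basis \<and> z \<in> B"
    then obtain k where k: "B = basic k" using basis_basicE by blast
    then have "q (length w + k) = Suc k" using B by (simp add: q_def)
    then show "B \<in> listed q" using k unfolding listed_def by blast
  qed
  then have "name_point q z" unfolding name_point_def by blast
  moreover have "map q [0..<length w] = w" by (intro nth_equalityI) (auto simp: q_def)
  ultimately show thesis using that by blast
qed

text \<open>A number that codes no program acts as \<open>RZ\<close>. That program returns only 0,
  the code of the empty word, and so never writes an infinite output.\<close>

lemma t2_out_encode:
  assumes "t2_out (prog e) args tapes r" obtains P where "e = encode P" "prog e = P"
proof (cases "\<exists>P. encode P = e")
  case True then show thesis using that prog_encode by blast
next
  case False
  then have "prog e = RZ" by (simp add: prog_def)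
  moreover obtain n v where "reval (prog e) (args @ map (\<lambda>q. list_encode (map q [0..<n])) tapes) v"
    "1 \<le> length (list_decode v)"
    using assms unfolding t2_out_def by blast
  ultimately show thesis by (simp add: reval_Z)
qed

locale meromorphic_names =
  fixes f :: "ecomplex \<Rightarrow> ecomplex" and D U :: "ecomplex set" and X :: "nat set" and e :: nat
    and p :: "nat \<Rightarrow> nat"
  assumes mero: "meromorphic_hat f D" and nonconst: "nonconstant_hat f D"
    and fname: "name_fun X e f D" and openU: "open U" and UD: "U \<subseteq> D" and pname: "name_open p U"
begin

definition xs :: "nat \<Rightarrow> nat list" where "xs n = map (char_seq X) [0..<n]"

definition ps :: "nat \<Rightarrow> nat list" where "ps n = map p [0..<n]"

lemma continuous_f: "continuous_on D f"
  using mero by (simp add: meromorphic_hat_def)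

text \<open>The input word continues to a name of z, and what the machine has written on it is never
  retracted; so the listed set belongs to a name of f z.\<close>

lemma entry_sound:
  assumes d: "derivation d" "s \<in> set d" and s: "run_entry e (xs n) s"
    and c: "c \<in> set (output_word s)" "c \<noteq> 0" and z: "z \<in> D" "z \<in> word_set (input_word s)"
  shows "f z \<in> basic (c - 1)"
proof -
  let ?w = "input_word s"
  obtain q where q: "name_point q z" "map q [0..<length ?w] = ?w"
    using name_point_extend[OF z(2)] by blast
  obtain r where r: "t2_out (prog e) [] [char_seq X, q] r" "name_point r (f z)"
    using fname z(1) q(1) unfolding name_fun_def by blast
  obtain P where P: "e = encode P" "prog e = P" using t2_out_encode[OF r(1)] by blast
  have len: "length ?w \<le> n" using s by (simp add: run_entry_def xs_def)
  then have "take (length ?w) (xs n) = map (char_seq X) [0..<length ?w]"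
    by (simp add: xs_def take_map min_def)
  then have "s = (encode P, [list_encode (map (char_seq X) [0..<length ?w]), list_encode (map q [0..<length ?w])], snd (snd s))"
    using s P(1) unfolding q(2) run_entry_def by (metis prod.collapse)
  then have "reval P [list_encode (map (char_seq X) [0..<length ?w]), list_encode (map q [0..<length ?w])] (snd (snd s))"
    using derivation_sound[OF d(1)] d(2) by metis
  then have "output_word s = map r [0..<length (output_word s)]"
    using r(1) unfolding t2_out_def P(2) output_word_def by simp
  then obtain i where "c = r i" using c(1) by (metis (no_types, lifting) imageE list.set_map)
  then have "r i = Suc (c - 1)" using c(2) by simp
  then have "basic (c - 1) \<in> listed r" unfolding listed_def by blast
  then show ?thesis using r(2) unfolding name_point_def by blast
qed

text \<open>On a name of z the output must eventually list B; the halting computation that does so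
  has a finite derivation, which remains usable for every longer oracle prefix.\<close>

lemma entry_complete:
  assumes z: "z \<in> D" and B: "B \<in> basis" "f z \<in> B"
  shows "\<exists>d s n0 c. derivation d \<and> s \<in> set d \<and> (\<forall>n\<ge>n0. run_entry e (xs n) s) \<and>
    z \<in> word_set (input_word s) \<and> c \<in> set (output_word s) \<and> c \<noteq> 0 \<and> basic (c - 1) = B"
proof -
  obtain q where q: "name_point q z"
    using name_point_extend[of z "[]"] by (auto simp: word_set_def)
  obtain r where r: "t2_out (prog e) [] [char_seq X, q] r" "name_point r (f z)"
    using fname z q(1) unfolding name_fun_def by blast
  obtain P where P: "e = encode P" "prog e = P" using t2_out_encode[OF r(1)] by blast
  have "B \<in> listed r" using r(2) B unfolding name_point_def by blast
  then obtain i k where k: "B = basic k" "r i = Suc k" unfolding listed_def by blast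
  obtain n v where v: "reval P [list_encode (xs n), list_encode (map q [0..<n])] v"
    "Suc i \<le> length (list_decode v)"
  proof -
    have "\<forall>k. \<exists>n v. reval P [list_encode (xs n), list_encode (map q [0..<n])] v \<and> k \<le> length (list_decode v)"
      using r(1) unfolding t2_out_def P(2) xs_def by simp
    then show thesis using that by blast
  qed
  have "list_decode v = map r [0..<length (list_decode v)]"
    using r(1) v(1) unfolding t2_out_def P(2) xs_def by simp
  moreover have "i \<in> set [0..<length (list_decode v)]" using v(2) by simp
  ultimately have c: "Suc k \<in> set (list_decode v)" using k(2) by (metis image_eqI list.set_map)
  obtain d where d: "derivation d" "(encode P, [list_encode (xs n), list_encode (map q [0..<n])], v) \<in> set d"
    using derivation_complete[OF v(1)] by blast
  let ?s = "(encode P, [list_encode (xs n), list_encode (map q [0..<n])], v)"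
  have w: "input_word ?s = map q [0..<n]" by (simp add: input_word_def)
  have "run_entry e (xs m) ?s" if "n \<le> m" for m
    using that P(1) unfolding run_entry_def w by (simp add: xs_def take_map min_def)
  moreover have "z \<in> word_set (input_word ?s)"
  proof -
    have "z \<in> basic (c - 1)" if "c \<in> set (map q [0..<n])" "c \<noteq> 0" for c
    proof -
      obtain i where "q i = Suc (c - 1)" using \<open>c \<in> set (map q [0..<n])\<close> \<open>c \<noteq> 0\<close> by auto
      then have "basic (c - 1) \<in> listed q" unfolding listed_def by blast
      then show ?thesis using q unfolding name_point_def by blast
    qed
    then show ?thesis unfolding w word_set_def by blast
  qed
  moreover have "Suc k \<in> set (output_word ?s)" using c by (simp add: output_word_def)
  ultimately show ?thesis using d k(1)
    by (intro exI[of _ d] exI[of _ ?s] exI[of _ n] exI[of _ "Suc k"]) simp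
qed

lemma covers_cell_sound:
  assumes d: "derivation d" and c: "covers_cell e (xs n) (ps m) d M N i j"
  shows "cell N i j \<subseteq> f ` U"
proof -
  obtain g s v a b where g: "g \<in> set (ps m)" "g \<noteq> 0"
    and s: "s \<in> set d" "run_entry e (xs n) s"
    and v: "v \<in> set (output_word s)" "v \<noteq> 0" "cell_inside N i j (v - 1)"
    and ab: "cell_inside M a b (g - 1)" "cell_inside_word M a b (input_word s)"
    and bd: "boundary_avoided e (xs n) d M (g - 1) (v - 1)"
    using c unfolding covers_cell_def common_cell_def by blast
  let ?G = "basic (g - 1)" and ?V = "basic (v - 1)"
  obtain i0 where "p i0 = g" using g(1) by (auto simp: ps_def)
  then have "p i0 = Suc (g - 1)" using g(2) by simp
  then have "?G \<in> listed p" unfolding listed_def by blast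
  then have clG: "closure ?G \<subseteq> U" using pname unfolding name_open_def by blast
  then have GU: "?G \<subseteq> U" using closure_subset by blast
  have "?V \<subseteq> f ` ?G"
  proof (rule connected_subset_image)
    show "continuous_on (closure ?G) f"
      by (rule continuous_on_subset[OF continuous_f]) (use clG UD in blast)
    show "open (f ` ?G)"
      by (rule open_meromorphic_image[OF mero nonconst open_basic]) (use GU UD in blast)
    show "connected ?V" by (rule connected_basic)
    obtain z where z: "z \<in> cell M a b" using cell_nonempty by blast
    have "z \<in> ?G" "z \<in> word_set (input_word s)"
      using z cell_inside_sound[OF ab(1)] cell_inside_word_sound[OF ab(2)] by blast+
    moreover from this have "f z \<in> ?V"
      using entry_sound[OF d s v(1,2)] GU UD by blast
    ultimately show "?V \<inter> f ` ?G \<noteq> {}" by blast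
    show "f \<zeta> \<notin> ?V" if \<zeta>: "\<zeta> \<in> closure ?G" "\<zeta> \<notin> ?G" for \<zeta>
    proof
      assume "f \<zeta> \<in> ?V"
      \<comment> \<open>The cell of \<zeta> passes neither test, so the certificate supplies a run
        on it. The separation check, applied to the cell of f \<zeta>, then contradicts f \<zeta>
        lying in both output sets.\<close>
      obtain a b where ab: "a < cell_index M" "b < cell_index M" "\<zeta> \<in> cell M a b"
        using cells_cover by blast
      have "\<not> cell_inside M a b (g - 1)" using cell_inside_sound ab(3) \<zeta>(2) by blast
      moreover have "\<not> cell_outside M a b (g - 1)" using cell_outside_sound ab(3) \<zeta>(1) by blast
      ultimately obtain t w where t: "t \<in> set d" "run_entry e (xs n) t" "cell_inside_word M a b (input_word t)"
        "w \<in> set (output_word t)" "w \<noteq> 0"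
        "\<forall>a'<cell_index M. \<forall>b'<cell_index M. cell_outside M a' b' (w - 1) \<or> cell_outside M a' b' (v - 1)"
        using bd ab(1,2) unfolding boundary_avoided_def avoided_on_def separated_def by blast
      have "\<zeta> \<in> word_set (input_word t)" using cell_inside_word_sound[OF t(3)] ab(3) by blast
      then have "f \<zeta> \<in> basic (w - 1)"
        using entry_sound[OF d t(1,2,4,5)] \<zeta>(1) clG UD by blast
      obtain a' b' where ab': "a' < cell_index M" "b' < cell_index M" "f \<zeta> \<in> cell M a' b'"
        using cells_cover by blast
      then have "f \<zeta> \<notin> closure (basic (w - 1)) \<or> f \<zeta> \<notin> closure ?V"
        using t(6) cell_outside_sound by blast
      then show False using \<open>f \<zeta> \<in> ?V\<close> \<open>f \<zeta> \<in> basic (w - 1)\<close> closure_subset by blast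
    qed
  qed
  then show ?thesis using cell_inside_sound[OF v(3)] GU by blast
qed

lemma accepts_sound:
  assumes "accepts e (xs n) (ps m) k d N M" shows "closure (basic k) \<subseteq> f ` U"
proof
  fix z assume z: "z \<in> closure (basic k)"
  obtain i j where ij: "i < cell_index N" "j < cell_index N" "z \<in> cell N i j"
    using cells_cover by blast
  have "\<not> cell_outside N i j k" using cell_outside_sound ij(3) z by blast
  then have "covers_cell e (xs n) (ps m) d M N i j" "derivation d"
    using assms ij(1,2) unfolding accepts_def by blast+
  then show "z \<in> f ` U" using covers_cell_sound ij(3) by blast
qed

section \<open>Existence of certificates\<close>

lemma name_openE:
  assumes "B \<in> basis" "closure B \<subseteq> U"
  obtains i k where "B = basic k" "p i = Suc k"
proof -
  have "B \<in> listed p" using pname assms unfolding name_open_def by blast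
  then show thesis using that unfolding listed_def by blast
qed

text \<open>Near an image point f z the certificate can be chosen once and for all: take a basic
  neighborhood G of z on whose closure z is the only preimage of f z, cover its boundary by runs
  whose output sets stay away from f z, and then choose the target set inside a neighborhood
  of f z separated from these finitely many output sets.\<close>

lemma covers_near_image:
  assumes z: "z \<in> U"
  shows "\<exists>d M0 n0. derivation d \<and> near_cells (f z) (\<lambda>N i j. \<forall>d' M n.
    set d \<subseteq> set d' \<longrightarrow> M0 \<le> M \<longrightarrow> n0 \<le> n \<longrightarrow> covers_cell e (xs n) (ps n) d' M N i j)"
proof -
  obtain T where T: "open T" "z \<in> T" "T \<subseteq> U" "\<And>w. w \<in> T \<Longrightarrow> f w = f z \<Longrightarrow> w = z"
    using isolated_preimages[OF mero nonconst openU UD z] by blast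
  obtain G where G: "G \<in> basis" "z \<in> G" "closure G \<subseteq> T" using basis_regular[OF T(1,2)] by blast
  obtain i0 g where g: "G = basic g" "p i0 = Suc g"
    using name_openE[OF G(1)] G(3) T(3) by blast
  \<comment> \<open>Such a point lies in T and differs from z, which is in the open set G; so its
    value differs from f z, and a run confirms this.\<close>
  have bd: "\<exists>d s n0 c S. derivation d \<and> s \<in> set d \<and> (\<forall>n\<ge>n0. run_entry e (xs n) s) \<and>
      \<zeta> \<in> word_set (input_word s) \<and> c \<in> set (output_word s) \<and> c \<noteq> 0 \<and>
      open S \<and> f z \<in> S \<and> closure (basic (c - 1)) \<inter> S = {}"
    if \<zeta>: "\<zeta> \<in> closure G - G" for \<zeta>
  proof -
    have "\<zeta> \<in> D" using \<zeta> G(3) T(3) UD by blast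
    have "f \<zeta> \<noteq> f z" using \<zeta> T(4)[of \<zeta>] G(2,3) by blast
    then obtain A B where AB: "A \<in> basis" "f \<zeta> \<in> A" "B \<in> basis" "f z \<in> B" "closure A \<inter> closure B = {}"
      by (rule basis_separate)
    obtain d s n0 c where "derivation d \<and> s \<in> set d \<and> (\<forall>n\<ge>n0. run_entry e (xs n) s) \<and>
      \<zeta> \<in> word_set (input_word s) \<and> c \<in> set (output_word s) \<and> c \<noteq> 0 \<and> basic (c - 1) = A"
      using entry_complete[OF \<open>\<zeta> \<in> D\<close> AB(1,2)] by blast
    moreover have "open B" "closure A \<inter> B = {}" using AB basis_open closure_subset[of B] by auto
    ultimately show ?thesis using AB(4)
      by (intro exI[of _ d] exI[of _ s] exI[of _ n0] exI[of _ c] exI[of _ B]) simp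
  qed
  define K where "K = closure G - G"
  have "\<forall>\<zeta>. \<exists>q. \<zeta> \<in> K \<longrightarrow> (case q of (d, s, n0, c, S) \<Rightarrow>
      derivation d \<and> s \<in> set d \<and> (\<forall>n\<ge>n0. run_entry e (xs n) s) \<and>
      \<zeta> \<in> word_set (input_word s) \<and> c \<in> set (output_word s) \<and> c \<noteq> (0::nat) \<and>
      open S \<and> f z \<in> S \<and> closure (basic (c - 1)) \<inter> S = {})"
    using bd unfolding K_def by (simp add: split_paired_Ex)
  from choice[OF this] obtain q where q: "\<And>\<zeta>. \<zeta> \<in> K \<Longrightarrow> (case q \<zeta> of (d, s, n0, c, S) \<Rightarrow>
      derivation d \<and> s \<in> set d \<and> (\<forall>n\<ge>n0. run_entry e (xs n) s) \<and>
      \<zeta> \<in> word_set (input_word s) \<and> c \<in> set (output_word s) \<and> c \<noteq> (0::nat) \<and>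
      open S \<and> f z \<in> S \<and> closure (basic (c - 1)) \<inter> S = {})"
    by blast
  define dd where "dd = (\<lambda>\<zeta>. fst (q \<zeta>))"
  define ss where "ss = (\<lambda>\<zeta>. fst (snd (q \<zeta>)))"
  define nn where "nn = (\<lambda>\<zeta>. fst (snd (snd (q \<zeta>))))"
  define cc where "cc = (\<lambda>\<zeta>. fst (snd (snd (snd (q \<zeta>)))))"
  define SS where "SS = (\<lambda>\<zeta>. snd (snd (snd (snd (q \<zeta>)))))"
  have K: "derivation (dd \<zeta>)" "ss \<zeta> \<in> set (dd \<zeta>)" "\<And>n. nn \<zeta> \<le> n \<Longrightarrow> run_entry e (xs n) (ss \<zeta>)"
      "\<zeta> \<in> word_set (input_word (ss \<zeta>))" "cc \<zeta> \<in> set (output_word (ss \<zeta>))" "cc \<zeta> \<noteq> 0"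
      "open (SS \<zeta>)" "f z \<in> SS \<zeta>" "closure (basic (cc \<zeta> - 1)) \<inter> SS \<zeta> = {}" if "\<zeta> \<in> K" for \<zeta>
    using q[OF that] by (simp_all add: dd_def ss_def nn_def cc_def SS_def case_prod_unfold)
  \<comment> \<open>The uniformity lemma wants a condition at every point of the sphere; off the
    boundary one of the first two alternatives already holds near the point.\<close>
  define Q where "Q = (\<lambda>\<zeta> M a b. cell_inside M a b g \<or> cell_outside M a b g \<or>
    \<zeta> \<in> K \<and> cell_inside_word M a b (input_word (ss \<zeta>)))"
  have "near_cells \<zeta> (Q \<zeta>)" for \<zeta>
  proof -
    consider "\<zeta> \<in> G" | "\<zeta> \<notin> closure G" | "\<zeta> \<in> K" unfolding K_def by blast
    then show ?thesis
    proof cases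
      case 1
      then have "near_cells \<zeta> (\<lambda>M a b. cell_inside M a b g)" using g(1) by (intro near_cell_inside) simp
      then show ?thesis by (rule near_cells_mono) (simp add: Q_def)
    next
      case 2
      then have "near_cells \<zeta> (\<lambda>M a b. cell_outside M a b g)" using g(1) by (intro near_cell_outside) simp
      then show ?thesis by (rule near_cells_mono) (simp add: Q_def)
    next
      case 3
      from near_cell_inside_word[OF K(4)[OF 3]] show ?thesis
        by (rule near_cells_mono) (simp add: Q_def 3)
    qed
  qed
  then obtain C M1 where C: "finite C" and M1: "\<And>M a b. M1 \<le> M \<Longrightarrow> \<exists>\<zeta>\<in>C. Q \<zeta> M a b"
    using near_cells_uniform[of Q] by metis
  \<comment> \<open>Runs were chosen meaningfully only for boundary points.\<close>
  define C' where "C' = C \<inter> K"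
  have C': "finite C'" "C' \<subseteq> K" using C by (auto simp: C'_def)
  have "open (\<Inter>\<zeta>\<in>C'. SS \<zeta>)" "f z \<in> (\<Inter>\<zeta>\<in>C'. SS \<zeta>)" using C' K(7,8) by (auto intro!: open_INT)
  then obtain V where V: "V \<in> basis" "f z \<in> V" "closure V \<subseteq> (\<Inter>\<zeta>\<in>C'. SS \<zeta>)"
    using basis_regular by blast
  have "z \<in> D" using z UD by blast
  obtain d0 s n1 v where s: "derivation d0" "s \<in> set d0" "\<And>n. n1 \<le> n \<Longrightarrow> run_entry e (xs n) s"
      "z \<in> word_set (input_word s)" "v \<in> set (output_word s)" "v \<noteq> 0" "basic (v - 1) = V"
    using entry_complete[OF \<open>z \<in> D\<close> V(1,2)] by blast
  have "near_cells z (\<lambda>M a b. cell_inside M a b g \<and> cell_inside_word M a b (input_word s))"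
    using G(2) g(1) s(4) by (intro near_cells_conj near_cell_inside near_cell_inside_word) simp_all
  then obtain M2 where M2: "\<And>M. M2 \<le> M \<Longrightarrow> common_cell M g (input_word s)"
    unfolding common_cell_def by (rule near_cells_at) blast
  have "\<forall>\<zeta>. \<exists>M3. \<zeta> \<in> C' \<longrightarrow> (\<forall>M\<ge>M3. separated M (cc \<zeta> - 1) (v - 1))"
  proof
    fix \<zeta>
    show "\<exists>M3. \<zeta> \<in> C' \<longrightarrow> (\<forall>M\<ge>M3. separated M (cc \<zeta> - 1) (v - 1))"
    proof (cases "\<zeta> \<in> C'")
      case True
      then have "closure (basic (cc \<zeta> - 1)) \<inter> closure (basic (v - 1)) = {}"
        using K(9)[of \<zeta>] C'(2) V(3) s(7) by blast
      from cells_separate[OF this] obtain M3 where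
        "\<And>M a b. M3 \<le> M \<Longrightarrow> cell_outside M a b (cc \<zeta> - 1) \<or> cell_outside M a b (v - 1)" by blast
      then show ?thesis unfolding separated_def by blast
    qed simp
  qed
  from choice[OF this] obtain M3 where M3: "\<And>\<zeta> M. \<zeta> \<in> C' \<Longrightarrow> M3 \<zeta> \<le> M \<Longrightarrow> separated M (cc \<zeta> - 1) (v - 1)"
    by blast
  define M0 where "M0 = Max (insert M1 (insert M2 (M3 ` C')))"
  have M0: "M1 \<le> M0" "M2 \<le> M0" "\<And>\<zeta>. \<zeta> \<in> C' \<Longrightarrow> M3 \<zeta> \<le> M0" using C'(1) by (auto simp: M0_def simp del: Max_insert intro!: Max_ge)
  \<comment> \<open>\<open>Suc i0\<close> makes the prefix of p long enough to contain the entry at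
    position i0, which lists G.\<close>
  define n0 where "n0 = Max (insert n1 (insert (Suc i0) (nn ` C')))"
  have n0: "n1 \<le> n0" "i0 < n0" "\<And>\<zeta>. \<zeta> \<in> C' \<Longrightarrow> nn \<zeta> \<le> n0"
    using C'(1) by (auto simp: n0_def less_eq_Suc_le simp del: Max_insert intro!: Max_ge)
  have "\<exists>d. derivation d \<and> ss ` C' \<subseteq> set d"
    using C' K(1,2) by (intro derivation_UN) blast+
  then obtain d1 where d1: "derivation d1" "ss ` C' \<subseteq> set d1" by blast
  define d where "d = d0 @ d1"
  have d: "derivation d" "s \<in> set d" "ss ` C' \<subseteq> set d"
    using s(1,2) d1 by (auto simp: d_def derivation_append)
  have "covers_cell e (xs n) (ps n) d' M N i j"
    if "cell_inside N i j (v - 1)" and d': "set d \<subseteq> set d'" and M: "M0 \<le> M" and n: "n0 \<le> n" for N i j d' M n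
  proof -
    have "avoided_on e (xs n) d' M a b (v - 1)"
      if "\<not> cell_inside M a b g" "\<not> cell_outside M a b g" for a b
    proof -
      obtain \<zeta> where "\<zeta> \<in> C" "Q \<zeta> M a b" using M1[of M a b] M M0(1) by auto
      then have \<zeta>: "\<zeta> \<in> C'" "\<zeta> \<in> K" "cell_inside_word M a b (input_word (ss \<zeta>))"
        using that by (auto simp: Q_def C'_def)
      have "separated M (cc \<zeta> - 1) (v - 1)" using M3[OF \<zeta>(1)] M0(3)[OF \<zeta>(1)] M by simp
      moreover have "run_entry e (xs n) (ss \<zeta>)" using K(3)[OF \<zeta>(2)] n0(3)[OF \<zeta>(1)] n by simp
      moreover have "ss \<zeta> \<in> set d'" using d(3) d' \<zeta>(1) by blast
      ultimately show ?thesis unfolding avoided_on_def using \<zeta>(3) K(5,6)[OF \<zeta>(2)] by blast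
    qed
    then have "boundary_avoided e (xs n) d' M g (v - 1)" unfolding boundary_avoided_def by blast
    moreover have "common_cell M g (input_word s)" using M2 M M0(2) by simp
    moreover have "run_entry e (xs n) s" using s(3) n n0(1) by simp
    moreover have "p i0 \<in> set (ps n)" using n n0(2) by (simp add: ps_def)
    then have "Suc g \<in> set (ps n)" by (simp only: g(2))
    moreover have "s \<in> set d'" using d(2) d' by blast
    ultimately show ?thesis unfolding covers_cell_def using s(5,6) that(1)
      by (intro bexI[of _ "Suc g"] conjI bexI[of _ s] bexI[of _ v]) simp_all
  qed
  moreover have "near_cells (f z) (\<lambda>N i j. cell_inside N i j (v - 1))"
    using V(2) s(7) by (intro near_cell_inside) simp
  ultimately have "near_cells (f z) (\<lambda>N i j. \<forall>d' M n. set d \<subseteq> set d' \<longrightarrow> M0 \<le> M \<longrightarrow> n0 \<le> n \<longrightarrow>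
      covers_cell e (xs n) (ps n) d' M N i j)"
    by (elim near_cells_mono) blast
  then show ?thesis using d(1) by blast
qed

text \<open>Each point of the sphere contributes a derivation and thresholds that survive
  enlargement. Compactness leaves finitely many of them, which are merged by concatenation and
  maxima.\<close>

lemma accepts_complete:
  assumes k: "closure (basic k) \<subseteq> f ` U"
  obtains n d N M where "accepts e (xs n) (ps n) k d N M"
proof -
  have "\<exists>q. derivation (fst q) \<and> near_cells w (\<lambda>N i j. cell_outside N i j k \<or>
    (\<forall>d' M n. set (fst q) \<subseteq> set d' \<longrightarrow> fst (snd q) \<le> M \<longrightarrow> snd (snd q) \<le> n \<longrightarrow>
      covers_cell e (xs n) (ps n) d' M N i j))" for w
  proof (cases "w \<in> closure (basic k)")
    case True
    then obtain z where "z \<in> U" "w = f z" using k by blast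
    then obtain d M0 n0 where "derivation d" "near_cells w (\<lambda>N i j. \<forall>d' M n.
      set d \<subseteq> set d' \<longrightarrow> M0 \<le> M \<longrightarrow> n0 \<le> n \<longrightarrow> covers_cell e (xs n) (ps n) d' M N i j)"
      using covers_near_image by blast
    then show ?thesis
      by (intro exI[of _ "(d, M0, n0)"]) (auto elim: near_cells_mono)
  next
    case False
    from near_cell_outside[OF this] show ?thesis
      \<comment> \<open>Away from the closure the cells pass the outside test, so no runs and no
        thresholds are needed.\<close>
      by (intro exI[of _ "([], 0, 0)"]) (auto elim: near_cells_mono simp: derivation_Nil)
  qed
  then have "\<forall>w. \<exists>q. derivation (fst q) \<and> near_cells w (\<lambda>N i j. cell_outside N i j k \<or>
    (\<forall>d' M n. set (fst q) \<subseteq> set d' \<longrightarrow> fst (snd q) \<le> M \<longrightarrow> snd (snd q) \<le> n \<longrightarrow>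
      covers_cell e (xs n) (ps n) d' M N i j))" by (rule allI)
  from choice[OF this] obtain q where q: "\<And>w. derivation (fst (q w))"
    "\<And>w. near_cells w (\<lambda>N i j. cell_outside N i j k \<or>
    (\<forall>d' M n. set (fst (q w)) \<subseteq> set d' \<longrightarrow> fst (snd (q w)) \<le> M \<longrightarrow> snd (snd (q w)) \<le> n \<longrightarrow>
      covers_cell e (xs n) (ps n) d' M N i j))"
    by blast
  obtain C N where C: "finite C" and N: "\<And>N' i j. N \<le> N' \<Longrightarrow> \<exists>w\<in>C. cell_outside N' i j k \<or>
    (\<forall>d' M n. set (fst (q w)) \<subseteq> set d' \<longrightarrow> fst (snd (q w)) \<le> M \<longrightarrow> snd (snd (q w)) \<le> n \<longrightarrow>
      covers_cell e (xs n) (ps n) d' M N' i j)"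
    by (rule near_cells_uniform[OF q(2)]) blast
  obtain ws where ws: "set ws = C" using finite_list[OF C] by blast
  define d where "d = concat (map (\<lambda>w. fst (q w)) ws)"
  define M where "M = Max (insert 0 ((\<lambda>w. fst (snd (q w))) ` C))"
  define n where "n = Max (insert 0 ((\<lambda>w. snd (snd (q w))) ` C))"
  have "set (fst (q w)) \<subseteq> set d" "fst (snd (q w)) \<le> M" "snd (snd (q w)) \<le> n" if "w \<in> C" for w
    using that ws C by (auto simp: d_def M_def n_def)
  then have "cell_outside N i j k \<or> covers_cell e (xs n) (ps n) d M N i j" for i j
    using N[OF order_refl, of i j] by blast
  moreover have "derivation d" unfolding d_def using q(1) by (intro derivation_concat) auto
  ultimately have "accepts e (xs n) (ps n) k d N M" by (simp add: accepts_def)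
  then show thesis by (rule that)
qed

text \<open>The answer at a position does not change as the input grows, so all outputs are prefixes
  of one infinite sequence.\<close>

lemma name_of_image:
  "\<exists>r. (\<forall>n. answers e (xs n) (ps n) = map r [0..<n]) \<and> name_open r (f ` U)"
proof -
  define r where "r = (\<lambda>i. let k = fst (prod_decode i); m = snd (prod_decode i);
      n = fst (prod_decode m); c = dec (snd (prod_decode m))
    in if accepts e (xs n) (ps n) k (fst c) (fst (snd c)) (snd (snd c)) then Suc k else 0)"
  \<comment> \<open>Ensures that the prefix requested at position i has been read as soon as
    position i is printed.\<close>
  have le: "fst (prod_decode (snd (prod_decode i))) \<le> i" for i
    by (metis le_prod_encode_1 le_prod_encode_2 order_trans prod.collapse prod_decode_inverse)
  have t: "take m (xs n) = xs m" "take m (ps n) = ps m" if "m \<le> n" for m n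
    using that by (simp_all add: xs_def ps_def take_map min_def)
  have "answers e (xs n) (ps n) = map r [0..<n]" for n
  proof -
    have "length (ps n) = n" by (simp add: ps_def)
    moreover have "fst (prod_decode (snd (prod_decode i))) \<le> n" if "i < n" for i using le[of i] that by simp
    ultimately show ?thesis by (auto simp: answers_def r_def Let_def t)
  qed
  moreover have "name_open r (f ` U)"
    unfolding name_open_def
  proof (intro equalityI subsetI)
    fix B assume "B \<in> listed r"
    then obtain k i where k: "B = basic k" "r i = Suc k" unfolding listed_def by blast
    then obtain n d N M where "accepts e (xs n) (ps n) k d N M"
      unfolding r_def Let_def by (metis nat.inject nat.distinct(1))
    then show "B \<in> {B \<in> basis. closure B \<subseteq> f ` U}" using accepts_sound k(1) basic_in_basis by blast
  next
    fix B assume "B \<in> {B \<in> basis. closure B \<subseteq> f ` U}"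
    then obtain k where k: "B = basic k" "closure (basic k) \<subseteq> f ` U" using basis_basicE by blast
    obtain n d N M where a: "accepts e (xs n) (ps n) k d N M" using accepts_complete[OF k(2)] by blast
    \<comment> \<open>Surjectivity of the numbering turns the existing certificate into a number met
      by the search.\<close>
    obtain c where "dec c = (d, N, M)" using surj_dec by (metis surjD)
    then have "r (prod_encode (k, prod_encode (n, c))) = Suc k" using a by (simp add: r_def)
    then show "B \<in> listed r" using k(1) unfolding listed_def by blast
  qed
  ultimately show ?thesis by blast
qed

end

theorem theorem2p8:
  shows "\<exists>M. \<forall>f D X e U p.
     meromorphic_hat f D \<and> nonconstant_hat f D \<and> name_fun X e f D \<and>
     open U \<and> U \<subseteq> D \<and> name_open p U \<longrightarrow>
     (\<exists>r. t2_out M [e] [char_seq X, p] r \<and> name_open r (f ` U))"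
proof -
  obtain P where P: "\<And>e x p v. reval P [e, list_encode x, list_encode p] v \<longleftrightarrow> v = list_encode (answers e x p)"
    by (rule machine_for_answers) blast
  show ?thesis
  proof (intro exI[of _ P] allI impI)
    fix f D X e U p
    assume "meromorphic_hat f D \<and> nonconstant_hat f D \<and> name_fun X e f D \<and>
      open U \<and> U \<subseteq> D \<and> name_open p U"
    then interpret meromorphic_names f D U X e p by unfold_locales auto
    obtain r where r: "\<And>n. answers e (xs n) (ps n) = map r [0..<n]" "name_open r (f ` U)"
      using name_of_image by blast
    have "t2_out P [e] [char_seq X, p] r"
      unfolding t2_out_def
    proof (intro conjI allI impI)
      fix n v assume "reval P ([e] @ map (\<lambda>q. list_encode (map q [0..<n])) [char_seq X, p]) v"
      then have "list_decode v = map r [0..<n]" by (simp add: P flip: xs_def ps_def r(1))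
      then show "list_decode v = map r [0..<length (list_decode v)]" by simp
    next
      fix k
      show "\<exists>n v. reval P ([e] @ map (\<lambda>q. list_encode (map q [0..<n])) [char_seq X, p]) v \<and>
        k \<le> length (list_decode v)"
        \<comment> \<open>On k input cells the machine prints exactly k symbols, padding included,
          so the output grows without bound.\<close>
        by (rule exI[of _ k], rule exI[of _ "list_encode (map r [0..<k])"])
           (simp add: P r(1) flip: xs_def ps_def)
    qed
    then show "\<exists>r. t2_out P [e] [char_seq X, p] r \<and> name_open r (f ` U)" using r(2) by blast
  qed
qed

end
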